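(* Let $A$ be a representation-finite Artin algebra. Then $\dim D^b(A\text{-}\mathrm{mod}) \leq 1$.
   Context: $A\text{-}\mathrm{mod}$ denotes the category of finitely generated left $A$-modules, and $D^b(A\text{-}\mathrm{mod})$ is the derived category of bounded complexes over it, a triangulated category. An Artin algebra $A$ is representation-finite if, up to isomorphism, there are only finitely many indecomposable $A$-modules in $A\text{-}\mathrm{mod}$. Let $\mathcal{T}$ be a triangulated category with shift functor $[1]$, and let $\mathcal{I}$ and $\mathcal{J}$ be full subcategories of $\mathcal{T}$. - $\langle \mathcal{I} \rangle$ denotes the smallest full subcategory of $\mathcal{T}$ containing $\mathcal{I}$ and closed under shifts, finite direct sums and direct summands. - $\mathcal{I} \ast \mathcal{J}$ denotes the full subcategory of $\mathcal{T}$ consisting of all objects $M \in \mathcal{T}$ for which there exists a triangle $I \rightarrow M \rightarrow J \rightarrow I[1]$ with $I \in \mathcal{I}$ and $J \in \mathcal{J}$. - $\mathcal{I} \diamond \mathcal{J} := \langle \mathcal{I} \ast \mathcal{J} \rangle$. - Inductively, $\langle \mathcal{I} \rangle_0 := \{0\}$ and $\langle \mathcal{I} \rangle_n := \langle \mathcal{I} \rangle_{n-1} \diamond \langle \mathcal{I} \rangle$ for $n \geq 1$. - For an object $M \in \mathcal{T}$, $\langle M \rangle_n$ means $\langle \mathcal{I} \rangle_n$ where $\mathcal{I}$ is the full subcategory with the single object $M$. - The dimension of $\mathcal{T}$ is $\dim \mathcal{T} := \min\{d \geq 0 \mid \text{there exists } M \in \mathcal{T} \text{ with } \mathcal{T}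 = \langle M \rangle_{d+1}\}$, or $\infty$ if there is no such $M$ for any $d$. *)

theory Defs
  imports "HOL-Algebra.Module" "HOL-Algebra.Ideal" "HOL-Library.Extended_Nat"
begin

section \<open>Modules over a ring that need not be commutative\<close>

text \<open>The library locale \<^locale>\<open>module\<close> requires a commutative ring; these are its
  axioms over an arbitrary ring. As everywhere in HOL-Algebra, the fields \<^const>\<open>mult\<close> and
  \<^const>\<open>one\<close> of the record type \<^typ>\<open>('a, 'b) module\<close> carry no information about a module.\<close>

locale left_module = R?: ring A + M?: abelian_group M
  for A :: "('a, 'r) ring_scheme" and M :: "('a, 'b, 's) module_scheme" (structure) +
  assumes smult_closed:
      "\<lbrakk>a \<in> carrier A; x \<in> carrier M\<rbrakk> \<Longrightarrow> a \<odot>\<^bsub>M\<^esub> x \<in> carrier M"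
    and smult_l_distr:
      "\<lbrakk>a \<in> carrier A; b \<in> carrier A; x \<in> carrier M\<rbrakk>
        \<Longrightarrow> (a \<oplus>\<^bsub>A\<^esub> b) \<odot>\<^bsub>M\<^esub> x = a \<odot>\<^bsub>M\<^esub> x \<oplus>\<^bsub>M\<^esub> b \<odot>\<^bsub>M\<^esub> x"
    and smult_r_distr:
      "\<lbrakk>a \<in> carrier A; x \<in> carrier M; y \<in> carrier M\<rbrakk>
        \<Longrightarrow> a \<odot>\<^bsub>M\<^esub> (x \<oplus>\<^bsub>M\<^esub> y) = a \<odot>\<^bsub>M\<^esub> x \<oplus>\<^bsub>M\<^esub> a \<odot>\<^bsub>M\<^esub> y"
    and smult_assoc1:
      "\<lbrakk>a \<in> carrier A; b \<in> carrier A; x \<in> carrier M\<rbrakk>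
        \<Longrightarrow> (a \<otimes>\<^bsub>A\<^esub> b) \<odot>\<^bsub>M\<^esub> x = a \<odot>\<^bsub>M\<^esub> (b \<odot>\<^bsub>M\<^esub> x)"
    and smult_one: "x \<in> carrier M \<Longrightarrow> \<one>\<^bsub>A\<^esub> \<odot>\<^bsub>M\<^esub> x = x"

definition fin_gen :: "('a, 'r) ring_scheme \<Rightarrow> ('a, 'b) module \<Rightarrow> bool" where
  "fin_gen A M \<longleftrightarrow>
    (\<exists>S. finite S \<and> S \<subseteq> carrier M \<and> (\<forall>N. submodule N A M \<and> S \<subseteq> N \<longrightarrow> N = carrier M))"

lemma fin_genE:
  assumes "fin_gen A M"
  obtains S where "finite S" "S \<subseteq> carrier M"
    "\<And>N. submodule N A M \<Longrightarrow> S \<subseteq> N \<Longrightarrow> N = carrier M"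
  using assms unfolding fin_gen_def by (elim exE conjE) simp

text \<open>Homomorphisms are extensional, so that equality of functions is equality of homomorphisms.\<close>

definition mod_hom ::
  "('a, 'r) ring_scheme \<Rightarrow> ('a, 'b) module \<Rightarrow> ('a, 'c) module \<Rightarrow> ('b \<Rightarrow> 'c) set" where
  "mod_hom A M N = {f \<in> carrier M \<rightarrow>\<^sub>E carrier N.
     (\<forall>x\<in>carrier M. \<forall>y\<in>carrier M. f (x \<oplus>\<^bsub>M\<^esub> y) = f x \<oplus>\<^bsub>N\<^esub> f y) \<and>
     (\<forall>a\<in>carrier A. \<forall>x\<in>carrier M. f (a \<odot>\<^bsub>M\<^esub> x) = a \<odot>\<^bsub>N\<^esub> f x)}"

definition mod_iso :: "('a, 'r) ring_scheme \<Rightarrow> ('a, 'b) module \<Rightarrow> ('a, 'c) module \<Rightarrow> bool" where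
  "mod_iso A M N \<longleftrightarrow> (\<exists>f\<in>mod_hom A M N. bij_betw f (carrier M) (carrier N))"

definition indecomposable :: "('a, 'r) ring_scheme \<Rightarrow> ('a, 'b) module \<Rightarrow> bool" where
  "indecomposable A M \<longleftrightarrow> carrier M \<noteq> {\<zero>\<^bsub>M\<^esub>} \<and>
    (\<forall>N L. submodule N A M \<and> submodule L A M \<and>
        N <+>\<^bsub>M\<^esub> L = carrier M \<and> N \<inter> L = {\<zero>\<^bsub>M\<^esub>} \<longrightarrow> N = {\<zero>\<^bsub>M\<^esub>} \<or> L = {\<zero>\<^bsub>M\<^esub>})"


section \<open>Artin algebras and the category of finitely generated modules\<close>

definition artinian_cring :: "('k, 'r) ring_scheme \<Rightarrow> bool" where
  "artinian_cring K \<longleftrightarrow> cring K \<and>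
    (\<forall>I :: nat \<Rightarrow> 'k set. (\<forall>n. ideal (I n) K \<and> I (Suc n) \<subseteq> I n) \<longrightarrow> (\<exists>n. \<forall>m\<ge>n. I m = I n))"

definition restrict_scalars ::
  "('k \<Rightarrow> 'a) \<Rightarrow> ('a, 'r) ring_scheme \<Rightarrow> ('k, 'a) module" where
  "restrict_scalars \<phi> A =
    \<lparr>carrier = carrier A, monoid.mult = (\<otimes>\<^bsub>A\<^esub>), one = \<one>\<^bsub>A\<^esub>, zero = \<zero>\<^bsub>A\<^esub>, add = (\<oplus>\<^bsub>A\<^esub>),
     smult = (\<lambda>c x. \<phi> c \<otimes>\<^bsub>A\<^esub> x)\<rparr>"

text \<open>\<open>A\<close> is an algebra over the commutative artinian ring \<open>K\<close> through the structure map
  \<open>\<phi>\<close> into the centre of \<open>A\<close>, and is finitely generated as a \<open>K\<close>-module.\<close>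

definition artin_algebra ::
  "('k, 'q) ring_scheme \<Rightarrow> ('k \<Rightarrow> 'a) \<Rightarrow> ('a, 'r) ring_scheme \<Rightarrow> bool" where
  "artin_algebra K \<phi> A \<longleftrightarrow> artinian_cring K \<and> ring A \<and> \<phi> \<in> ring_hom K A \<and>
    (\<forall>c\<in>carrier K. \<forall>x\<in>carrier A. \<phi> c \<otimes>\<^bsub>A\<^esub> x = x \<otimes>\<^bsub>A\<^esub> \<phi> c) \<and>
    fin_gen K (restrict_scalars \<phi> A)"

text \<open>A universe for the elements of finitely generated modules over a ring with elements
  in \<^typ>\<open>'a\<close>: by \<open>fin_gen_in_universe\<close> below, every finitely generated module is isomorphic to
  one with elements in \<open>'a elt\<close>, and pairing makes the universe closed under direct sums.\<close>

datatype 'a elt = Gen 'a | Couple (cfst: "'a elt") (csnd: "'a elt")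

definition fg_modules :: "('a, 'r) ring_scheme \<Rightarrow> ('a, 'a elt) module set" where
  "fg_modules A = {M. left_module A M \<and> fin_gen A M}"

definition rep_finite :: "('a, 'r) ring_scheme \<Rightarrow> bool" where
  "rep_finite A \<longleftrightarrow> (\<exists>S. finite S \<and> S \<subseteq> fg_modules A \<and>
    (\<forall>M\<in>fg_modules A. indecomposable A M \<longrightarrow> (\<exists>N\<in>S. mod_iso A M N)))"

definition mod_prod ::
  "('a, 'a elt) module \<Rightarrow> ('a, 'a elt) module \<Rightarrow> ('a, 'a elt) module" where
  "mod_prod M N =
    \<lparr>carrier = {Couple x y | x y. x \<in> carrier M \<and> y \<in> carrier N},
     monoid.mult = undefined, one = undefined,
     zero = Couple \<zero>\<^bsub>M\<^esub> \<zero>\<^bsub>N\<^esub>,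
     add = (\<lambda>p q. Couple (cfst p \<oplus>\<^bsub>M\<^esub> cfst q) (csnd p \<oplus>\<^bsub>N\<^esub> csnd q)),
     smult = (\<lambda>a p. Couple (a \<odot>\<^bsub>M\<^esub> cfst p) (a \<odot>\<^bsub>N\<^esub> csnd p))\<rparr>"

context left_module
begin

lemma smult_zero_l: "x \<in> carrier M \<Longrightarrow> \<zero>\<^bsub>A\<^esub> \<odot>\<^bsub>M\<^esub> x = \<zero>\<^bsub>M\<^esub>"
  by (metis M.add.l_cancel_one' R.l_zero R.zero_closed smult_closed smult_l_distr)

lemma smult_zero_r: "a \<in> carrier A \<Longrightarrow> a \<odot>\<^bsub>M\<^esub> \<zero>\<^bsub>M\<^esub> = \<zero>\<^bsub>M\<^esub>"
  by (metis M.add.l_cancel_one' M.l_zero M.zero_closed smult_closed smult_r_distr)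

lemma smult_minus_l:
  "a \<in> carrier A \<Longrightarrow> x \<in> carrier M \<Longrightarrow> (\<ominus>\<^bsub>A\<^esub> a) \<odot>\<^bsub>M\<^esub> x = \<ominus>\<^bsub>M\<^esub> (a \<odot>\<^bsub>M\<^esub> x)"
  by (metis M.minus_equality R.a_inv_closed R.l_neg smult_closed smult_l_distr smult_zero_l)

primrec span_list :: "'b list \<Rightarrow> 'b set" where
  "span_list [] = {\<zero>\<^bsub>M\<^esub>}"
| "span_list (s # l) = {a \<odot>\<^bsub>M\<^esub> s \<oplus>\<^bsub>M\<^esub> t | a t. a \<in> carrier A \<and> t \<in> span_list l}"

lemma span_closed: "set l \<subseteq> carrier M \<Longrightarrow> span_list l \<subseteq> carrier M"
  by (induction l) (auto intro!: smult_closed)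

lemma span_zero: "set l \<subseteq> carrier M \<Longrightarrow> \<zero>\<^bsub>M\<^esub> \<in> span_list l"
proof (induction l)
  case (Cons s l)
  have "\<zero>\<^bsub>M\<^esub> = \<zero>\<^bsub>A\<^esub> \<odot>\<^bsub>M\<^esub> s \<oplus>\<^bsub>M\<^esub> \<zero>\<^bsub>M\<^esub>" using Cons by (simp add: smult_zero_l)
  then show ?case using Cons by (auto intro!: exI)
qed simp

lemma span_gen: "set l \<subseteq> carrier M \<Longrightarrow> set l \<subseteq> span_list l"
proof (induction l)
  case (Cons s l)
  have "s = \<one>\<^bsub>A\<^esub> \<odot>\<^bsub>M\<^esub> s \<oplus>\<^bsub>M\<^esub> \<zero>\<^bsub>M\<^esub>" using Cons by (simp add: smult_one)
  then have 1: "s \<in> span_list (s # l)" using Cons span_zero[of l] by auto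
  have "x \<in> span_list (s # l)" if "x \<in> set l" for x
  proof -
    have "x = \<zero>\<^bsub>A\<^esub> \<odot>\<^bsub>M\<^esub> s \<oplus>\<^bsub>M\<^esub> x" using Cons that by (auto simp: smult_zero_l)
    then show ?thesis using Cons that by auto
  qed
  then show ?case using 1 by auto
qed simp

lemma span_add: "set l \<subseteq> carrier M \<Longrightarrow> x \<in> span_list l \<Longrightarrow> y \<in> span_list l \<Longrightarrow> x \<oplus>\<^bsub>M\<^esub> y \<in> span_list l"
proof (induction l arbitrary: x y)
  case (Cons s l)
  from Cons.prems obtain a t b u where
    *: "a \<in> carrier A" "t \<in> span_list l" "x = a \<odot>\<^bsub>M\<^esub> s \<oplus>\<^bsub>M\<^esub> t"
       "b \<in> carrier A" "u \<in> span_list l" "y = b \<odot>\<^bsub>M\<^esub> s \<oplus>\<^bsub>M\<^esub> u" by auto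
  have c: "t \<in> carrier M" "u \<in> carrier M" "s \<in> carrier M"
    using * Cons.prems span_closed[of l] by auto
  have "x \<oplus>\<^bsub>M\<^esub> y = (a \<oplus>\<^bsub>A\<^esub> b) \<odot>\<^bsub>M\<^esub> s \<oplus>\<^bsub>M\<^esub> (t \<oplus>\<^bsub>M\<^esub> u)"
    using * c by (simp add: smult_l_distr smult_closed M.a_ac)
  moreover have "t \<oplus>\<^bsub>M\<^esub> u \<in> span_list l" using Cons * by auto
  ultimately show ?case using * by auto
qed simp

lemma span_smult: "set l \<subseteq> carrier M \<Longrightarrow> c \<in> carrier A \<Longrightarrow> x \<in> span_list l \<Longrightarrow> c \<odot>\<^bsub>M\<^esub> x \<in> span_list l"
proof (induction l arbitrary: x)
  case (Cons s l)
  from Cons.prems obtain a t where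
    *: "a \<in> carrier A" "t \<in> span_list l" "x = a \<odot>\<^bsub>M\<^esub> s \<oplus>\<^bsub>M\<^esub> t" by auto
  have c: "t \<in> carrier M" "s \<in> carrier M"
    using * Cons.prems span_closed[of l] by auto
  have "c \<odot>\<^bsub>M\<^esub> x = (c \<otimes>\<^bsub>A\<^esub> a) \<odot>\<^bsub>M\<^esub> s \<oplus>\<^bsub>M\<^esub> c \<odot>\<^bsub>M\<^esub> t"
    using * c Cons.prems by (simp add: smult_r_distr smult_assoc1 smult_closed)
  moreover have "c \<odot>\<^bsub>M\<^esub> t \<in> span_list l" using Cons * by auto
  ultimately show ?case using * Cons.prems by auto
qed (simp add: smult_zero_r)

lemma submoduleI:
  assumes sub: "H \<subseteq> carrier M" and zero: "\<zero>\<^bsub>M\<^esub> \<in> H"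
    and add: "\<And>x y. x \<in> H \<Longrightarrow> y \<in> H \<Longrightarrow> x \<oplus>\<^bsub>M\<^esub> y \<in> H"
    and smult: "\<And>a x. a \<in> carrier A \<Longrightarrow> x \<in> H \<Longrightarrow> a \<odot>\<^bsub>M\<^esub> x \<in> H"
  shows "submodule H A M"
proof -
  have "\<ominus>\<^bsub>M\<^esub> x \<in> H" if "x \<in> H" for x
    using smult[of "\<ominus>\<^bsub>A\<^esub> \<one>\<^bsub>A\<^esub>" x] that sub
    by (auto simp: smult_minus_l smult_one subset_iff)
  then have "subgroup H (add_monoid M)"
    using sub zero add by (intro subgroup.intro) (simp_all add: a_inv_def)
  then show ?thesis
    using smult by (simp add: submodule_def submodule_axioms_def)
qed

lemma span_submodule: "set l \<subseteq> carrier M \<Longrightarrow> submodule (span_list l) A M"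
  by (rule submoduleI) (auto intro: span_zero span_add span_smult dest: span_closed)

lemma span_inj: "\<exists>g :: 'b \<Rightarrow> 'a elt. inj_on g (span_list l)"
proof (induction l)
  case (Cons s l)
  then obtain g :: "'b \<Rightarrow> 'a elt" where g: "inj_on g (span_list l)" by auto
  have "\<forall>x\<in>span_list (s # l). \<exists>p. fst p \<in> carrier A \<and> snd p \<in> span_list l \<and> x = fst p \<odot>\<^bsub>M\<^esub> s \<oplus>\<^bsub>M\<^esub> snd p"
    by auto
  then obtain p where p: "\<And>x. x\<in>span_list (s # l) \<Longrightarrow> fst (p x) \<in> carrier A \<and> snd (p x) \<in> span_list l \<and> x = fst (p x) \<odot>\<^bsub>M\<^esub> s \<oplus>\<^bsub>M\<^esub> snd (p x)"
    by metis
  have "inj_on (\<lambda>x. Couple (Gen (fst (p x))) (g (snd (p x)))) (span_list (s # l))"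
  proof (rule inj_onI)
    fix x y assume xy: "x \<in> span_list (s # l)" "y \<in> span_list (s # l)"
      and "Couple (Gen (fst (p x))) (g (snd (p x))) = Couple (Gen (fst (p y))) (g (snd (p y)))"
    then have "fst (p x) = fst (p y)" "g (snd (p x)) = g (snd (p y))" by auto
    moreover from this have "snd (p x) = snd (p y)" using inj_onD[OF g] p xy by blast
    ultimately show "x = y" using p[OF xy(1)] p[OF xy(2)] by simp
  qed
  then show ?case by blast
qed simp

end

lemma transport_module:
  fixes M :: "('a, 'b) module" and g :: "'b \<Rightarrow> 'c"
  assumes "left_module A M" "fin_gen A M" "inj_on g (carrier M)"
  shows "\<exists>N :: ('a, 'c) module. left_module A N \<and> fin_gen A N \<and> mod_iso A M N"
proof -
  interpret left_module A M by fact
  define h where "h = inv_into (carrier M) g"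
  have hg [simp]: "h (g x) = x" if "x \<in> carrier M" for x
    using that assms(3) by (simp add: h_def)
  define N :: "('a, 'c) module" where "N = \<lparr>carrier = g ` carrier M, monoid.mult = undefined, one = undefined,
    zero = g \<zero>\<^bsub>M\<^esub>, add = (\<lambda>x y. g (h x \<oplus>\<^bsub>M\<^esub> h y)), smult = (\<lambda>a x. g (a \<odot>\<^bsub>M\<^esub> h x))\<rparr>"
  have N: "carrier N = g ` carrier M" "zero N = g \<zero>\<^bsub>M\<^esub>"
    "\<And>x y. x \<oplus>\<^bsub>N\<^esub> y = g (h x \<oplus>\<^bsub>M\<^esub> h y)" "\<And>a x. a \<odot>\<^bsub>N\<^esub> x = g (a \<odot>\<^bsub>M\<^esub> h x)"
    by (simp_all add: N_def)
  have "abelian_group N"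
  proof (rule abelian_groupI)
    fix x assume "x \<in> carrier N"
    then obtain u where u: "x = g u" "u \<in> carrier M" by (auto simp: N)
    show "\<zero>\<^bsub>N\<^esub> \<oplus>\<^bsub>N\<^esub> x = x" using u by (simp add: N)
    show "\<exists>y\<in>carrier N. y \<oplus>\<^bsub>N\<^esub> x = \<zero>\<^bsub>N\<^esub>"
    proof
      show "g (\<ominus>\<^bsub>M\<^esub> u) \<oplus>\<^bsub>N\<^esub> x = \<zero>\<^bsub>N\<^esub>" using u by (simp add: N M.l_neg)
      show "g (\<ominus>\<^bsub>M\<^esub> u) \<in> carrier N" using u by (simp add: N)
    qed
    fix y assume "y \<in> carrier N"
    then obtain v where v: "y = g v" "v \<in> carrier M" by (auto simp: N)
    show "x \<oplus>\<^bsub>N\<^esub> y \<in> carrier N" using u v by (simp add: N)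
    show "x \<oplus>\<^bsub>N\<^esub> y = y \<oplus>\<^bsub>N\<^esub> x" using u v by (simp add: N M.a_comm)
    fix z assume "z \<in> carrier N"
    then obtain w where w: "z = g w" "w \<in> carrier M" by (auto simp: N)
    show "(x \<oplus>\<^bsub>N\<^esub> y) \<oplus>\<^bsub>N\<^esub> z = x \<oplus>\<^bsub>N\<^esub> (y \<oplus>\<^bsub>N\<^esub> z)" using u v w by (simp add: N M.a_assoc)
  qed (simp add: N)
  then have lm: "left_module A N"
    by (intro left_module.intro R.ring_axioms left_module_axioms.intro)
       (auto simp: N smult_closed smult_l_distr smult_r_distr smult_assoc1 smult_one)
  have iso: "restrict g (carrier M) \<in> mod_hom A M N"
    by (auto simp: mod_hom_def N smult_closed)
  have bij: "bij_betw (restrict g (carrier M)) (carrier M) (carrier N)"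
    using assms(3) by (auto simp: bij_betw_def N inj_on_def)
  from assms(2) obtain S where S: "finite S" "S \<subseteq> carrier M"
    "\<And>L. submodule L A M \<Longrightarrow> S \<subseteq> L \<Longrightarrow> L = carrier M" by (rule fin_genE) blast
  have "fin_gen A N" unfolding fin_gen_def
  proof (intro exI conjI allI impI)
    show "finite (g ` S)" "g ` S \<subseteq> carrier N" using S(1,2) by (auto simp: N)
    fix L assume L: "submodule L A N \<and> g ` S \<subseteq> L"
    then interpret L: submodule L A N by auto
    have Lc: "L \<subseteq> carrier N" using L.subset by simp
    let ?L = "{x \<in> carrier M. g x \<in> L}"
    have z: "g \<zero>\<^bsub>M\<^esub> \<in> L" using L.one_closed by (simp add: N)
    have a: "g (x \<oplus>\<^bsub>M\<^esub> y) \<in> L" if "x \<in> ?L" "y \<in> ?L" for x y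
      using L.m_closed[of "g x" "g y"] that by (simp add: N)
    have s: "g (c \<odot>\<^bsub>M\<^esub> x) \<in> L" if "c \<in> carrier A" "x \<in> ?L" for x c
      using L.smult_closed[of c "g x"] that by (simp add: N)
    have "submodule ?L A M"
      using z a s by (intro submoduleI) (auto simp: smult_closed)
    then have "?L = carrier M" using S(2) L by (intro S(3)) blast+
    then show "L = carrier N" using Lc by (auto simp: N)
  qed
  then show ?thesis using lm iso bij unfolding mod_iso_def by blast
qed

lemma fin_gen_in_universe:
  fixes M :: "('a, 'b) module"
  assumes "left_module A M" "fin_gen A M"
  shows "\<exists>N\<in>fg_modules A. mod_iso A M N"
proof -
  interpret left_module A M by fact
  from assms(2) obtain S where S: "finite S" "S \<subseteq> carrier M"
    "\<And>L. submodule L A M \<Longrightarrow> S \<subseteq> L \<Longrightarrow> L = carrier M" by (rule fin_genE) blast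
  from S(1) obtain l where "set l = S" using finite_list by auto
  then have "span_list l = carrier M"
    using S(2) span_submodule[of l] span_gen[of l] by (intro S(3)) simp_all
  then obtain g :: "'b \<Rightarrow> 'a elt" where "inj_on g (carrier M)" using span_inj[of l] by auto
  from transport_module[OF assms this] show ?thesis by (auto simp: fg_modules_def)
qed

section \<open>Triangulated categories and their dimension\<close>

record ('o, 'm) category =
  Obj :: "'o set"
  Arr :: "'m set"
  Dom :: "'m \<Rightarrow> 'o"
  Cod :: "'m \<Rightarrow> 'o"
  Ident :: "'o \<Rightarrow> 'm"
  Comp :: "'m \<Rightarrow> 'm \<Rightarrow> 'm"

text \<open>The data of a triangulated category: \<open>Shift\<close> and \<open>Shift_arr\<close> are the functor \<open>[1]\<close> on
  objects and morphisms, and \<open>Tri\<close> consists of the distinguished triangles \<open>(u, v, w)\<close>,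
  that is \<open>u : X \<rightarrow> Y\<close>, \<open>v : Y \<rightarrow> Z\<close>, \<open>w : Z \<rightarrow> X[1]\<close>. A full subcategory is given by its set of
  objects.\<close>

record ('o, 'm) tricat = "('o, 'm) category" +
  Shift :: "'o \<Rightarrow> 'o"
  Shift_arr :: "'m \<Rightarrow> 'm"
  Tri :: "('m \<times> 'm \<times> 'm) set"

definition Hom :: "('o, 'm, 's) category_scheme \<Rightarrow> 'o \<Rightarrow> 'o \<Rightarrow> 'm set" where
  "Hom C X Y = {f \<in> Arr C. Dom C f = X \<and> Cod C f = Y}"

definition is_iso :: "('o, 'm, 's) category_scheme \<Rightarrow> 'm \<Rightarrow> bool" where
  "is_iso C f \<longleftrightarrow> f \<in> Arr C \<and> (\<exists>g\<in>Hom C (Cod C f) (Dom C f).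
     Comp C g f = Ident C (Dom C f) \<and> Comp C f g = Ident C (Cod C f))"

definition is_zero :: "('o, 'm, 's) category_scheme \<Rightarrow> 'o \<Rightarrow> bool" where
  "is_zero C Z \<longleftrightarrow> Z \<in> Obj C \<and>
     (\<forall>X\<in>Obj C. (\<exists>!f. f \<in> Hom C Z X) \<and> (\<exists>!f. f \<in> Hom C X Z))"

text \<open>In an additive category the direct sum of two objects is their coproduct.\<close>

definition is_direct_sum :: "('o, 'm, 's) category_scheme \<Rightarrow> 'o \<Rightarrow> 'o \<Rightarrow> 'o \<Rightarrow> bool" where
  "is_direct_sum C S X Y \<longleftrightarrow> S \<in> Obj C \<and> X \<in> Obj C \<and> Y \<in> Obj C \<and>
     (\<exists>i\<in>Hom C X S. \<exists>j\<in>Hom C Y S. \<forall>Z\<in>Obj C. \<forall>f\<in>Hom C X Z. \<forall>g\<in>Hom C Y Z.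
        \<exists>!h. h \<in> Hom C S Z \<and> Comp C h i = f \<and> Comp C h j = g)"

text \<open>\<open>\<langle>I\<rangle>\<close>. The rule \<open>unshift\<close> is closure under \<open>[-1]\<close>; closure under isomorphism is the case
  \<open>X = S \<oplus> 0\<close> of the rules for direct sums and summands.\<close>

inductive_set gen :: "('o, 'm, 's) tricat_scheme \<Rightarrow> 'o set \<Rightarrow> 'o set"
  for T :: "('o, 'm, 's) tricat_scheme" and I :: "'o set" where
  base: "X \<in> I \<Longrightarrow> X \<in> Obj T \<Longrightarrow> X \<in> gen T I"
| shift: "X \<in> gen T I \<Longrightarrow> Shift T X \<in> gen T I"
| unshift: "Shift T X \<in> gen T I \<Longrightarrow> X \<in> Obj T \<Longrightarrow> X \<in> gen T I"
| zero: "is_zero T Z \<Longrightarrow> Z \<in> gen T I"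
| sum: "X \<in> gen T I \<Longrightarrow> Y \<in> gen T I \<Longrightarrow> is_direct_sum T S X Y \<Longrightarrow> S \<in> gen T I"
| summand: "S \<in> gen T I \<Longrightarrow> is_direct_sum T S X Y \<Longrightarrow> X \<in> gen T I"

definition star :: "('o, 'm, 's) tricat_scheme \<Rightarrow> 'o set \<Rightarrow> 'o set \<Rightarrow> 'o set" where
  "star T I J = {M \<in> Obj T. \<exists>(u, v, w)\<in>Tri T. Dom T u \<in> I \<and> Cod T u = M \<and> Cod T v \<in> J}"

definition diamond :: "('o, 'm, 's) tricat_scheme \<Rightarrow> 'o set \<Rightarrow> 'o set \<Rightarrow> 'o set" where
  "diamond T I J = gen T (star T I J)"

primrec gen_n :: "('o, 'm, 's) tricat_scheme \<Rightarrow> 'o set \<Rightarrow> nat \<Rightarrow> 'o set" where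
  "gen_n T I 0 = {Z. is_zero T Z}"
| "gen_n T I (Suc n) = diamond T (gen_n T I n) (gen T I)"

text \<open>On \<^typ>\<open>enat\<close> the infimum of a nonempty set is its minimum, and \<open>Inf {} = \<infinity>\<close>.\<close>

definition tri_dim :: "('o, 'm, 's) tricat_scheme \<Rightarrow> enat" where
  "tri_dim T = Inf {enat d | d. \<exists>M\<in>Obj T. gen_n T {M} (d + 1) = Obj T}"


section \<open>Localization of a category\<close>

text \<open>The Gabriel--Zisman localization \<open>C[W\<inverse>]\<close>: morphisms are zigzags of arrows of \<open>C\<close> and formal
  inverses of arrows in \<open>W\<close>, modulo the congruence generated by the relations of \<open>C\<close> and by
  \<open>Bwd s\<close> being inverse to \<open>Fwd s\<close>. Zigzags are read in the order of travel.\<close>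

datatype 'm step = Fwd 'm | Bwd 'm

inductive zigzag ::
  "('o, 'm, 's) category_scheme \<Rightarrow> 'm set \<Rightarrow> 'o \<Rightarrow> 'm step list \<Rightarrow> 'o \<Rightarrow> bool"
  for C :: "('o, 'm, 's) category_scheme" and W :: "'m set" where
  nil: "X \<in> Obj C \<Longrightarrow> zigzag C W X [] X"
| fwd: "f \<in> Arr C \<Longrightarrow> zigzag C W (Cod C f) p Y \<Longrightarrow> zigzag C W (Dom C f) (Fwd f # p) Y"
| bwd: "s \<in> W \<Longrightarrow> zigzag C W (Dom C s) p Y \<Longrightarrow> zigzag C W (Cod C s) (Bwd s # p) Y"

inductive zz_move ::
  "('o, 'm, 's) category_scheme \<Rightarrow> 'm set \<Rightarrow> 'm step list \<Rightarrow> 'm step list \<Rightarrow> bool"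
  for C :: "('o, 'm, 's) category_scheme" and W :: "'m set" where
  ident: "X \<in> Obj C \<Longrightarrow> zz_move C W [Fwd (Ident C X)] []"
| comp: "f \<in> Arr C \<Longrightarrow> g \<in> Arr C \<Longrightarrow> Dom C g = Cod C f \<Longrightarrow>
    zz_move C W [Fwd f, Fwd g] [Fwd (Comp C g f)]"
| inv_right: "s \<in> W \<Longrightarrow> zz_move C W [Fwd s, Bwd s] []"
| inv_left: "s \<in> W \<Longrightarrow> zz_move C W [Bwd s, Fwd s] []"

inductive zz_equiv ::
  "('o, 'm, 's) category_scheme \<Rightarrow> 'm set \<Rightarrow> 'o \<Rightarrow> 'o \<Rightarrow> 'm step list \<Rightarrow> 'm step list \<Rightarrow> bool"
  for C :: "('o, 'm, 's) category_scheme" and W :: "'m set" and X Y :: 'o where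
  refl: "zigzag C W X p Y \<Longrightarrow> zz_equiv C W X Y p p"
| sym: "zz_equiv C W X Y p q \<Longrightarrow> zz_equiv C W X Y q p"
| trans: "zz_equiv C W X Y p q \<Longrightarrow> zz_equiv C W X Y q r \<Longrightarrow> zz_equiv C W X Y p r"
| move: "zz_move C W u v \<Longrightarrow> zigzag C W X (p @ u @ q) Y \<Longrightarrow> zigzag C W X (p @ v @ q) Y \<Longrightarrow>
    zz_equiv C W X Y (p @ u @ q) (p @ v @ q)"

type_synonym ('o, 'm) loc_arr = "'o \<times> 'm step list set \<times> 'o"

definition zz_class ::
  "('o, 'm, 's) category_scheme \<Rightarrow> 'm set \<Rightarrow> 'o \<Rightarrow> 'm step list \<Rightarrow> 'o \<Rightarrow> ('o, 'm) loc_arr" where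
  "zz_class C W X p Y = (X, {q. zz_equiv C W X Y p q}, Y)"

definition loc ::
  "('o, 'm, 's) category_scheme \<Rightarrow> 'm set \<Rightarrow> ('o, ('o, 'm) loc_arr) category" where
  "loc C W =
    \<lparr>Obj = Obj C,
     Arr = {zz_class C W X p Y | X p Y. zigzag C W X p Y},
     Dom = (\<lambda>(X, P, Y). X),
     Cod = (\<lambda>(X, P, Y). Y),
     Ident = (\<lambda>X. zz_class C W X [] X),
     Comp = (\<lambda>(Y', Q, Z) (X, P, Y). (X, {r. \<exists>p\<in>P. \<exists>q\<in>Q. zz_equiv C W X Z (p @ q) r}, Z))\<rparr>"

definition loc_fun ::
  "('o, 'm, 's) category_scheme \<Rightarrow> 'm set \<Rightarrow> 'm \<Rightarrow> ('o, 'm) loc_arr" where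
  "loc_fun C W f = zz_class C W (Dom C f) [Fwd f] (Cod C f)"

text \<open>The endofunctor of \<open>C[W\<inverse>]\<close> induced by an endofunctor \<open>(F, F')\<close> of \<open>C\<close> that
  preserves \<open>W\<close>, on morphisms.\<close>

definition loc_map ::
  "('o, 'm, 's) category_scheme \<Rightarrow> 'm set \<Rightarrow> ('o \<Rightarrow> 'o) \<Rightarrow> ('m \<Rightarrow> 'm) \<Rightarrow>
    ('o, 'm) loc_arr \<Rightarrow> ('o, 'm) loc_arr" where
  "loc_map C W F F' = (\<lambda>(X, P, Y).
     (F X, {r. \<exists>p\<in>P. zz_equiv C W (F X) (F Y) (map (map_step F') p) r}, F Y))"


section \<open>The bounded derived category\<close>

text \<open>Cochain complexes, with differential \<open>Dif X i\<close> from degree \<open>i\<close> to degree \<open>i + 1\<close>.\<close>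

record ('a, 'b) cpx =
  Term :: "int \<Rightarrow> ('a, 'b) module"
  Dif :: "int \<Rightarrow> 'b \<Rightarrow> 'b"

type_synonym ('a, 'b) cpx_arr = "('a, 'b) cpx \<times> (int \<Rightarrow> 'b \<Rightarrow> 'b) \<times> ('a, 'b) cpx"

definition bounded_complexes :: "('a, 'r) ring_scheme \<Rightarrow> ('a, 'a elt) cpx set" where
  "bounded_complexes A = {X.
     (\<forall>i. Term X i \<in> fg_modules A) \<and>
     (\<forall>i. Dif X i \<in> mod_hom A (Term X i) (Term X (i + 1))) \<and>
     (\<forall>i. \<forall>x\<in>carrier (Term X i). Dif X (i + 1) (Dif X i x) = \<zero>\<^bsub>Term X (i + 2)\<^esub>) \<and>
     finite {i. carrier (Term X i) \<noteq> {\<zero>\<^bsub>Term X i\<^esub>}}}"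

definition chain_maps :: "('a, 'r) ring_scheme \<Rightarrow> ('a, 'a elt) cpx_arr set" where
  "chain_maps A = {(X, f, Y). X \<in> bounded_complexes A \<and> Y \<in> bounded_complexes A \<and>
     (\<forall>i. f i \<in> mod_hom A (Term X i) (Term Y i)) \<and>
     (\<forall>i. \<forall>x\<in>carrier (Term X i). f (i + 1) (Dif X i x) = Dif Y i (f i x))}"

definition Ch :: "('a, 'r) ring_scheme \<Rightarrow> (('a, 'a elt) cpx, ('a, 'a elt) cpx_arr) category" where
  "Ch A =
    \<lparr>Obj = bounded_complexes A,
     Arr = chain_maps A,
     Dom = (\<lambda>(X, f, Y). X),
     Cod = (\<lambda>(X, f, Y). Y),
     Ident = (\<lambda>X. (X, \<lambda>i. \<lambda>x\<in>carrier (Term X i). x, X)),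
     Comp = (\<lambda>(Y', g, Z) (X, f, Y). (X, \<lambda>i. compose (carrier (Term X i)) (g i) (f i), Z))\<rparr>"

definition cycles :: "('a, 'b) cpx \<Rightarrow> int \<Rightarrow> 'b set" where
  "cycles X i = {x \<in> carrier (Term X i). Dif X i x = \<zero>\<^bsub>Term X (i + 1)\<^esub>}"

definition boundaries :: "('a, 'b) cpx \<Rightarrow> int \<Rightarrow> 'b set" where
  "boundaries X i = Dif X (i - 1) ` carrier (Term X (i - 1))"

definition cohomology :: "('a, 'b) cpx \<Rightarrow> int \<Rightarrow> 'b set set" where
  "cohomology X i = (\<lambda>z. boundaries X i +>\<^bsub>Term X i\<^esub> z) ` cycles X i"

text \<open>For a chain map \<open>f\<close> this sends the class of a cycle \<open>z\<close> to the class of \<open>f z\<close>.\<close>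

definition cohomology_map :: "('a, 'b) cpx_arr \<Rightarrow> int \<Rightarrow> 'b set \<Rightarrow> 'b set" where
  "cohomology_map = (\<lambda>(X, f, Y) i c. boundaries Y i <+>\<^bsub>Term Y i\<^esub> (f i ` c))"

definition quasi_isos :: "('a, 'r) ring_scheme \<Rightarrow> ('a, 'a elt) cpx_arr set" where
  "quasi_isos A = {(X, f, Y) \<in> chain_maps A.
     \<forall>i. bij_betw (cohomology_map (X, f, Y) i) (cohomology X i) (cohomology Y i)}"

definition cpx_shift :: "('a, 'b) cpx \<Rightarrow> ('a, 'b) cpx" where
  "cpx_shift X =
    \<lparr>Term = (\<lambda>i. Term X (i + 1)),
     Dif = (\<lambda>i. \<lambda>x\<in>carrier (Term X (i + 1)). \<ominus>\<^bsub>Term X (i + 2)\<^esub> Dif X (i + 1) x)\<rparr>"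

definition cpx_shift_arr :: "('a, 'b) cpx_arr \<Rightarrow> ('a, 'b) cpx_arr" where
  "cpx_shift_arr = (\<lambda>(X, f, Y). (cpx_shift X, \<lambda>i. f (i + 1), cpx_shift Y))"

definition cone :: "('a, 'a elt) cpx_arr \<Rightarrow> ('a, 'a elt) cpx" where
  "cone = (\<lambda>(X, f, Y).
    \<lparr>Term = (\<lambda>i. mod_prod (Term X (i + 1)) (Term Y i)),
     Dif = (\<lambda>i. \<lambda>p\<in>carrier (mod_prod (Term X (i + 1)) (Term Y i)).
       Couple (\<ominus>\<^bsub>Term X (i + 2)\<^esub> Dif X (i + 1) (cfst p))
              (f (i + 1) (cfst p) \<oplus>\<^bsub>Term Y (i + 1)\<^esub> Dif Y i (csnd p)))\<rparr>)"

definition cone_in :: "('a, 'a elt) cpx_arr \<Rightarrow> ('a, 'a elt) cpx_arr" where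
  "cone_in = (\<lambda>(X, f, Y).
    (Y, \<lambda>i. \<lambda>y\<in>carrier (Term Y i). Couple \<zero>\<^bsub>Term X (i + 1)\<^esub> y, cone (X, f, Y)))"

definition cone_out :: "('a, 'a elt) cpx_arr \<Rightarrow> ('a, 'a elt) cpx_arr" where
  "cone_out = (\<lambda>(X, f, Y).
    (cone (X, f, Y), \<lambda>i. \<lambda>p\<in>carrier (Term (cone (X, f, Y)) i). cfst p, cpx_shift X))"

definition Db_cat :: "('a, 'r) ring_scheme \<Rightarrow>
    (('a, 'a elt) cpx, (('a, 'a elt) cpx, ('a, 'a elt) cpx_arr) loc_arr) category" where
  "Db_cat A = loc (Ch A) (quasi_isos A)"

definition Db_shift_arr :: "('a, 'r) ring_scheme \<Rightarrow>
    (('a, 'a elt) cpx, ('a, 'a elt) cpx_arr) loc_arr \<Rightarrow>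
    (('a, 'a elt) cpx, ('a, 'a elt) cpx_arr) loc_arr" where
  "Db_shift_arr A = loc_map (Ch A) (quasi_isos A) cpx_shift cpx_shift_arr"

text \<open>The distinguished triangles are those isomorphic in the derived category to the triangle
  \<open>X \<rightarrow> Y \<rightarrow> cone f \<rightarrow> X[1]\<close> of a chain map \<open>f : X \<rightarrow> Y\<close>.\<close>

definition Db_triangles :: "('a, 'r) ring_scheme \<Rightarrow>
    ((('a, 'a elt) cpx, ('a, 'a elt) cpx_arr) loc_arr \<times>
     (('a, 'a elt) cpx, ('a, 'a elt) cpx_arr) loc_arr \<times>
     (('a, 'a elt) cpx, ('a, 'a elt) cpx_arr) loc_arr) set" where
  "Db_triangles A =
    (let D = Db_cat A; Q = loc_fun (Ch A) (quasi_isos A)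
     in {(u, v, w). u \<in> Arr D \<and> v \<in> Arr D \<and> w \<in> Arr D \<and>
          Dom D v = Cod D u \<and> Dom D w = Cod D v \<and> Cod D w = cpx_shift (Dom D u) \<and>
          (\<exists>f\<in>chain_maps A. \<exists>a b c. is_iso D a \<and> is_iso D b \<and> is_iso D c \<and>
             a \<in> Hom D (Dom D u) (Dom (Ch A) f) \<and>
             b \<in> Hom D (Cod D u) (Cod (Ch A) f) \<and>
             c \<in> Hom D (Cod D v) (cone f) \<and>
             Comp D b u = Comp D (Q f) a \<and>
             Comp D c v = Comp D (Q (cone_in f)) b \<and>
             Comp D (Db_shift_arr A a) w = Comp D (Q (cone_out f)) c)})"

definition Db :: "('a, 'r) ring_scheme \<Rightarrow>
    (('a, 'a elt) cpx, (('a, 'a elt) cpx, ('a, 'a elt) cpx_arr) loc_arr) tricat" where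
  "Db A = category.extend (Db_cat A)
    \<lparr>Shift = cpx_shift, Shift_arr = Db_shift_arr A, Tri = Db_triangles A\<rparr>"

end

theory Submission
  imports Defs
begin

text \<open>Let \<open>X\<close> be a bounded complex with differential \<open>d\<close>, and let \<open>B\<close> be its subcomplex of
  boundaries. Both \<open>B\<close> and \<open>X / B\<close> have zero differential: \<open>d\<close> kills boundaries, and every value of
  \<open>d\<close> is a boundary. So each of them is a finite direct sum of shifts of stalk complexes of finitely
  generated modules. As the cone of \<open>B \<rightarrow> X\<close> is quasi-isomorphic to \<open>X / B\<close>, there is a triangle
  \<open>B \<rightarrow> X \<rightarrow> X / B \<rightarrow> B[1]\<close> (\<open>boundaries_triangle\<close>). Let \<open>M\<close> be the direct sum of representatives of
  the finitely many indecomposables. Every finitely generated module is a finite direct sum of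
  indecomposables, so \<open>B\<close> and \<open>X / B\<close> lie in \<open>\<langle>M\<rangle>\<close>, and \<open>X\<close> lies in \<open>\<langle>M\<rangle>\<^sub>2\<close>. Taking boundaries instead
  of cycles means that only images and quotients of finitely generated modules occur, and these are
  finitely generated over any ring.

  Decomposition into indecomposables rests on the descending chain condition, which passes from \<open>K\<close>
  to \<open>A\<close> and on to all finitely generated \<open>A\<close>-modules (\<open>artin_algebra_dcc\<close>, \<open>fg_module_induct\<close>).

  Direct sums are computed in the category of complexes, so the argument needs that they remain
  coproducts after quasi-isomorphisms are inverted (\<open>loc_is_direct_sum\<close>). This holds in every
  localization \<open>C[W\<inverse>]\<close> in which \<open>W\<close> is closed under coproducts: functors preserving \<open>W\<close> and natural
  transformations between them act on zigzags (\<open>naturality\<close>), and the coproduct functors and the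
  codiagonal provide existence and uniqueness of copairings of zigzags.\<close>

section \<open>The calculus of zigzags\<close>

locale cat =
  fixes C :: "('o, 'm, 's) category_scheme"
  assumes Dom_Obj: "f \<in> Arr C \<Longrightarrow> Dom C f \<in> Obj C"
    and Cod_Obj: "f \<in> Arr C \<Longrightarrow> Cod C f \<in> Obj C"
    and Ident_Hom: "X \<in> Obj C \<Longrightarrow> Ident C X \<in> Hom C X X"
    and Comp_Hom: "f \<in> Hom C X Y \<Longrightarrow> g \<in> Hom C Y Z \<Longrightarrow> Comp C g f \<in> Hom C X Z"
    and Comp_assoc: "f \<in> Hom C X Y \<Longrightarrow> g \<in> Hom C Y Z \<Longrightarrow> h \<in> Hom C Z V \<Longrightarrow>
      Comp C h (Comp C g f) = Comp C (Comp C h g) f"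
    and Comp_Ident_left: "f \<in> Hom C X Y \<Longrightarrow> Comp C (Ident C Y) f = f"
    and Comp_Ident_right: "f \<in> Hom C X Y \<Longrightarrow> Comp C f (Ident C X) = f"

locale cat_loc = cat C for C :: "('o, 'm, 's) category_scheme" +
  fixes W :: "'m set"
  assumes W_Arr: "W \<subseteq> Arr C"
    and Ident_W: "X \<in> Obj C \<Longrightarrow> Ident C X \<in> W"
begin

abbreviation zz where "zz \<equiv> zigzag C W"
abbreviation eqv where "eqv \<equiv> zz_equiv C W"

lemma Hom_Obj: "f \<in> Hom C X Y \<Longrightarrow> X \<in> Obj C" "f \<in> Hom C X Y \<Longrightarrow> Y \<in> Obj C"
  using Dom_Obj Cod_Obj by (auto simp: Hom_def)

lemma zz_Nil_iff [simp]: "zz X [] Y \<longleftrightarrow> X = Y \<and> X \<in> Obj C"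
  by (auto intro: zigzag.intros elim: zigzag.cases)

lemma zz_Fwd_iff: "zz X (Fwd f # p) Y \<longleftrightarrow> f \<in> Arr C \<and> X = Dom C f \<and> zz (Cod C f) p Y"
  by (auto intro: zigzag.intros elim: zigzag.cases)

lemma zz_Bwd_iff: "zz X (Bwd s # p) Y \<longleftrightarrow> s \<in> W \<and> X = Cod C s \<and> zz (Dom C s) p Y"
  by (auto intro: zigzag.intros elim: zigzag.cases)

lemma zz_Obj: "zz X p Y \<Longrightarrow> X \<in> Obj C \<and> Y \<in> Obj C"
  by (induction rule: zigzag.induct) (use W_Arr Dom_Obj Cod_Obj in auto)

lemma zz_append: "zz X p Y \<Longrightarrow> zz Y q Z \<Longrightarrow> zz X (p @ q) Z"
  by (induction rule: zigzag.induct) (auto intro: zigzag.intros)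

lemma zz_Fwd: "f \<in> Hom C X Y \<Longrightarrow> zz X [Fwd f] Y"
  using Cod_Obj by (auto simp: zz_Fwd_iff Hom_def)

lemma zz_Bwd: "s \<in> W \<Longrightarrow> s \<in> Hom C X Y \<Longrightarrow> zz Y [Bwd s] X"
  using Dom_Obj by (auto simp: zz_Bwd_iff Hom_def)

lemma eqv_zz: "eqv X Y p q \<Longrightarrow> zz X p Y \<and> zz X q Y"
  by (induction rule: zz_equiv.induct) auto

lemma eqv_appendR:
  assumes "eqv X Y p p'" "zz Y q Z"
  shows "eqv X Z (p @ q) (p' @ q)"
  using assms(1)
proof (induction rule: zz_equiv.induct)
  case (refl p)
  then show ?case using assms(2) by (intro zz_equiv.refl zz_append)
next
  case (move u v p r)
  from zz_equiv.move[OF move(1), of X p "r @ q" Z]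
  show ?case using zz_append[OF move(2) assms(2)] zz_append[OF move(3) assms(2)] by simp
qed (blast intro: zz_equiv.intros)+

lemma eqv_appendL:
  assumes "eqv X Y p p'" "zz V q X"
  shows "eqv V Y (q @ p) (q @ p')"
  using assms(1)
proof (induction rule: zz_equiv.induct)
  case (refl p)
  then show ?case using assms(2) by (intro zz_equiv.refl) (rule zz_append)
next
  case (move u v p r)
  from zz_equiv.move[OF move(1), of V "q @ p" "r" Y]
  show ?case using zz_append[OF assms(2) move(2)] zz_append[OF assms(2) move(3)] by simp
qed (blast intro: zz_equiv.intros)+

lemma eqv_append: "eqv X Y p p' \<Longrightarrow> eqv Y Z q q' \<Longrightarrow> eqv X Z (p @ q) (p' @ q')"
  by (meson eqv_appendL eqv_appendR eqv_zz zz_equiv.trans)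

lemma eqv_context: "eqv Y Z u v \<Longrightarrow> zz X p Y \<Longrightarrow> zz Z q V \<Longrightarrow> eqv X V (p @ u @ q) (p @ v @ q)"
  by (meson eqv_appendL eqv_appendR)

lemma eqv_Ident: "X \<in> Obj C \<Longrightarrow> eqv X X [Fwd (Ident C X)] []"
  using zz_equiv.move[OF zz_move.ident, of X C W X "[]" "[]" X] zz_Fwd[OF Ident_Hom] by simp

lemma eqv_Comp:
  assumes "f \<in> Hom C X Y" "g \<in> Hom C Y Z"
  shows "eqv X Z [Fwd f, Fwd g] [Fwd (Comp C g f)]"
  using zz_equiv.move[OF zz_move.comp, of f C g W X "[]" "[]" Z] assms
    zz_append[OF zz_Fwd zz_Fwd, OF assms] zz_Fwd[OF Comp_Hom[OF assms]] by (simp add: Hom_def)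

lemma eqv_square:
  assumes "f \<in> Hom C X Y" "g \<in> Hom C Y Z" "f' \<in> Hom C X Y'" "g' \<in> Hom C Y' Z"
    "Comp C g f = Comp C g' f'"
  shows "eqv X Z [Fwd f, Fwd g] [Fwd f', Fwd g']"
  using eqv_Comp[OF assms(1,2)] eqv_Comp[OF assms(3,4)] assms(5)
  by (metis zz_equiv.sym zz_equiv.trans)

lemma eqv_Fwd_Bwd:
  assumes "s \<in> W" "s \<in> Hom C X Y"
  shows "eqv X X [Fwd s, Bwd s] []"
  using zz_equiv.move[OF zz_move.inv_right, of s W C X "[]" "[]" X] assms
    zz_append[OF zz_Fwd zz_Bwd] Hom_Obj by fastforce

lemma eqv_Bwd_Fwd:
  assumes "s \<in> W" "s \<in> Hom C X Y"
  shows "eqv Y Y [Bwd s, Fwd s] []"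
  using zz_equiv.move[OF zz_move.inv_left, of s W C Y "[]" "[]" Y] assms
    zz_append[OF zz_Bwd zz_Fwd] Hom_Obj by fastforce

section \<open>Functors and natural transformations on zigzags\<close>

text \<open>Functors of this kind act on zigzags step by step, and so descend to the localization.\<close>

definition endo :: "('o \<Rightarrow> 'o) \<Rightarrow> ('m \<Rightarrow> 'm) \<Rightarrow> bool" where
  "endo F F' \<longleftrightarrow> (\<forall>X\<in>Obj C. F X \<in> Obj C \<and> F' (Ident C X) = Ident C (F X)) \<and>
    (\<forall>X Y f. f \<in> Hom C X Y \<longrightarrow> F' f \<in> Hom C (F X) (F Y)) \<and>
    (\<forall>X Y Z f g. f \<in> Hom C X Y \<longrightarrow> g \<in> Hom C Y Z \<longrightarrow> F' (Comp C g f) = Comp C (F' g) (F' f)) \<and>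
    F' ` W \<subseteq> W"

lemma endo_Hom: "endo F F' \<Longrightarrow> f \<in> Hom C X Y \<Longrightarrow> F' f \<in> Hom C (F X) (F Y)"
  by (auto simp: endo_def)

lemma endo_W: "endo F F' \<Longrightarrow> s \<in> W \<Longrightarrow> F' s \<in> W"
  by (auto simp: endo_def)

lemma endo_zz:
  assumes "endo F F'" "zz X p Y"
  shows "zz (F X) (map (map_step F') p) (F Y)"
  using assms(2)
proof (induction rule: zigzag.induct)
  case (nil X)
  then show ?case using assms(1) by (simp add: endo_def)
next
  case (fwd f p Y)
  have "F' f \<in> Hom C (F (Dom C f)) (F (Cod C f))"
    using assms(1) fwd by (auto simp: endo_def Hom_def)
  then show ?case using fwd by (auto simp: zz_Fwd_iff Hom_def)
next
  case (bwd s p Y)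
  have "F' s \<in> Hom C (F (Dom C s)) (F (Cod C s))" "F' s \<in> W"
    using assms(1) bwd W_Arr by (auto simp: endo_def Hom_def)
  then show ?case using bwd by (auto simp: zz_Bwd_iff Hom_def)
qed

lemma endo_move:
  assumes "endo F F'" "zz_move C W u v"
  shows "zz_move C W (map (map_step F') u) (map (map_step F') v)"
  using assms(2)
proof cases
  case (ident X)
  then show ?thesis using assms(1) by (auto simp: endo_def intro: zz_move.intros)
next
  case (comp f g)
  then have f: "f \<in> Hom C (Dom C f) (Cod C f)" and g: "g \<in> Hom C (Cod C f) (Cod C g)"
    by (auto simp: Hom_def)
  have "F' (Comp C g f) = Comp C (F' g) (F' f)" using f g assms(1) by (auto simp: endo_def)
  then show ?thesis using comp endo_Hom[OF assms(1) f] endo_Hom[OF assms(1) g]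
    by (auto simp: Hom_def intro: zz_move.intros)
qed (auto intro!: zz_move.intros endo_W[OF assms(1)])

lemma endo_eqv:
  assumes "endo F F'" "eqv X Y p q"
  shows "eqv (F X) (F Y) (map (map_step F') p) (map (map_step F') q)"
  using assms(2)
proof (induction rule: zz_equiv.induct)
  case (move u v p q)
  show ?case
    using zz_equiv.move[OF endo_move[OF assms(1) move(1)]] move endo_zz[OF assms(1)]
    by (metis map_append)
qed (blast intro: zz_equiv.intros endo_zz[OF assms(1)])+

lemma endo_id: "endo (\<lambda>X. X) (\<lambda>f. f)"
  by (auto simp: endo_def)

lemma map_step_ident [simp]: "map (map_step (\<lambda>f. f)) p = p"
  by (induction p) (simp_all add: step.map_ident)

lemma endo_const: "Z \<in> Obj C \<Longrightarrow> endo (\<lambda>X. Z) (\<lambda>f. Ident C Z)"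
  by (auto simp: endo_def Ident_W Ident_Hom Comp_Ident_left[OF Ident_Hom])

text \<open>With constant functors, the naturality of a coprojection in the summand that does not
  contain its source is an instance of naturality of a transformation between functors.\<close>

lemma const_eqv_Nil: "Z \<in> Obj C \<Longrightarrow> eqv Z Z (map (map_step (\<lambda>f. Ident C Z)) p) []"
proof (induction p)
  case Nil
  then show ?case by (simp add: zz_equiv.refl)
next
  case (Cons a p)
  have B: "eqv Z Z [Bwd (Ident C Z)] []"
    using eqv_appendR[OF eqv_Ident zz_Bwd[OF Ident_W Ident_Hom], of Z]
      eqv_Fwd_Bwd[OF Ident_W Ident_Hom, of Z] Cons.prems zz_equiv.sym zz_equiv.trans
    by (metis append_Cons append_Nil)
  have "eqv Z Z [map_step (\<lambda>f. Ident C Z) a] []"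
    using B eqv_Ident Cons.prems by (cases a) auto
  from eqv_append[OF this Cons.IH[OF Cons.prems]] show ?case by simp
qed

text \<open>On a forward step this is the naturality square. On a backward step \<open>s\<close> the square for \<open>s\<close> is
  conjugated by the formal inverses of \<open>F' s\<close> and \<open>G' s\<close>.\<close>

lemma naturality:
  assumes F: "endo F F'" and G: "endo G G'"
    and \<eta>: "\<And>X. X \<in> Obj C \<Longrightarrow> \<eta> X \<in> Hom C (F X) (G X)"
    and nat: "\<And>X Y f. f \<in> Hom C X Y \<Longrightarrow> Comp C (G' f) (\<eta> X) = Comp C (\<eta> Y) (F' f)"
    and "zz X p Y"
  shows "eqv (F X) (G Y) (Fwd (\<eta> X) # map (map_step G') p) (map (map_step F') p @ [Fwd (\<eta> Y)])"
  using assms(5)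
proof (induction rule: zigzag.induct)
  case (nil X)
  then show ?case using zz_Fwd[OF \<eta>] by (simp add: zz_equiv.refl)
next
  case (fwd f p Y)
  let ?X = "Dom C f" and ?X' = "Cod C f"
  have f: "f \<in> Hom C ?X ?X'" using fwd by (simp add: Hom_def)
  have "eqv (F ?X) (G ?X') [Fwd (\<eta> ?X), Fwd (G' f)] [Fwd (F' f), Fwd (\<eta> ?X')]"
    using f \<eta> endo_Hom[OF F f] endo_Hom[OF G f] nat[OF f] Hom_Obj[OF f]
    by (intro eqv_square) auto
  from eqv_appendR[OF this endo_zz[OF G fwd(2)]]
  have "eqv (F ?X) (G Y) (Fwd (\<eta> ?X) # Fwd (G' f) # map (map_step G') p)
      (Fwd (F' f) # Fwd (\<eta> ?X') # map (map_step G') p)" by simp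
  moreover have "eqv (F ?X) (G Y) (Fwd (F' f) # Fwd (\<eta> ?X') # map (map_step G') p)
      (Fwd (F' f) # map (map_step F') p @ [Fwd (\<eta> Y)])"
    using eqv_appendL[OF fwd.IH zz_Fwd[OF endo_Hom[OF F f]]] by simp
  ultimately show ?case by (auto intro: zz_equiv.trans)
next
  case (bwd s p Y)
  let ?X = "Dom C s" and ?X' = "Cod C s"
  have s: "s \<in> Hom C ?X ?X'" using bwd W_Arr by (auto simp: Hom_def)
  note Fs = endo_Hom[OF F s] endo_W[OF F bwd(1)] and Gs = endo_Hom[OF G s] endo_W[OF G bwd(1)]
  have sq: "eqv (F ?X) (G ?X') [Fwd (\<eta> ?X), Fwd (G' s)] [Fwd (F' s), Fwd (\<eta> ?X')]"
    using s \<eta> Fs Gs nat[OF s] Hom_Obj[OF s] by (intro eqv_square) auto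
  have \<eta>': "\<eta> ?X' \<in> Hom C (F ?X') (G ?X')" "\<eta> ?X \<in> Hom C (F ?X) (G ?X)"
    using \<eta> Hom_Obj[OF s] by auto
  note Fb = zz_Bwd[OF Fs(2,1)] and Gb = zz_Bwd[OF Gs(2,1)]
  note zp = endo_zz[OF G bwd(2)]
  have e1: "eqv (F ?X') (G ?X) [Fwd (\<eta> ?X'), Bwd (G' s)] [Bwd (F' s), Fwd (F' s), Fwd (\<eta> ?X'), Bwd (G' s)]"
    using eqv_appendR[OF eqv_Bwd_Fwd[OF Fs(2,1)] zz_append[OF zz_Fwd[OF \<eta>'(1)] Gb]] 
    by (simp add: zz_equiv.sym)
  have e2: "eqv (F ?X') (G ?X) [Bwd (F' s), Fwd (F' s), Fwd (\<eta> ?X'), Bwd (G' s)]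
     [Bwd (F' s), Fwd (\<eta> ?X), Fwd (G' s), Bwd (G' s)]"
    using eqv_context[OF zz_equiv.sym[OF sq] Fb Gb] by simp
  have e3: "eqv (F ?X') (G ?X) [Bwd (F' s), Fwd (\<eta> ?X), Fwd (G' s), Bwd (G' s)] [Bwd (F' s), Fwd (\<eta> ?X)]"
    using eqv_appendL[OF eqv_Fwd_Bwd[OF Gs(2,1)] zz_append[OF Fb zz_Fwd[OF \<eta>'(2)]]] by simp
  have "eqv (F ?X') (G ?X) [Fwd (\<eta> ?X'), Bwd (G' s)] [Bwd (F' s), Fwd (\<eta> ?X)]"
    using e1 e2 e3 by (blast intro: zz_equiv.trans)
  from eqv_appendR[OF this zp]
  have "eqv (F ?X') (G Y) (Fwd (\<eta> ?X') # Bwd (G' s) # map (map_step G') p)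
      (Bwd (F' s) # Fwd (\<eta> ?X) # map (map_step G') p)" by simp
  moreover have "eqv (F ?X') (G Y) (Bwd (F' s) # Fwd (\<eta> ?X) # map (map_step G') p)
      (Bwd (F' s) # map (map_step F') p @ [Fwd (\<eta> Y)])"
    using eqv_appendL[OF bwd.IH Fb] by simp
  ultimately show ?case by (auto intro: zz_equiv.trans)
qed

section \<open>The localized category\<close>

abbreviation cls where "cls \<equiv> zz_class C W"

lemma zz_class_eq_iff:
  "zz X p Y \<Longrightarrow> cls X p Y = cls X q Y \<longleftrightarrow> eqv X Y p q"
  by (auto simp: zz_class_def set_eq_iff intro: zz_equiv.intros)

lemma loc_Hom: "f \<in> Hom (loc C W) X Y \<longleftrightarrow> (\<exists>p. zz X p Y \<and> f = cls X p Y)"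
  by (auto simp: Hom_def loc_def zz_class_def)

lemma loc_Comp:
  assumes "zz X p Y" "zz Y q Z"
  shows "Comp (loc C W) (cls Y q Z) (cls X p Y) = cls X (p @ q) Z"
proof -
  have "eqv X Z (p @ q) r" if "eqv X Y p p'" "eqv Y Z q q'" "eqv X Z (p' @ q') r" for p' q' r
    using that eqv_append[OF that(1,2)] by (blast intro: zz_equiv.trans)
  then show ?thesis using assms
    by (auto simp: loc_def zz_class_def intro: zz_equiv.refl)
qed

lemma loc_simps [simp]:
  "Obj (loc C W) = Obj C" "Ident (loc C W) X = cls X [] X"
  "Dom (loc C W) (cls X p Y) = X" "Cod (loc C W) (cls X p Y) = Y"
  by (simp_all add: loc_def zz_class_def)

lemma loc_is_iso_Ident:
  assumes "X \<in> Obj C"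
  shows "is_iso (loc C W) (cls X [] X)"
proof -
  have "cls X [] X \<in> Hom (loc C W) X X"
    unfolding loc_Hom using assms by (intro exI[of _ "[]"]) simp
  moreover have "Comp (loc C W) (cls X [] X) (cls X [] X) = cls X [] X"
    using assms by (simp add: loc_Comp)
  ultimately show ?thesis by (auto simp: is_iso_def Hom_def simp del: split_paired_Ex)
qed

lemma loc_is_direct_sumI:
  assumes obj: "zz X i S" "zz Y j S"
    and ex: "\<And>Z f g. zz X f Z \<Longrightarrow> zz Y g Z \<Longrightarrow>
      \<exists>h. zz S h Z \<and> eqv X Z (i @ h) f \<and> eqv Y Z (j @ h) g"
    and un: "\<And>Z h h'. zz S h Z \<Longrightarrow> zz S h' Z \<Longrightarrow> eqv X Z (i @ h) (i @ h') \<Longrightarrow>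
      eqv Y Z (j @ h) (j @ h') \<Longrightarrow> eqv S Z h h'"
  shows "is_direct_sum (loc C W) S X Y"
  unfolding is_direct_sum_def
proof (intro conjI bexI ballI)
  let ?i = "cls X i S" and ?j = "cls Y j S"
  fix Z f g assume "f \<in> Hom (loc C W) X Z" "g \<in> Hom (loc C W) Y Z"
  then obtain p q where p: "zz X p Z" "f = cls X p Z" and q: "zz Y q Z" "g = cls Y q Z"
    by (auto simp: loc_Hom)
  from ex[OF p(1) q(1)] obtain h where h: "zz S h Z" "eqv X Z (i @ h) p" "eqv Y Z (j @ h) q" by blast
  show "\<exists>!h. h \<in> Hom (loc C W) S Z \<and> Comp (loc C W) h ?i = f \<and> Comp (loc C W) h ?j = g"
  proof (rule ex1I)
    show "cls S h Z \<in> Hom (loc C W) S Z \<and>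
      Comp (loc C W) (cls S h Z) ?i = f \<and> Comp (loc C W) (cls S h Z) ?j = g"
      using h p q obj by (auto simp: loc_Hom loc_Comp zz_class_eq_iff zz_append intro: zz_equiv.refl)
    fix k assume k: "k \<in> Hom (loc C W) S Z \<and> Comp (loc C W) k ?i = f \<and> Comp (loc C W) k ?j = g"
    then obtain r where r: "zz S r Z" "k = cls S r Z" by (auto simp: loc_Hom)
    have "eqv X Z (i @ r) p" "eqv Y Z (j @ r) q"
      using k r obj p q by (auto simp: loc_Comp zz_class_eq_iff zz_append)
    then have "eqv S Z r h"
      using h by (intro un[OF r(1) h(1)]) (blast intro: zz_equiv.intros)+
    then show "k = cls S h Z" using r by (simp add: zz_class_eq_iff)
  qed
qed (use obj zz_Obj in \<open>auto simp: loc_Hom\<close>)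

text \<open>An arrow from an initial object into the target of \<open>s\<close> factors through \<open>s\<close>, so a backward
  step along \<open>s\<close> cancels.\<close>

lemma initial_zigzag:
  assumes init: "\<And>X. X \<in> Obj C \<Longrightarrow> \<exists>!f. f \<in> Hom C O' X" and "zz X p Y" "f \<in> Hom C O' X" "g \<in> Hom C O' Y"
  shows "eqv O' Y (Fwd f # p) [Fwd g]"
  using assms(2,3,4)
proof (induction arbitrary: f rule: zigzag.induct)
  case (nil X)
  then have "f = g" using init by blast
  then show ?case using nil by (auto intro!: zz_equiv.refl zz_Fwd)
next
  case (fwd h p Y)
  have h: "h \<in> Hom C (Dom C h) (Cod C h)" using fwd by (auto simp: Hom_def)
  have "eqv O' Y (Fwd f # Fwd h # p) (Fwd (Comp C h f) # p)"
    using eqv_appendR[OF eqv_Comp[OF fwd.prems(1) h] fwd(2)] by simp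
  with fwd.IH[OF Comp_Hom[OF fwd.prems(1) h] fwd.prems(2)] show ?case by (blast intro: zz_equiv.trans)
next
  case (bwd s p Y)
  have s: "s \<in> Hom C (Dom C s) (Cod C s)" using bwd W_Arr by (auto simp: Hom_def)
  obtain f' where f': "f' \<in> Hom C O' (Dom C s)" using init Hom_Obj[OF s] by blast
  have "f = Comp C s f'" using init Hom_Obj[OF s] Comp_Hom[OF f' s] bwd.prems by blast
  then have "eqv O' (Cod C s) [Fwd f] [Fwd f', Fwd s]"
    using eqv_Comp[OF f' s] by (simp add: zz_equiv.sym)
  from eqv_appendR[OF this zz_Bwd[OF bwd(1) s]]
  have "eqv O' (Dom C s) [Fwd f, Bwd s] [Fwd f', Fwd s, Bwd s]" by simp
  moreover have "eqv O' (Dom C s) [Fwd f', Fwd s, Bwd s] [Fwd f']"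
    using eqv_appendL[OF eqv_Fwd_Bwd[OF bwd(1) s] zz_Fwd[OF f']] by simp
  ultimately have "eqv O' (Dom C s) [Fwd f, Bwd s] [Fwd f']" by (blast intro: zz_equiv.trans)
  from eqv_appendR[OF this bwd(2)] have "eqv O' Y (Fwd f # Bwd s # p) (Fwd f' # p)" by simp
  with bwd.IH[OF f' bwd.prems(2)] show ?case by (blast intro: zz_equiv.trans)
qed

lemma terminal_zigzag:
  assumes final: "\<And>X. X \<in> Obj C \<Longrightarrow> \<exists>!f. f \<in> Hom C X O'" and "zz X p Y" "f \<in> Hom C X O'" "g \<in> Hom C Y O'"
  shows "eqv X O' (p @ [Fwd g]) [Fwd f]"
  using assms(2,3,4)
proof (induction arbitrary: f rule: zigzag.induct)
  case (nil X)
  then have "f = g" using final by blast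
  then show ?case using nil by (auto intro!: zz_equiv.refl zz_Fwd)
next
  case (fwd h p Y)
  have h: "h \<in> Hom C (Dom C h) (Cod C h)" using fwd by (auto simp: Hom_def)
  obtain f' where f': "f' \<in> Hom C (Cod C h) O'" using final Hom_Obj[OF h] by blast
  have "f = Comp C f' h" using final Hom_Obj[OF h] Comp_Hom[OF h f'] fwd.prems by blast
  then have "eqv (Dom C h) O' [Fwd h, Fwd f'] [Fwd f]" using eqv_Comp[OF h f'] by simp
  then show ?case using eqv_appendL[OF fwd.IH[OF f' fwd.prems(2)] zz_Fwd[OF h]]
    by (auto intro: zz_equiv.trans)
next
  case (bwd s p Y)
  have s: "s \<in> Hom C (Dom C s) (Cod C s)" using bwd W_Arr by (auto simp: Hom_def)
  have fs: "Comp C f s \<in> Hom C (Dom C s) O'" using Comp_Hom[OF s bwd.prems(1)] .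
  have 1: "eqv (Cod C s) O' (Bwd s # p @ [Fwd g]) [Bwd s, Fwd (Comp C f s)]"
    using eqv_appendL[OF bwd.IH[OF fs bwd.prems(2)] zz_Bwd[OF bwd(1) s]] by simp
  have 2: "eqv (Cod C s) O' [Bwd s, Fwd (Comp C f s)] [Bwd s, Fwd s, Fwd f]"
    using eqv_appendL[OF zz_equiv.sym[OF eqv_Comp[OF s bwd.prems(1)]] zz_Bwd[OF bwd(1) s]] by simp
  have 3: "eqv (Cod C s) O' [Bwd s, Fwd s, Fwd f] [Fwd f]"
    using eqv_appendR[OF eqv_Bwd_Fwd[OF bwd(1) s] zz_Fwd[OF bwd.prems(1)]] by simp
  show ?case using 1 2 3 by (auto intro: zz_equiv.trans)
qed

lemma is_zero_initial: "is_zero C Z \<Longrightarrow> X \<in> Obj C \<Longrightarrow> \<exists>!f. f \<in> Hom C Z X"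
  and is_zero_terminal: "is_zero C Z \<Longrightarrow> X \<in> Obj C \<Longrightarrow> \<exists>!f. f \<in> Hom C X Z"
  by (simp_all add: is_zero_def)

lemma zero_zigzag_unique:
  assumes "is_zero C Z" "zz Z p Y" "zz Z q Y"
  shows "eqv Z Y p q"
proof -
  have Z: "Z \<in> Obj C" using assms by (simp add: is_zero_def)
  obtain g where g: "g \<in> Hom C Z Y" using is_zero_initial[OF assms(1)] zz_Obj[OF assms(2)] by blast
  have "eqv Z Y p [Fwd g]" if "zz Z p Y" for p
  proof -
    have "eqv Z Y (Fwd (Ident C Z) # p) p"
      using eqv_appendR[OF eqv_Ident[OF Z] that] by simp
    with initial_zigzag[OF is_zero_initial[OF assms(1)] that Ident_Hom[OF Z] g]
    show ?thesis by (blast intro: zz_equiv.intros)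
  qed
  then show ?thesis using assms by (blast intro: zz_equiv.intros)
qed

lemma zero_zigzag_unique':
  assumes "is_zero C Z" "zz Y p Z" "zz Y q Z"
  shows "eqv Y Z p q"
proof -
  have Z: "Z \<in> Obj C" using assms by (simp add: is_zero_def)
  obtain g where g: "g \<in> Hom C Y Z" using is_zero_terminal[OF assms(1)] zz_Obj[OF assms(2)] by blast
  have "eqv Y Z p [Fwd g]" if "zz Y p Z" for p
  proof -
    have "eqv Y Z (p @ [Fwd (Ident C Z)]) p"
      using eqv_appendL[OF eqv_Ident[OF Z] that] by simp
    with terminal_zigzag[OF is_zero_terminal[OF assms(1)] that g Ident_Hom[OF Z]]
    show ?thesis by (blast intro: zz_equiv.intros)
  qed
  then show ?thesis using assms by (blast intro: zz_equiv.intros)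
qed

lemma loc_is_zero:
  assumes "is_zero C Z"
  shows "is_zero (loc C W) Z"
  unfolding is_zero_def loc_simps
proof (intro conjI ballI)
  show "Z \<in> Obj C" using assms by (simp add: is_zero_def)
  fix X assume X: "X \<in> Obj C"
  obtain f g where f: "f \<in> Hom C Z X" and g: "g \<in> Hom C X Z"
    using is_zero_initial[OF assms X] is_zero_terminal[OF assms X] by blast
  show "\<exists>!f. f \<in> Hom (loc C W) Z X"
    using zz_Fwd[OF f] zero_zigzag_unique[OF assms]
    by (intro ex1I[of _ "cls Z [Fwd f] X"]) (auto simp: loc_Hom zz_class_eq_iff)
  show "\<exists>!f. f \<in> Hom (loc C W) X Z"
    using zz_Fwd[OF g] zero_zigzag_unique'[OF assms]
    by (intro ex1I[of _ "cls X [Fwd g] Z"]) (auto simp: loc_Hom zz_class_eq_iff)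
qed

text \<open>An arrow of \<open>W\<close> becomes invertible, and isomorphic objects differ by a zero summand. In this
  form, closure under direct sums gives closure under quasi-isomorphism.\<close>

lemma loc_is_direct_sum_W:
  assumes s: "s \<in> W" "s \<in> Hom C X S" and Z: "is_zero C Z"
  shows "is_direct_sum (loc C W) X S Z"
proof -
  obtain t where t: "t \<in> Hom C Z X" using is_zero_initial[OF Z] Hom_Obj[OF s(2)] by blast
  show ?thesis
  proof (rule loc_is_direct_sumI)
    show b: "zz S [Bwd s] X" using zz_Bwd s by blast
    show c: "zz Z [Fwd t] X" by (rule zz_Fwd[OF t])
    fix V
    {
      fix f g assume f: "zz S f V" and g: "zz Z g V"
      have h: "zz X (Fwd s # f) V" using zz_append[OF zz_Fwd[OF s(2)] f] by simp
      show "\<exists>h. zz X h V \<and> eqv S V ([Bwd s] @ h) f \<and> eqv Z V ([Fwd t] @ h) g"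
      proof (intro exI conjI)
        show "eqv S V ([Bwd s] @ (Fwd s # f)) f"
          using eqv_appendR[OF eqv_Bwd_Fwd[OF s] f] by simp
        show "eqv Z V ([Fwd t] @ (Fwd s # f)) g"
          using zero_zigzag_unique[OF Z zz_append[OF c h] g] .
      qed (rule h)
    }
    fix h h' assume h: "zz X h V" "zz X h' V" and e: "eqv S V ([Bwd s] @ h) ([Bwd s] @ h')"
    have "eqv X V h (Fwd s # Bwd s # h)" if "zz X h V" for h
      using eqv_appendR[OF zz_equiv.sym[OF eqv_Fwd_Bwd[OF s]] that] by simp
    moreover have "eqv X V (Fwd s # Bwd s # h) (Fwd s # Bwd s # h')"
      using eqv_appendL[OF e zz_Fwd[OF s(2)]] by simp
    ultimately show "eqv X V h h'" using h by (blast intro: zz_equiv.intros)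
  qed
qed

end

section \<open>Coproducts in the localization\<close>

text \<open>The assumption \<open>cop_W\<close> is what makes \<open>X \<oplus> -\<close> and \<open>- \<oplus> Y\<close> act on zigzags.\<close>

locale cat_cop = cat_loc C W for C :: "('o, 'm, 's) category_scheme" and W +
  fixes cop :: "'o \<Rightarrow> 'o \<Rightarrow> 'o" and inl inr :: "'o \<Rightarrow> 'o \<Rightarrow> 'm"
  assumes cop_Obj: "X \<in> Obj C \<Longrightarrow> Y \<in> Obj C \<Longrightarrow> cop X Y \<in> Obj C"
    and inl_Hom: "X \<in> Obj C \<Longrightarrow> Y \<in> Obj C \<Longrightarrow> inl X Y \<in> Hom C X (cop X Y)"
    and inr_Hom: "X \<in> Obj C \<Longrightarrow> Y \<in> Obj C \<Longrightarrow> inr X Y \<in> Hom C Y (cop X Y)"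
    and cop_universal: "f \<in> Hom C X Z \<Longrightarrow> g \<in> Hom C Y Z \<Longrightarrow>
      \<exists>!h. h \<in> Hom C (cop X Y) Z \<and> Comp C h (inl X Y) = f \<and> Comp C h (inr X Y) = g"
    and cop_W: "f \<in> W \<Longrightarrow> g \<in> W \<Longrightarrow> f \<in> Hom C X X' \<Longrightarrow> g \<in> Hom C Y Y' \<Longrightarrow>
      h \<in> Hom C (cop X Y) (cop X' Y') \<Longrightarrow> Comp C h (inl X Y) = Comp C (inl X' Y') f \<Longrightarrow>
      Comp C h (inr X Y) = Comp C (inr X' Y') g \<Longrightarrow> h \<in> W"
begin

definition copair :: "'m \<Rightarrow> 'm \<Rightarrow> 'm" where
  "copair f g = (THE h. h \<in> Hom C (cop (Dom C f) (Dom C g)) (Cod C f) \<and>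
     Comp C h (inl (Dom C f) (Dom C g)) = f \<and> Comp C h (inr (Dom C f) (Dom C g)) = g)"

lemma
  assumes "f \<in> Hom C X Z" "g \<in> Hom C Y Z"
  shows copair_Hom: "copair f g \<in> Hom C (cop X Y) Z"
    and copair_inl: "Comp C (copair f g) (inl X Y) = f"
    and copair_inr: "Comp C (copair f g) (inr X Y) = g"
proof -
  have "Dom C f = X" "Dom C g = Y" "Cod C f = Z" using assms by (auto simp: Hom_def)
  then have "copair f g \<in> Hom C (cop X Y) Z \<and> Comp C (copair f g) (inl X Y) = f \<and>
      Comp C (copair f g) (inr X Y) = g"
    using theI'[OF cop_universal[OF assms]] by (simp add: copair_def)
  then show "copair f g \<in> Hom C (cop X Y) Z" "Comp C (copair f g) (inl X Y) = f"
    "Comp C (copair f g) (inr X Y) = g" by auto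
qed

lemma cop_eqI:
  assumes "h \<in> Hom C (cop X Y) Z" "h' \<in> Hom C (cop X Y) Z" "X \<in> Obj C" "Y \<in> Obj C"
    "Comp C h (inl X Y) = Comp C h' (inl X Y)" "Comp C h (inr X Y) = Comp C h' (inr X Y)"
  shows "h = h'"
  using cop_universal[OF Comp_Hom[OF inl_Hom assms(2)] Comp_Hom[OF inr_Hom assms(2)]] assms by blast

definition cmap :: "'m \<Rightarrow> 'm \<Rightarrow> 'm" where
  "cmap f g = copair (Comp C (inl (Cod C f) (Cod C g)) f) (Comp C (inr (Cod C f) (Cod C g)) g)"

lemma
  assumes "f \<in> Hom C X X'" "g \<in> Hom C Y Y'"
  shows cmap_Hom: "cmap f g \<in> Hom C (cop X Y) (cop X' Y')"
    and cmap_inl: "Comp C (cmap f g) (inl X Y) = Comp C (inl X' Y') f"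
    and cmap_inr: "Comp C (cmap f g) (inr X Y) = Comp C (inr X' Y') g"
proof -
  note o = Hom_Obj[OF assms(1)] Hom_Obj[OF assms(2)]
  have c: "Cod C f = X'" "Cod C g = Y'" using assms by (auto simp: Hom_def)
  note l = Comp_Hom[OF assms(1) inl_Hom[OF o(2,4)]] and r = Comp_Hom[OF assms(2) inr_Hom[OF o(2,4)]]
  show "cmap f g \<in> Hom C (cop X Y) (cop X' Y')"
    "Comp C (cmap f g) (inl X Y) = Comp C (inl X' Y') f"
    "Comp C (cmap f g) (inr X Y) = Comp C (inr X' Y') g"
    using copair_Hom[OF l r] copair_inl[OF l r] copair_inr[OF l r] by (simp_all add: cmap_def c)
qed

lemma copair_cmap:
  assumes "f \<in> Hom C X X'" "g \<in> Hom C Y Y'" "h \<in> Hom C X' Z" "k \<in> Hom C Y' Z"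
  shows "Comp C (copair h k) (cmap f g) = copair (Comp C h f) (Comp C k g)"
proof -
  note o = Hom_Obj[OF assms(1)] Hom_Obj[OF assms(2)]
  note m = cmap_Hom[OF assms(1,2)] and p = copair_Hom[OF assms(3,4)]
  note hf = Comp_Hom[OF assms(1,3)] and kg = Comp_Hom[OF assms(2,4)]
  show ?thesis
  proof (rule cop_eqI[OF Comp_Hom[OF m p] copair_Hom[OF hf kg] o(1,3)])
    show "Comp C (Comp C (copair h k) (cmap f g)) (inl X Y) = Comp C (copair (Comp C h f) (Comp C k g)) (inl X Y)"
      by (simp add: Comp_assoc[OF inl_Hom[OF o(1,3)] m p, symmetric] cmap_inl[OF assms(1,2)]
        Comp_assoc[OF assms(1) inl_Hom[OF o(2,4)] p] copair_inl[OF assms(3,4)] copair_inl[OF hf kg])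
    show "Comp C (Comp C (copair h k) (cmap f g)) (inr X Y) = Comp C (copair (Comp C h f) (Comp C k g)) (inr X Y)"
      by (simp add: Comp_assoc[OF inr_Hom[OF o(1,3)] m p, symmetric] cmap_inr[OF assms(1,2)]
        Comp_assoc[OF assms(2) inr_Hom[OF o(2,4)] p] copair_inr[OF assms(3,4)] copair_inr[OF hf kg])
  qed
qed

lemma cmap_eq_copair:
  "f \<in> Hom C X X' \<Longrightarrow> g \<in> Hom C Y Y' \<Longrightarrow> cmap f g = copair (Comp C (inl X' Y') f) (Comp C (inr X' Y') g)"
  by (auto simp: cmap_def Hom_def)

lemma cmap_Comp:
  assumes "f \<in> Hom C X X'" "g \<in> Hom C Y Y'" "f' \<in> Hom C X' X''" "g' \<in> Hom C Y' Y''"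
  shows "Comp C (cmap f' g') (cmap f g) = cmap (Comp C f' f) (Comp C g' g)"
proof -
  note o = Hom_Obj[OF assms(3)] Hom_Obj[OF assms(4)]
  note l = inl_Hom[OF o(2,4)] and r = inr_Hom[OF o(2,4)]
  show ?thesis
    using copair_cmap[OF assms(1,2) Comp_Hom[OF assms(3) l] Comp_Hom[OF assms(4) r]]
      Comp_assoc[OF assms(1,3) l] Comp_assoc[OF assms(2,4) r]
    by (simp add: cmap_eq_copair[OF assms(3,4)]
      cmap_eq_copair[OF Comp_Hom[OF assms(1,3)] Comp_Hom[OF assms(2,4)]])
qed

lemma cmap_Ident:
  assumes "X \<in> Obj C" "Y \<in> Obj C"
  shows "cmap (Ident C X) (Ident C Y) = Ident C (cop X Y)"
proof (rule cop_eqI[OF cmap_Hom[OF Ident_Hom Ident_Hom] Ident_Hom[OF cop_Obj]])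
  note l = inl_Hom[OF assms] and r = inr_Hom[OF assms]
  show "Comp C (cmap (Ident C X) (Ident C Y)) (inl X Y) = Comp C (Ident C (cop X Y)) (inl X Y)"
    using cmap_inl[OF Ident_Hom Ident_Hom, OF assms] by (simp add: Comp_Ident_left[OF l] Comp_Ident_right[OF l])
  show "Comp C (cmap (Ident C X) (Ident C Y)) (inr X Y) = Comp C (Ident C (cop X Y)) (inr X Y)"
    using cmap_inr[OF Ident_Hom Ident_Hom, OF assms] by (simp add: Comp_Ident_left[OF r] Comp_Ident_right[OF r])
qed (use assms in auto)

lemma endo_cop_left:
  assumes Y: "Y \<in> Obj C"
  shows "endo (\<lambda>X. cop X Y) (\<lambda>f. cmap f (Ident C Y))"
  unfolding endo_def
proof (intro conjI ballI allI impI)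
  fix X X' X'' f g assume fg: "f \<in> Hom C X X'" "g \<in> Hom C X' X''"
  show "cmap (Comp C g f) (Ident C Y) = Comp C (cmap g (Ident C Y)) (cmap f (Ident C Y))"
    using cmap_Comp[OF fg(1) Ident_Hom[OF Y] fg(2) Ident_Hom[OF Y]]
    by (simp add: Comp_Ident_left[OF Ident_Hom[OF Y]])
next
  show "(\<lambda>f. cmap f (Ident C Y)) ` W \<subseteq> W"
  proof clarify
    fix s assume s: "s \<in> W"
    then have h: "s \<in> Hom C (Dom C s) (Cod C s)" using W_Arr by (auto simp: Hom_def)
    note i = Ident_Hom[OF Y]
    show "cmap s (Ident C Y) \<in> W"
      by (rule cop_W[OF s Ident_W[OF Y] h i cmap_Hom[OF h i] cmap_inl[OF h i] cmap_inr[OF h i]])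
  qed
qed (use Y in \<open>auto intro: cop_Obj cmap_Ident cmap_Hom Ident_Hom\<close>)

lemma endo_cop_right:
  assumes X: "X \<in> Obj C"
  shows "endo (cop X) (cmap (Ident C X))"
  unfolding endo_def
proof (intro conjI ballI allI impI)
  fix Y Y' Y'' f g assume fg: "f \<in> Hom C Y Y'" "g \<in> Hom C Y' Y''"
  show "cmap (Ident C X) (Comp C g f) = Comp C (cmap (Ident C X) g) (cmap (Ident C X) f)"
    using cmap_Comp[OF Ident_Hom[OF X] fg(1) Ident_Hom[OF X] fg(2)]
    by (simp add: Comp_Ident_left[OF Ident_Hom[OF X]])
next
  show "cmap (Ident C X) ` W \<subseteq> W"
  proof clarify
    fix s assume s: "s \<in> W"
    then have h: "s \<in> Hom C (Dom C s) (Cod C s)" using W_Arr by (auto simp: Hom_def)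
    note i = Ident_Hom[OF X]
    show "cmap (Ident C X) s \<in> W"
      by (rule cop_W[OF Ident_W[OF X] s i h cmap_Hom[OF i h] cmap_inl[OF i h] cmap_inr[OF i h]])
  qed
qed (use X in \<open>auto intro: cop_Obj cmap_Ident cmap_Hom Ident_Hom\<close>)

definition cofold :: "'o \<Rightarrow> 'm" where
  "cofold Z = copair (Ident C Z) (Ident C Z)"

text \<open>Two zigzags need not have the same shape, so they cannot be paired step by step. Instead one
  runs after the other, through \<open>X \<oplus> Y \<rightarrow> Z \<oplus> Y \<rightarrow> Z \<oplus> Z \<rightarrow> Z\<close>.\<close>

definition zpair :: "'o \<Rightarrow> 'o \<Rightarrow> 'm step list \<Rightarrow> 'm step list \<Rightarrow> 'm step list" where
  "zpair Y Z p q = map (map_step (\<lambda>f. cmap f (Ident C Y))) p @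
     map (map_step (cmap (Ident C Z))) q @ [Fwd (cofold Z)]"

lemma cofold_Hom: "Z \<in> Obj C \<Longrightarrow> cofold Z \<in> Hom C (cop Z Z) Z"
  unfolding cofold_def by (intro copair_Hom Ident_Hom)

lemma zpair_zz:
  assumes "zz X p Z" "zz Y q Z"
  shows "zz (cop X Y) (zpair Y Z p q) Z"
  using endo_zz[OF endo_cop_left assms(1), of Y] endo_zz[OF endo_cop_right assms(2), of Z]
    zz_Obj[OF assms(1)] zz_Obj[OF assms(2)] zz_Fwd[OF cofold_Hom, of Z]
  by (auto simp: zpair_def intro!: zz_append)

lemma zpair_eqv:
  assumes "eqv X Z p p'" "eqv Y Z q q'"
  shows "eqv (cop X Y) Z (zpair Y Z p q) (zpair Y Z p' q')"
proof -
  have o: "X \<in> Obj C" "Y \<in> Obj C" "Z \<in> Obj C"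
    using eqv_zz[OF assms(1)] eqv_zz[OF assms(2)] zz_Obj by blast+
  show ?thesis unfolding zpair_def
    using endo_eqv[OF endo_cop_left[OF o(2)] assms(1)] endo_eqv[OF endo_cop_right[OF o(3)] assms(2)]
      zz_equiv.refl[OF zz_Fwd[OF cofold_Hom[OF o(3)]]]
    by (blast intro: eqv_append)
qed

lemma inl_zpair:
  assumes p: "zz X p Z" and q: "zz Y q Z"
  shows "eqv X Z (Fwd (inl X Y) # zpair Y Z p q) p"
proof -
  have o: "X \<in> Obj C" "Y \<in> Obj C" "Z \<in> Obj C" using zz_Obj p q by blast+
  let ?p = "map (map_step (\<lambda>f. cmap f (Ident C Y))) p" and ?q = "map (map_step (cmap (Ident C Z))) q"
  have 1: "eqv X (cop Z Y) (Fwd (inl X Y) # ?p) (p @ [Fwd (inl Z Y)])"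
    using naturality[OF endo_id endo_cop_left[OF o(2)] _ _ p, of "\<lambda>X. inl X Y"] o
    by (auto simp: inl_Hom cmap_inl Ident_Hom)
  have 2: "eqv Z (cop Z Z) (Fwd (inl Z Y) # ?q) (map (map_step (\<lambda>f. Ident C Z)) q @ [Fwd (inl Z Z)])"
    using naturality[OF endo_const[OF o(3)] endo_cop_right[OF o(3)] _ _ q, of "\<lambda>Y. inl Z Y"] o
    by (auto simp: inl_Hom cmap_inl Ident_Hom)
  have 3: "eqv Z (cop Z Z) (map (map_step (\<lambda>f. Ident C Z)) q @ [Fwd (inl Z Z)]) [Fwd (inl Z Z)]"
    using eqv_appendR[OF const_eqv_Nil zz_Fwd[OF inl_Hom]] o by fastforce
  have 4: "eqv Z Z [Fwd (inl Z Z), Fwd (cofold Z)] []"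
    using eqv_Comp[OF inl_Hom cofold_Hom] eqv_Ident o copair_inl[OF Ident_Hom Ident_Hom]
    by (metis cofold_def zz_equiv.trans)
  have c: "zz (cop Z Z) [Fwd (cofold Z)] Z" using o by (intro zz_Fwd cofold_Hom)
  have q': "zz (cop Z Y) ?q (cop Z Z)" by (rule endo_zz[OF endo_cop_right[OF o(3)] q])
  have "eqv Z Z (Fwd (inl Z Y) # ?q @ [Fwd (cofold Z)]) []"
    using eqv_appendR[OF zz_equiv.trans[OF 2 3] c] 4 by (auto intro: zz_equiv.trans)
  from eqv_appendL[OF this p] eqv_appendR[OF 1 zz_append[OF q' c]]
  show ?thesis by (auto simp: zpair_def intro: zz_equiv.trans)
qed

lemma inr_zpair:
  assumes p: "zz X p Z" and q: "zz Y q Z"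
  shows "eqv Y Z (Fwd (inr X Y) # zpair Y Z p q) q"
proof -
  have o: "X \<in> Obj C" "Y \<in> Obj C" "Z \<in> Obj C" using zz_Obj p q by blast+
  let ?p = "map (map_step (\<lambda>f. cmap f (Ident C Y))) p" and ?q = "map (map_step (cmap (Ident C Z))) q"
  have 1: "eqv Y (cop Z Y) (Fwd (inr X Y) # ?p) (map (map_step (\<lambda>f. Ident C Y)) p @ [Fwd (inr Z Y)])"
    using naturality[OF endo_const[OF o(2)] endo_cop_left[OF o(2)] _ _ p, of "\<lambda>X. inr X Y"] o
    by (auto simp: inr_Hom cmap_inr Ident_Hom)
  have 2: "eqv Y (cop Z Y) (map (map_step (\<lambda>f. Ident C Y)) p @ [Fwd (inr Z Y)]) [Fwd (inr Z Y)]"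
    using eqv_appendR[OF const_eqv_Nil zz_Fwd[OF inr_Hom]] o by fastforce
  have 3: "eqv Y (cop Z Z) (Fwd (inr Z Y) # ?q) (q @ [Fwd (inr Z Z)])"
    using naturality[OF endo_id endo_cop_right[OF o(3)] _ _ q, of "inr Z"] o
    by (auto simp: inr_Hom cmap_inr Ident_Hom)
  have 4: "eqv Z Z [Fwd (inr Z Z), Fwd (cofold Z)] []"
    using eqv_Comp[OF inr_Hom cofold_Hom] eqv_Ident o copair_inr[OF Ident_Hom Ident_Hom]
    by (metis cofold_def zz_equiv.trans)
  have c: "zz (cop Z Z) [Fwd (cofold Z)] Z" using o by (intro zz_Fwd cofold_Hom)
  have q': "zz (cop Z Y) ?q (cop Z Z)" by (rule endo_zz[OF endo_cop_right[OF o(3)] q])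
  have "eqv Y Z (Fwd (inr Z Y) # ?q @ [Fwd (cofold Z)]) q"
    using eqv_appendR[OF 3 c] eqv_appendL[OF 4 q] by (auto intro: zz_equiv.trans)
  with eqv_appendR[OF zz_equiv.trans[OF 1 2] zz_append[OF q' c]]
  show ?thesis by (auto simp: zpair_def intro: zz_equiv.trans)
qed

text \<open>Naturality of the copairing in its target: \<open>f\<close> passes the codiagonal as \<open>f \<oplus> f\<close>, and its
  left component moves to the front because it acts on the summand that \<open>q\<close> leaves alone.\<close>

lemma zpair_Fwd:
  assumes p: "zz X p Z" and q: "zz Y q Z" and f: "f \<in> Hom C Z V"
  shows "eqv (cop X Y) V (zpair Y Z p q @ [Fwd f]) (zpair Y V (p @ [Fwd f]) (q @ [Fwd f]))"
proof -
  have o: "X \<in> Obj C" "Y \<in> Obj C" "Z \<in> Obj C" "V \<in> Obj C" using zz_Obj p q Hom_Obj f by blast+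
  let ?p = "map (map_step (\<lambda>f. cmap f (Ident C Y))) p"
  let ?q = "map (map_step (cmap (Ident C Z))) q" and ?q' = "map (map_step (cmap (Ident C V))) q"
  note I = Ident_Hom and m = cmap_Hom[OF f Ident_Hom[OF o(3)]] cmap_Hom[OF Ident_Hom[OF o(4)] f]
  note F = cofold_Hom[OF o(3)] cofold_Hom[OF o(4)]
  have n: "eqv (cop Z Y) (cop V Z) (Fwd (cmap f (Ident C Y)) # ?q') (?q @ [Fwd (cmap f (Ident C Z))])"
  proof (rule naturality[OF endo_cop_right[OF o(3)] endo_cop_right[OF o(4)] _ _ q,
      where \<eta> = "\<lambda>Y. cmap f (Ident C Y)"])
    fix Y Y' g assume g: "g \<in> Hom C Y Y'"
    then have i: "Ident C Y \<in> Hom C Y Y" "Ident C Y' \<in> Hom C Y' Y'" using Hom_Obj I by blast+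
    show "Comp C (cmap (Ident C V) g) (cmap f (Ident C Y)) = Comp C (cmap f (Ident C Y')) (cmap (Ident C Z) g)"
      using cmap_Comp[OF f i(1) I[OF o(4)] g] cmap_Comp[OF I[OF o(3)] g f i(2)]
      by (simp add: Comp_Ident_left[OF f] Comp_Ident_right[OF f] Comp_Ident_left[OF g] Comp_Ident_right[OF g])
  qed (use f in \<open>auto intro: cmap_Hom I\<close>)
  have "Comp C f (cofold Z) = Comp C (Comp C (cofold V) (cmap (Ident C V) f)) (cmap f (Ident C Z))"
  proof (rule cop_eqI)
    have "Comp C (Comp C f (cofold Z)) (inl Z Z) = f" "Comp C (Comp C f (cofold Z)) (inr Z Z) = f"
      using Comp_assoc[OF inl_Hom[OF o(3,3)] F(1) f] Comp_assoc[OF inr_Hom[OF o(3,3)] F(1) f]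
        copair_inl[OF I[OF o(3)] I[OF o(3)]] copair_inr[OF I[OF o(3)] I[OF o(3)]]
      by (auto simp: cofold_def Comp_Ident_right[OF f])
    moreover have "Comp C (cofold V) (cmap (Ident C V) f) = copair (Ident C V) f"
      using copair_cmap[OF I[OF o(4)] f I[OF o(4)] I[OF o(4)]]
      by (simp add: cofold_def Comp_Ident_left[OF f] Comp_Ident_left[OF I[OF o(4)]])
    moreover have "Comp C (copair (Ident C V) f) (cmap f (Ident C Z)) = copair f f"
      using copair_cmap[OF f I[OF o(3)] I[OF o(4)] f]
      by (simp add: Comp_Ident_left[OF f] Comp_Ident_right[OF f])
    ultimately show "Comp C (Comp C f (cofold Z)) (inl Z Z) =
        Comp C (Comp C (Comp C (cofold V) (cmap (Ident C V) f)) (cmap f (Ident C Z))) (inl Z Z)"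
      "Comp C (Comp C f (cofold Z)) (inr Z Z) =
        Comp C (Comp C (Comp C (cofold V) (cmap (Ident C V) f)) (cmap f (Ident C Z))) (inr Z Z)"
      by (simp_all add: copair_inl[OF f f] copair_inr[OF f f])
    show "Comp C f (cofold Z) \<in> Hom C (cop Z Z) V" by (rule Comp_Hom[OF F(1) f])
    show "Comp C (Comp C (cofold V) (cmap (Ident C V) f)) (cmap f (Ident C Z)) \<in> Hom C (cop Z Z) V"
      using o by (intro Comp_Hom[OF m(1) Comp_Hom[OF m(2) F(2)]])
  qed (use o in auto)
  then have "eqv (cop Z Z) V [Fwd (cofold Z), Fwd f]
      [Fwd (cmap f (Ident C Z)), Fwd (Comp C (cofold V) (cmap (Ident C V) f))]"
    using o by (intro eqv_square[OF F(1) f m(1) Comp_Hom[OF m(2) F(2)]]) auto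
  moreover have "eqv (cop Z Z) V [Fwd (cmap f (Ident C Z)), Fwd (Comp C (cofold V) (cmap (Ident C V) f))]
      [Fwd (cmap f (Ident C Z)), Fwd (cmap (Ident C V) f), Fwd (cofold V)]"
    using eqv_appendL[OF zz_equiv.sym[OF eqv_Comp[OF m(2) F(2)]] zz_Fwd[OF m(1)]] by simp
  ultimately have s: "eqv (cop Z Z) V [Fwd (cofold Z), Fwd f]
      [Fwd (cmap f (Ident C Z)), Fwd (cmap (Ident C V) f), Fwd (cofold V)]" by (rule zz_equiv.trans)
  have p': "zz (cop X Y) ?p (cop Z Y)" by (rule endo_zz[OF endo_cop_left[OF o(2)] p])
  have q': "zz (cop Z Y) ?q (cop Z Z)" by (rule endo_zz[OF endo_cop_right[OF o(3)] q])
  have t: "zz (cop V Z) [Fwd (cmap (Ident C V) f), Fwd (cofold V)] V"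
    using zz_append[OF zz_Fwd[OF m(2)] zz_Fwd[OF F(2)]] o by simp
  have "eqv (cop X Y) V (?p @ ?q @ [Fwd (cofold Z), Fwd f])
      (?p @ ?q @ [Fwd (cmap f (Ident C Z)), Fwd (cmap (Ident C V) f), Fwd (cofold V)])"
    using eqv_appendL[OF eqv_appendL[OF s q'] p'] .
  moreover have "eqv (cop X Y) V (?p @ (?q @ [Fwd (cmap f (Ident C Z))]) @ [Fwd (cmap (Ident C V) f), Fwd (cofold V)])
      (?p @ (Fwd (cmap f (Ident C Y)) # ?q') @ [Fwd (cmap (Ident C V) f), Fwd (cofold V)])"
    by (rule eqv_context[OF zz_equiv.sym[OF n] p' t])
  ultimately show ?thesis by (auto simp: zpair_def intro: zz_equiv.trans)
qed

text \<open>The case of a backward step follows from the case of a forward one, applied to the zigzags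
  already extended by that backward step. Uniqueness of copairings is the special case in which \<open>p\<close>
  and \<open>q\<close> are the coprojections: a zigzag out of the coproduct is the copairing of its restrictions.\<close>

lemma zpair_append:
  assumes "zz Z h V" "zz X p Z" "zz Y q Z"
  shows "eqv (cop X Y) V (zpair Y Z p q @ h) (zpair Y V (p @ h) (q @ h))"
  using assms
proof (induction arbitrary: p q rule: zigzag.induct)
  case (nil Z)
  then show ?case by (simp add: zpair_zz zz_equiv.refl)
next
  case (fwd f h V)
  have f: "f \<in> Hom C (Dom C f) (Cod C f)" using fwd by (auto simp: Hom_def)
  have "eqv (cop X Y) V ((zpair Y (Dom C f) p q @ [Fwd f]) @ h) (zpair Y (Cod C f) (p @ [Fwd f]) (q @ [Fwd f]) @ h)"
    by (rule eqv_appendR[OF zpair_Fwd[OF fwd.prems f] fwd(2)])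
  moreover have "eqv (cop X Y) V (zpair Y (Cod C f) (p @ [Fwd f]) (q @ [Fwd f]) @ h)
      (zpair Y V ((p @ [Fwd f]) @ h) ((q @ [Fwd f]) @ h))"
    by (rule fwd.IH[OF zz_append[OF fwd.prems(1) zz_Fwd[OF f]] zz_append[OF fwd.prems(2) zz_Fwd[OF f]]])
  ultimately show ?case by (auto intro: zz_equiv.trans)
next
  case (bwd s h V)
  let ?Z = "Cod C s" and ?Z' = "Dom C s"
  have s: "s \<in> Hom C ?Z' ?Z" using bwd W_Arr by (auto simp: Hom_def)
  note b = zz_Bwd[OF bwd(1) s]
  note p = zz_append[OF bwd.prems(1) b] and q = zz_append[OF bwd.prems(2) b]
  have e: "eqv U ?Z ((r @ [Bwd s]) @ [Fwd s]) r" if "zz U r ?Z" for U r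
    using eqv_appendL[OF eqv_Bwd_Fwd[OF bwd(1) s] that] by simp
  have "eqv (cop X Y) ?Z (zpair Y ?Z p q) (zpair Y ?Z' (p @ [Bwd s]) (q @ [Bwd s]) @ [Fwd s])"
    using zpair_Fwd[OF p q s] zpair_eqv[OF e[OF bwd.prems(1)] e[OF bwd.prems(2)]]
    by (blast intro: zz_equiv.intros)
  from eqv_appendR[OF this b]
  have "eqv (cop X Y) ?Z' (zpair Y ?Z p q @ [Bwd s])
      (zpair Y ?Z' (p @ [Bwd s]) (q @ [Bwd s]) @ [Fwd s, Bwd s])" by simp
  moreover have "eqv (cop X Y) ?Z' (zpair Y ?Z' (p @ [Bwd s]) (q @ [Bwd s]) @ [Fwd s, Bwd s])
      (zpair Y ?Z' (p @ [Bwd s]) (q @ [Bwd s]))"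
    using eqv_appendL[OF eqv_Fwd_Bwd[OF bwd(1) s] zpair_zz[OF p q]] by simp
  ultimately have "eqv (cop X Y) ?Z' (zpair Y ?Z p q @ [Bwd s]) (zpair Y ?Z' (p @ [Bwd s]) (q @ [Bwd s]))"
    by (rule zz_equiv.trans)
  from eqv_appendR[OF this bwd(2)] bwd.IH[OF p q] show ?case by (auto intro: zz_equiv.trans)
qed

theorem loc_is_direct_sum:
  assumes "is_direct_sum C S X Y"
  shows "is_direct_sum (loc C W) S X Y"
proof -
  from assms obtain i j where o: "S \<in> Obj C" "X \<in> Obj C" "Y \<in> Obj C"
    and i: "i \<in> Hom C X S" and j: "j \<in> Hom C Y S"
    and univ: "\<And>Z f g. Z \<in> Obj C \<Longrightarrow> f \<in> Hom C X Z \<Longrightarrow> g \<in> Hom C Y Z \<Longrightarrow>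
      \<exists>!h. h \<in> Hom C S Z \<and> Comp C h i = f \<and> Comp C h j = g"
    unfolding is_direct_sum_def by blast
  note l = inl_Hom[OF o(2,3)] and r = inr_Hom[OF o(2,3)]
  obtain u where u: "u \<in> Hom C S (cop X Y)" "Comp C u i = inl X Y" "Comp C u j = inr X Y"
    using univ[OF cop_Obj[OF o(2,3)] l r] by blast
  note v = copair_Hom[OF i j]
  have vu: "Comp C (copair i j) u = Ident C S"
  proof -
    have "Comp C (Comp C (copair i j) u) i = i" "Comp C (Comp C (copair i j) u) j = j"
      by (simp_all add: Comp_assoc[OF i u(1) v, symmetric] Comp_assoc[OF j u(1) v, symmetric] u(2,3)
        copair_inl[OF i j] copair_inr[OF i j])
    then show ?thesis
      using univ[OF o(1) i j] Comp_Hom[OF u(1) v] Ident_Hom[OF o(1)] Comp_Ident_left[OF i]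
        Comp_Ident_left[OF j] by blast
  qed
  have ui: "eqv X (cop X Y) [Fwd i, Fwd u] [Fwd (inl X Y)]"
    and uj: "eqv Y (cop X Y) [Fwd j, Fwd u] [Fwd (inr X Y)]"
    using eqv_Comp[OF i u(1)] eqv_Comp[OF j u(1)] u by auto
  show ?thesis
  proof (rule loc_is_direct_sumI)
    show zi: "zz X [Fwd i] S" and zj: "zz Y [Fwd j] S" by (rule zz_Fwd; fact)+
    fix Z
    {
      fix p q assume p: "zz X p Z" and q: "zz Y q Z"
      show "\<exists>h. zz S h Z \<and> eqv X Z ([Fwd i] @ h) p \<and> eqv Y Z ([Fwd j] @ h) q"
      proof (intro exI conjI)
        show "zz S (Fwd u # zpair Y Z p q) Z"
          using zz_append[OF zz_Fwd[OF u(1)] zpair_zz[OF p q]] by simp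
        show "eqv X Z ([Fwd i] @ (Fwd u # zpair Y Z p q)) p"
          using eqv_appendR[OF ui zpair_zz[OF p q]] inl_zpair[OF p q] by (auto intro: zz_equiv.trans)
        show "eqv Y Z ([Fwd j] @ (Fwd u # zpair Y Z p q)) q"
          using eqv_appendR[OF uj zpair_zz[OF p q]] inr_zpair[OF p q] by (auto intro: zz_equiv.trans)
      qed
    }
    have pij: "eqv S S (Fwd u # zpair Y S [Fwd i] [Fwd j]) []"
    proof -
      note I = Ident_Hom
      have m: "cmap i (Ident C Y) \<in> Hom C (cop X Y) (cop S Y)" "cmap (Ident C S) j \<in> Hom C (cop S Y) (cop S S)"
        using cmap_Hom[OF i I[OF o(3)]] cmap_Hom[OF I[OF o(1)] j] .
      note F = cofold_Hom[OF o(1)]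
      have "Comp C (cofold S) (Comp C (cmap (Ident C S) j) (cmap i (Ident C Y))) = copair i j"
        using cmap_Comp[OF i I[OF o(3)] I[OF o(1)] j] copair_cmap[OF i j I[OF o(1)] I[OF o(1)]]
        by (simp add: cofold_def Comp_Ident_left[OF i] Comp_Ident_left[OF j] Comp_Ident_right[OF j])
      then have "eqv (cop X Y) S [Fwd (cmap i (Ident C Y)), Fwd (cmap (Ident C S) j), Fwd (cofold S)] [Fwd (copair i j)]"
        using eqv_appendR[OF eqv_Comp[OF m] zz_Fwd[OF F]] eqv_Comp[OF Comp_Hom[OF m] F]
        by (auto intro: zz_equiv.trans)
      from eqv_appendL[OF this zz_Fwd[OF u(1)]]
      have "eqv S S (Fwd u # zpair Y S [Fwd i] [Fwd j]) [Fwd u, Fwd (copair i j)]" by (simp add: zpair_def)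
      with eqv_Comp[OF u(1) v] eqv_Ident[OF o(1)] vu show ?thesis by (auto intro: zz_equiv.trans)
    qed
    have h: "eqv S Z h (Fwd u # zpair Y Z ([Fwd i] @ h) ([Fwd j] @ h))" if h: "zz S h Z" for h
    proof -
      have "eqv S Z h ((Fwd u # zpair Y S [Fwd i] [Fwd j]) @ h)"
        using eqv_appendR[OF zz_equiv.sym[OF pij] h] by simp
      moreover have "eqv S Z (Fwd u # (zpair Y S [Fwd i] [Fwd j] @ h)) (Fwd u # zpair Y Z ([Fwd i] @ h) ([Fwd j] @ h))"
        using eqv_appendL[OF zpair_append[OF h zi zj] zz_Fwd[OF u(1)]] by simp
      ultimately show ?thesis by (auto intro: zz_equiv.trans)
    qed
    fix h1 h2 assume hh: "zz S h1 Z" "zz S h2 Z" "eqv X Z ([Fwd i] @ h1) ([Fwd i] @ h2)"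
      "eqv Y Z ([Fwd j] @ h1) ([Fwd j] @ h2)"
    have "eqv S Z (Fwd u # zpair Y Z ([Fwd i] @ h1) ([Fwd j] @ h1)) (Fwd u # zpair Y Z ([Fwd i] @ h2) ([Fwd j] @ h2))"
      using eqv_appendL[OF zpair_eqv[OF hh(3,4)] zz_Fwd[OF u(1)]] by simp
    with h[OF hh(1)] h[OF hh(2)] show "eqv S Z h1 h2" by (blast intro: zz_equiv.intros)
  qed
qed

end

section \<open>Modules and homomorphisms\<close>

context abelian_group
begin

lemma a_inv_zero: "\<ominus> \<zero> = \<zero>"
  using minus_equality[of \<zero> \<zero>] by simp

lemma diff_zero: "x \<in> carrier G \<Longrightarrow> x \<ominus> \<zero> = x"
  by (simp add: minus_eq a_inv_zero)

lemma add_diff_add: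
  "x \<in> carrier G \<Longrightarrow> y \<in> carrier G \<Longrightarrow> u \<in> carrier G \<Longrightarrow> v \<in> carrier G \<Longrightarrow>
    (x \<oplus> y) \<ominus> (u \<oplus> v) = (x \<ominus> u) \<oplus> (y \<ominus> v)"
  by (simp add: minus_eq minus_add a_assoc a_lcomm)

lemma add_diff_cancel_left:
  "x \<in> carrier G \<Longrightarrow> y \<in> carrier G \<Longrightarrow> u \<in> carrier G \<Longrightarrow> (x \<oplus> y) \<ominus> (x \<oplus> u) = y \<ominus> u"
  by (simp add: add_diff_add) (simp add: minus_eq r_neg)

lemma diff_add_diff:
  "x \<in> carrier G \<Longrightarrow> y \<in> carrier G \<Longrightarrow> z \<in> carrier G \<Longrightarrow> (x \<ominus> y) \<oplus> (y \<ominus> z) = x \<ominus> z"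
  by (simp add: minus_eq a_assoc r_neg1)

lemma minus_diff: "x \<in> carrier G \<Longrightarrow> y \<in> carrier G \<Longrightarrow> \<ominus> (x \<ominus> y) = y \<ominus> x"
  by (simp add: minus_eq minus_add a_comm)

lemma diff_cross:
  assumes "y \<in> carrier G" "z \<in> carrier G" "y' \<in> carrier G" "z' \<in> carrier G" "y \<oplus> z = y' \<oplus> z'"
  shows "y \<ominus> y' = z' \<ominus> z"
proof -
  have "y \<ominus> y' = (y \<oplus> z) \<ominus> (y' \<oplus> z)"
    using assms(1-4) by (simp add: add_diff_add) (simp add: minus_eq r_neg)
  also have "\<dots> = z' \<ominus> z" using assms(1-4) by (simp add: assms(5) add_diff_cancel_left)
  finally show ?thesis .
qed

lemma diff_zero_imp_eq: "x \<in> carrier G \<Longrightarrow> y \<in> carrier G \<Longrightarrow> x \<ominus> y = \<zero> \<Longrightarrow> x = y"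
  using minus_equality[of x "\<ominus> y"] by (simp add: minus_eq)

end

lemma (in left_module) smult_minus_r:
  assumes "a \<in> carrier A" "x \<in> carrier M"
  shows "a \<odot>\<^bsub>M\<^esub> \<ominus>\<^bsub>M\<^esub> x = \<ominus>\<^bsub>M\<^esub> (a \<odot>\<^bsub>M\<^esub> x)"
proof -
  have "a \<odot>\<^bsub>M\<^esub> \<ominus>\<^bsub>M\<^esub> x \<oplus>\<^bsub>M\<^esub> a \<odot>\<^bsub>M\<^esub> x = \<zero>\<^bsub>M\<^esub>"
    using assms by (simp add: smult_r_distr[symmetric] M.l_neg smult_zero_r)
  then show ?thesis using assms by (simp add: M.minus_equality smult_closed)
qed

lemma mod_homI:
  assumes "\<And>x. x \<in> carrier M \<Longrightarrow> f x \<in> carrier N"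
    and "\<And>x y. x \<in> carrier M \<Longrightarrow> y \<in> carrier M \<Longrightarrow> f (x \<oplus>\<^bsub>M\<^esub> y) = f x \<oplus>\<^bsub>N\<^esub> f y"
    and "\<And>a x. a \<in> carrier A \<Longrightarrow> x \<in> carrier M \<Longrightarrow> f (a \<odot>\<^bsub>M\<^esub> x) = a \<odot>\<^bsub>N\<^esub> f x"
    and "\<And>x. x \<notin> carrier M \<Longrightarrow> f x = undefined"
  shows "f \<in> mod_hom A M N"
  using assms by (auto simp: mod_hom_def)

lemma
  assumes "f \<in> mod_hom A M N"
  shows mod_hom_closed: "x \<in> carrier M \<Longrightarrow> f x \<in> carrier N"
    and mod_hom_add: "x \<in> carrier M \<Longrightarrow> y \<in> carrier M \<Longrightarrow> f (x \<oplus>\<^bsub>M\<^esub> y) = f x \<oplus>\<^bsub>N\<^esub> f y"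
    and mod_hom_smult: "a \<in> carrier A \<Longrightarrow> x \<in> carrier M \<Longrightarrow> f (a \<odot>\<^bsub>M\<^esub> x) = a \<odot>\<^bsub>N\<^esub> f x"
    and mod_hom_undefined: "x \<notin> carrier M \<Longrightarrow> f x = undefined"
  using assms by (auto simp: mod_hom_def)

lemma mod_hom_eqI:
  "f \<in> mod_hom A M N \<Longrightarrow> g \<in> mod_hom A M N' \<Longrightarrow> (\<And>x. x \<in> carrier M \<Longrightarrow> f x = g x) \<Longrightarrow> f = g"
  by (metis ext mod_hom_undefined)

lemma mod_hom_zero:
  assumes "f \<in> mod_hom A M N" "left_module A M" "left_module A N"
  shows "f \<zero>\<^bsub>M\<^esub> = \<zero>\<^bsub>N\<^esub>"
proof -
  interpret M: left_module A M by fact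
  interpret N: left_module A N by fact
  have "f \<zero>\<^bsub>M\<^esub> = f (\<zero>\<^bsub>A\<^esub> \<odot>\<^bsub>M\<^esub> \<zero>\<^bsub>M\<^esub>)" by (simp add: M.smult_zero_r)
  also have "\<dots> = \<zero>\<^bsub>N\<^esub>"
    using assms(1) by (simp add: mod_hom_smult mod_hom_closed N.smult_zero_l)
  finally show ?thesis .
qed

lemma mod_hom_minus:
  assumes "f \<in> mod_hom A M N" "left_module A M" "left_module A N" "x \<in> carrier M"
  shows "f (\<ominus>\<^bsub>M\<^esub> x) = \<ominus>\<^bsub>N\<^esub> f x"
proof -
  interpret M: left_module A M by fact
  interpret N: left_module A N by fact
  have "f (\<ominus>\<^bsub>M\<^esub> x) \<oplus>\<^bsub>N\<^esub> f x = \<zero>\<^bsub>N\<^esub>"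
    using assms mod_hom_zero[OF assms(1-3)]
    by (simp add: mod_hom_add[OF assms(1), symmetric] M.l_neg)
  then show ?thesis using assms by (simp add: mod_hom_closed N.minus_equality)
qed

lemma zero_mod_hom:
  assumes "left_module A M" "left_module A N"
  shows "(\<lambda>x\<in>carrier M. \<zero>\<^bsub>N\<^esub>) \<in> mod_hom A M N"
proof -
  interpret M: left_module A M by fact
  interpret N: left_module A N by fact
  show ?thesis by (rule mod_homI) (auto simp: N.smult_zero_r M.smult_closed)
qed

lemma ident_mod_hom:
  assumes "left_module A M"
  shows "(\<lambda>x\<in>carrier M. x) \<in> mod_hom A M M"
proof -
  interpret M: left_module A M by fact
  show ?thesis by (rule mod_homI) (auto simp: M.smult_closed)
qed

lemma compose_mod_hom:
  assumes "f \<in> mod_hom A M N" "g \<in> mod_hom A N L" "left_module A M"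
  shows "compose (carrier M) g f \<in> mod_hom A M L"
proof -
  interpret M: left_module A M by fact
  show ?thesis using assms(1,2)
    by (intro mod_homI) (simp_all add: compose_def mod_hom_closed mod_hom_add mod_hom_smult M.smult_closed)
qed

lemma fin_gen_image:
  assumes "left_module A M" "fin_gen A M" "left_module A N" "f \<in> mod_hom A M N" "f ` carrier M = carrier N"
  shows "fin_gen A N"
proof -
  interpret M: left_module A M by fact
  interpret N: left_module A N by fact
  from assms(2) obtain S where S: "finite S" "S \<subseteq> carrier M"
    "\<And>L. submodule L A M \<Longrightarrow> S \<subseteq> L \<Longrightarrow> L = carrier M" by (rule fin_genE) blast
  show ?thesis unfolding fin_gen_def
  proof (intro exI conjI allI impI)
    show "finite (f ` S)" "f ` S \<subseteq> carrier N" using S(1,2) assms(5) by auto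
    fix L assume L: "submodule L A N \<and> f ` S \<subseteq> L"
    then interpret L: submodule L A N by auto
    have "submodule {x \<in> carrier M. f x \<in> L} A M"
      using L.one_closed L.m_closed L.smult_closed mod_hom_zero[OF assms(4,1,3)]
      by (intro M.submoduleI)
        (auto simp: mod_hom_add[OF assms(4)] mod_hom_smult[OF assms(4)] M.smult_closed)
    from S(3)[OF this] S(2) L have "carrier M \<subseteq> {x \<in> carrier M. f x \<in> L}" by auto
    then have "carrier N \<subseteq> L" unfolding assms(5)[symmetric] by blast
    moreover have "L \<subseteq> carrier N" using L.subset by simp
    ultimately show "L = carrier N" by blast
  qed
qed

lemma (in left_module)
  assumes "submodule H A M"
  shows submodule_subset: "H \<subseteq> carrier M"
    and submodule_zero: "\<zero>\<^bsub>M\<^esub> \<in> H"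
    and submodule_add: "x \<in> H \<Longrightarrow> y \<in> H \<Longrightarrow> x \<oplus>\<^bsub>M\<^esub> y \<in> H"
    and submodule_smult: "a \<in> carrier A \<Longrightarrow> x \<in> H \<Longrightarrow> a \<odot>\<^bsub>M\<^esub> x \<in> H"
    and submodule_minus: "x \<in> H \<Longrightarrow> \<ominus>\<^bsub>M\<^esub> x \<in> H"
proof -
  interpret H: submodule H A M by fact
  show sub: "H \<subseteq> carrier M" using H.subset by simp
  show "\<zero>\<^bsub>M\<^esub> \<in> H" "x \<in> H \<Longrightarrow> y \<in> H \<Longrightarrow> x \<oplus>\<^bsub>M\<^esub> y \<in> H"
    "a \<in> carrier A \<Longrightarrow> x \<in> H \<Longrightarrow> a \<odot>\<^bsub>M\<^esub> x \<in> H"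
    using H.one_closed H.m_closed by auto
  show "\<ominus>\<^bsub>M\<^esub> x \<in> H" if "x \<in> H"
  proof -
    have "x \<in> carrier M" using that sub by blast
    then show ?thesis
      using H.smult_closed[of "\<ominus>\<^bsub>A\<^esub> \<one>\<^bsub>A\<^esub>" x] that by (simp add: smult_minus_l smult_one)
  qed
qed

lemma (in left_module) submodule_left_module:
  assumes "submodule H A M"
  shows "left_module A (M\<lparr>carrier := H\<rparr>)"
proof -
  note H = submodule_zero[OF assms] submodule_add[OF assms] submodule_smult[OF assms]
    submodule_minus[OF assms] subsetD[OF submodule_subset[OF assms]]
  have "abelian_group (M\<lparr>carrier := H\<rparr>)"
  proof (rule abelian_groupI)
    fix x assume "x \<in> carrier (M\<lparr>carrier := H\<rparr>)"
    then show "\<exists>y\<in>carrier (M\<lparr>carrier := H\<rparr>). y \<oplus>\<^bsub>M\<lparr>carrier := H\<rparr>\<^esub> x = \<zero>\<^bsub>M\<lparr>carrier := H\<rparr>\<^esub>"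
      using H by (auto intro!: bexI[of _ "\<ominus>\<^bsub>M\<^esub> x"] simp: M.l_neg)
  qed (use H in \<open>auto intro: M.a_assoc M.a_comm\<close>)
  then show ?thesis
    using H by (intro left_module.intro R.ring_axioms left_module_axioms.intro)
      (auto simp: smult_l_distr smult_r_distr smult_assoc1 smult_one)
qed

section \<open>Chain conditions and decomposition\<close>

definition dcc :: "('a, 'r) ring_scheme \<Rightarrow> ('a, 'b) module \<Rightarrow> bool" where
  "dcc A M \<longleftrightarrow> (\<forall>N :: nat \<Rightarrow> 'b set.
    (\<forall>n. submodule (N n) A M \<and> N (Suc n) \<subseteq> N n) \<longrightarrow> (\<exists>n. \<forall>m\<ge>n. N m = N n))"

lemma restrict_scalars_left_module:
  assumes "ring K" "ring A" "\<phi> \<in> ring_hom K A"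
  shows "left_module K (restrict_scalars \<phi> A)"
proof -
  interpret K: ring K by fact
  interpret A: ring A by fact
  note h = ring_hom_closed[OF assms(3)] ring_hom_add[OF assms(3)] ring_hom_mult[OF assms(3)]
    ring_hom_one[OF assms(3)]
  have "abelian_group (restrict_scalars \<phi> A)"
    by (rule abelian_groupI)
      (auto simp: restrict_scalars_def A.a_ac intro!: bexI[of _ "\<ominus>\<^bsub>A\<^esub> _"] A.l_neg)
  then show ?thesis
    by (intro left_module.intro K.ring_axioms left_module_axioms.intro)
      (auto simp: restrict_scalars_def h A.l_distr A.r_distr A.m_assoc)
qed

lemma dcc_minimal:
  assumes "dcc A M" "H \<in> S" "\<And>H. H \<in> S \<Longrightarrow> submodule H A M"
  shows "\<exists>L\<in>S. \<forall>L'\<in>S. L' \<subseteq> L \<longrightarrow> L' = L"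
proof (rule ccontr)
  assume "\<not> ?thesis"
  then have step: "\<exists>L'. L' \<in> S \<and> L' \<subset> L" if "L \<in> S" for L using that by blast
  define N where "N = rec_nat H (\<lambda>_ L. SOME L'. L' \<in> S \<and> L' \<subset> L)"
  have N: "N n \<in> S" for n
    by (induction n) (auto simp: N_def assms(2) dest: someI_ex[OF step])
  have N': "N (Suc n) \<subset> N n" for n
    using someI_ex[OF step[OF N[of n]]] by (simp add: N_def)
  then obtain n where "\<forall>m\<ge>n. N m = N n"
    using assms(1,3) N unfolding dcc_def by (metis psubset_imp_subset)
  then show False using N'[of n] by (metis le_Suc_eq order_refl psubset_eq)
qed

text \<open>A module generated by \<open>s\<close> and a submodule \<open>U\<close> is controlled by its traces on \<open>U\<close> and on the
  coefficients of \<open>s\<close>, so chains stabilize by induction on the number of generators.\<close>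

lemma dcc_fin_gen:
  assumes A: "dcc A (restrict_scalars (\<lambda>c. c) A)" and "left_module A M" "fin_gen A M"
  shows "dcc A M"
proof -
  interpret left_module A M by fact
  have st: "\<exists>n. \<forall>m\<ge>n. N m = N n"
    if "set l \<subseteq> carrier M" "\<And>n. submodule (N n) A M" "\<And>n. N (Suc n) \<subseteq> N n" "\<And>n. N n \<subseteq> span_list l"
    for l and N :: "nat \<Rightarrow> 'c set"
    using that
  proof (induction l arbitrary: N)
    case Nil
    have "N n = {\<zero>\<^bsub>M\<^esub>}" for n using Nil(4)[of n] submodule_zero[OF Nil(2)] by auto
    then show ?case by auto
  next
    case (Cons s l)
    have l: "set l \<subseteq> carrier M" and s: "s \<in> carrier M" using Cons.prems(1) by auto
    note sp = span_zero[OF l] span_add[OF l] span_smult[OF l] subsetD[OF span_closed[OF l]]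
      submodule_minus[OF span_submodule[OF l]]
    note N = submodule_zero[OF Cons.prems(2)] submodule_add[OF Cons.prems(2)]
      submodule_smult[OF Cons.prems(2)] submodule_minus[OF Cons.prems(2)]
      subsetD[OF submodule_subset[OF Cons.prems(2)]]
    have anti: "N m \<subseteq> N n" if "n \<le> m" for n m
      using lift_Suc_antimono_le[of N, OF Cons.prems(3) that] .
    define J where "J n = {a \<in> carrier A. \<exists>t\<in>span_list l. a \<odot>\<^bsub>M\<^esub> s \<oplus>\<^bsub>M\<^esub> t \<in> N n}" for n
    interpret RA: left_module A "restrict_scalars (\<lambda>c. c) A"
      by (rule restrict_scalars_left_module) (auto simp: R.ring_axioms ring_hom_def)
    have J: "submodule (J n) A (restrict_scalars (\<lambda>c. c) A)" for n
    proof (rule RA.submoduleI)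
      show "\<zero>\<^bsub>restrict_scalars (\<lambda>c. c) A\<^esub> \<in> J n"
        using N(1) sp(1) s by (auto simp: J_def restrict_scalars_def smult_zero_l intro!: bexI[of _ "\<zero>\<^bsub>M\<^esub>"])
      fix a b assume ab: "a \<in> J n" "b \<in> J n"
      then obtain t u where t: "a \<in> carrier A" "t \<in> span_list l" "a \<odot>\<^bsub>M\<^esub> s \<oplus>\<^bsub>M\<^esub> t \<in> N n"
        and u: "b \<in> carrier A" "u \<in> span_list l" "b \<odot>\<^bsub>M\<^esub> s \<oplus>\<^bsub>M\<^esub> u \<in> N n" by (auto simp: J_def)
      have "(a \<odot>\<^bsub>M\<^esub> s \<oplus>\<^bsub>M\<^esub> t) \<oplus>\<^bsub>M\<^esub> (b \<odot>\<^bsub>M\<^esub> s \<oplus>\<^bsub>M\<^esub> u) = (a \<oplus>\<^bsub>A\<^esub> b) \<odot>\<^bsub>M\<^esub> s \<oplus>\<^bsub>M\<^esub> (t \<oplus>\<^bsub>M\<^esub> u)"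
        using t u s sp(4) by (simp add: smult_l_distr smult_closed M.a_ac)
      then show "a \<oplus>\<^bsub>restrict_scalars (\<lambda>c. c) A\<^esub> b \<in> J n"
        using t u N(2)[OF t(3) u(3)] sp(2)[OF t(2) u(2)] by (auto simp: J_def restrict_scalars_def)
    next
      fix a b assume ab: "a \<in> carrier A" "b \<in> J n"
      then obtain u where u: "b \<in> carrier A" "u \<in> span_list l" "b \<odot>\<^bsub>M\<^esub> s \<oplus>\<^bsub>M\<^esub> u \<in> N n"
        by (auto simp: J_def)
      have "a \<odot>\<^bsub>M\<^esub> (b \<odot>\<^bsub>M\<^esub> s \<oplus>\<^bsub>M\<^esub> u) = (a \<otimes>\<^bsub>A\<^esub> b) \<odot>\<^bsub>M\<^esub> s \<oplus>\<^bsub>M\<^esub> a \<odot>\<^bsub>M\<^esub> u"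
        using u s sp(4) ab by (simp add: smult_r_distr smult_assoc1 smult_closed)
      then show "a \<odot>\<^bsub>restrict_scalars (\<lambda>c. c) A\<^esub> b \<in> J n"
        using ab u N(3)[OF ab(1) u(3)] sp(3)[OF ab(1) u(2)] by (auto simp: J_def restrict_scalars_def)
    qed (auto simp: J_def restrict_scalars_def)
    have "J (Suc n) \<subseteq> J n" for n using Cons.prems(3)[of n] by (auto simp: J_def)
    with J A obtain n1 where n1: "\<forall>m\<ge>n1. J m = J n1" unfolding dcc_def by blast
    have "submodule (N n \<inter> span_list l) A M" for n
      using N sp by (intro submoduleI) auto
    then obtain n2 where n2: "\<forall>m\<ge>n2. N m \<inter> span_list l = N n2 \<inter> span_list l"
      using Cons.IH[OF l, of "\<lambda>n. N n \<inter> span_list l"] Cons.prems(3) by auto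
    have "N m = N (max n1 n2)" if m: "m \<ge> max n1 n2" for m
    proof
      show "N m \<subseteq> N (max n1 n2)" by (rule anti[OF m])
      show "N (max n1 n2) \<subseteq> N m"
      proof
        fix x assume x: "x \<in> N (max n1 n2)"
        with Cons.prems(4) obtain a t where at: "x = a \<odot>\<^bsub>M\<^esub> s \<oplus>\<^bsub>M\<^esub> t" "a \<in> carrier A" "t \<in> span_list l"
          by fastforce
        have "a \<in> J (max n1 n2)" using x at by (auto simp: J_def)
        then have "a \<in> J m" using n1 m by (metis max.cobounded1 max.bounded_iff)
        then obtain u where u: "u \<in> span_list l" "a \<odot>\<^bsub>M\<^esub> s \<oplus>\<^bsub>M\<^esub> u \<in> N m" by (auto simp: J_def)
        define y where "y = a \<odot>\<^bsub>M\<^esub> s \<oplus>\<^bsub>M\<^esub> u"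
        have c: "t \<in> carrier M" "u \<in> carrier M" "a \<odot>\<^bsub>M\<^esub> s \<in> carrier M" "x \<in> carrier M" "y \<in> carrier M"
          using sp(4) at u s by (auto simp: smult_closed y_def)
        have xy: "x \<ominus>\<^bsub>M\<^esub> y = t \<ominus>\<^bsub>M\<^esub> u" using c M.add_diff_cancel_left by (simp add: at(1) y_def)
        have "y \<in> N (max n1 n2)" using u anti[OF m] by (auto simp: y_def)
        then have "x \<ominus>\<^bsub>M\<^esub> y \<in> N (max n1 n2)" using x N by (auto simp: M.minus_eq)
        moreover have "x \<ominus>\<^bsub>M\<^esub> y \<in> span_list l" unfolding xy using sp at u by (auto simp: M.minus_eq)
        ultimately have "x \<ominus>\<^bsub>M\<^esub> y \<in> N m"
          using n2 m by (metis (no_types, lifting) IntD1 IntI max.cobounded2 max.bounded_iff)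
        then have "(x \<ominus>\<^bsub>M\<^esub> y) \<oplus>\<^bsub>M\<^esub> y \<in> N m" using u N(2) by (auto simp: y_def)
        then show "x \<in> N m" using c by (simp add: M.minus_eq M.a_assoc M.l_neg)
      qed
    qed
    then show ?case by blast
  qed
  from assms(3) obtain S where S: "finite S" "S \<subseteq> carrier M"
    "\<And>L. submodule L A M \<Longrightarrow> S \<subseteq> L \<Longrightarrow> L = carrier M" by (rule fin_genE) blast
  from S(1) obtain l where l: "set l = S" using finite_list by auto
  then have "span_list l = carrier M"
    using S(2) span_submodule[of l] span_gen[of l] by (intro S(3)) simp_all
  then have "N n \<subseteq> span_list l" if "submodule (N n) A M" for N n
    using submodule_subset[OF that] by simp
  note span = this
  show ?thesis unfolding dcc_def
  proof (intro allI impI)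
    fix N :: "nat \<Rightarrow> 'c set" assume "\<forall>n. submodule (N n) A M \<and> N (Suc n) \<subseteq> N n"
    then show "\<exists>n. \<forall>m\<ge>n. N m = N n" using l S(2) span[of N] by (intro st[of l N]) simp_all
  qed
qed

text \<open>The passage from a ring to its finitely generated modules is made twice: from \<open>K\<close> to \<open>A\<close>, whose
  left ideals are \<open>K\<close>-submodules, and from \<open>A\<close> to \<open>M\<close>.\<close>

lemma artin_algebra_dcc:
  assumes "artin_algebra K \<phi> A" "left_module A M" "fin_gen A M"
  shows "dcc A M"
proof (rule dcc_fin_gen[OF _ assms(2,3)])
  have K: "cring K" "ring A" "\<phi> \<in> ring_hom K A" and fg: "fin_gen K (restrict_scalars \<phi> A)"
    and art: "\<And>I :: nat \<Rightarrow> 'a set. (\<And>n. ideal (I n) K \<and> I (Suc n) \<subseteq> I n) \<Longrightarrow> \<exists>n. \<forall>m\<ge>n. I m = I n"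
    using assms(1) by (auto simp: artin_algebra_def artinian_cring_def)
  interpret K: cring K by fact
  interpret A: ring A by fact
  interpret KK: left_module K "restrict_scalars (\<lambda>c. c) K"
    by (rule restrict_scalars_left_module) (auto simp: K.ring_axioms ring_hom_def)
  interpret KA: left_module K "restrict_scalars \<phi> A"
    by (rule restrict_scalars_left_module[OF K.ring_axioms K(2,3)])
  interpret AA: left_module A "restrict_scalars (\<lambda>c. c) A"
    by (rule restrict_scalars_left_module) (auto simp: A.ring_axioms ring_hom_def)
  have "ideal H K" if "submodule H K (restrict_scalars (\<lambda>c. c) K)" for H
  proof -
    note H = KK.submodule_subset[OF that] KK.submodule_zero[OF that] KK.submodule_add[OF that]
      KK.submodule_smult[OF that]
    have "\<ominus>\<^bsub>K\<^esub> x \<in> H" if "x \<in> H" for x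
      using H(4)[of "\<ominus>\<^bsub>K\<^esub> \<one>\<^bsub>K\<^esub>" x] H(1) that by (auto simp: restrict_scalars_def K.l_minus subset_iff)
    then have "subgroup H (add_monoid K)"
      using H by (intro subgroup.intro) (auto simp: restrict_scalars_def a_inv_def)
    moreover have l: "x \<otimes>\<^bsub>K\<^esub> a \<in> H" if "a \<in> H" "x \<in> carrier K" for a x
      using H(4)[OF that(2,1)] by (simp add: restrict_scalars_def)
    moreover have "a \<otimes>\<^bsub>K\<^esub> x \<in> H" if "a \<in> H" "x \<in> carrier K" for a x
    proof -
      have "a \<in> carrier K" using that H(1) by (auto simp: restrict_scalars_def)
      then show ?thesis using l[OF that] K.m_comm[of a x] that by simp
    qed
    ultimately show ?thesis by (intro idealI K.ring_axioms)
  qed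
  then have "dcc K (restrict_scalars (\<lambda>c. c) K)" unfolding dcc_def using art by blast
  from dcc_fin_gen[OF this KA.left_module_axioms fg] have d: "dcc K (restrict_scalars \<phi> A)" .
  have "submodule H K (restrict_scalars \<phi> A)" if "submodule H A (restrict_scalars (\<lambda>c. c) A)" for H
    using AA.submodule_subset[OF that] AA.submodule_zero[OF that] AA.submodule_add[OF that]
      AA.submodule_smult[OF that] ring_hom_closed[OF K(3)]
    by (intro KA.submoduleI) (auto simp: restrict_scalars_def)
  then show "dcc A (restrict_scalars (\<lambda>c. c) A)" using d unfolding dcc_def by blast
qed

text \<open>A direct summand is the image of a projection.\<close>

lemma direct_summand_fin_gen:
  assumes M: "left_module A M" and g: "fin_gen A M" "submodule N A M" "submodule L A M" "N <+>\<^bsub>M\<^esub> L = carrier M" "N \<inter> L = {\<zero>\<^bsub>M\<^esub>}"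
  shows "fin_gen A (M\<lparr>carrier := N\<rparr>)"
proof -
  interpret left_module A M by fact
  note N = submodule_add[OF g(2)] submodule_smult[OF g(2)] submodule_minus[OF g(2)]
    subsetD[OF submodule_subset[OF g(2)]]
  note L = submodule_add[OF g(3)] submodule_smult[OF g(3)] submodule_minus[OF g(3)]
    subsetD[OF submodule_subset[OF g(3)]]
  define f where "f = (\<lambda>x\<in>carrier M. SOME y. y \<in> N \<and> (\<exists>z\<in>L. x = y \<oplus>\<^bsub>M\<^esub> z))"
  have dec: "\<exists>y z. y \<in> N \<and> z \<in> L \<and> x = y \<oplus>\<^bsub>M\<^esub> z" if "x \<in> carrier M" for x
  proof -
    have "x \<in> N <+>\<^bsub>M\<^esub> L" using that g(4) by simp
    then show ?thesis unfolding set_add_def set_mult_def by auto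
  qed
  have uniq: "y = y'" if "y \<in> N" "z \<in> L" "y' \<in> N" "z' \<in> L" "y \<oplus>\<^bsub>M\<^esub> z = y' \<oplus>\<^bsub>M\<^esub> z'" for y z y' z'
  proof -
    have c: "y \<in> carrier M" "z \<in> carrier M" "y' \<in> carrier M" "z' \<in> carrier M" using that N L by auto
    have "y \<ominus>\<^bsub>M\<^esub> y' = z' \<ominus>\<^bsub>M\<^esub> z" by (rule M.diff_cross[OF c that(5)])
    moreover have "y \<ominus>\<^bsub>M\<^esub> y' \<in> N" "z' \<ominus>\<^bsub>M\<^esub> z \<in> L" using that N L by (auto simp: M.minus_eq)
    ultimately have "y \<ominus>\<^bsub>M\<^esub> y' \<in> N \<inter> L" by simp
    then have "y \<ominus>\<^bsub>M\<^esub> y' = \<zero>\<^bsub>M\<^esub>" unfolding g(5) by simp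
    then show ?thesis by (rule M.diff_zero_imp_eq[OF c(1,3)])
  qed
  have f: "f (y \<oplus>\<^bsub>M\<^esub> z) = y" if "y \<in> N" "z \<in> L" for y z
  proof -
    have "f (y \<oplus>\<^bsub>M\<^esub> z) \<in> N \<and> (\<exists>w\<in>L. y \<oplus>\<^bsub>M\<^esub> z = f (y \<oplus>\<^bsub>M\<^esub> z) \<oplus>\<^bsub>M\<^esub> w)"
    proof -
      have "y \<oplus>\<^bsub>M\<^esub> z \<in> carrier M" using that N(4) L(4) by simp
      then have "f (y \<oplus>\<^bsub>M\<^esub> z) = (SOME v. v \<in> N \<and> (\<exists>w\<in>L. y \<oplus>\<^bsub>M\<^esub> z = v \<oplus>\<^bsub>M\<^esub> w))"
        unfolding f_def restrict_def by (rule if_P)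
      moreover have "\<exists>v. v \<in> N \<and> (\<exists>w\<in>L. y \<oplus>\<^bsub>M\<^esub> z = v \<oplus>\<^bsub>M\<^esub> w)" using that by blast
      ultimately show ?thesis by (simp only: someI_ex[where P = "\<lambda>v. v \<in> N \<and> (\<exists>w\<in>L. y \<oplus>\<^bsub>M\<^esub> z = v \<oplus>\<^bsub>M\<^esub> w)"])
    qed
    then show ?thesis using uniq that by metis
  qed
  have hom: "f \<in> mod_hom A M (M\<lparr>carrier := N\<rparr>)"
  proof (rule mod_homI)
    fix x assume "x \<in> carrier M"
    then obtain y z where x: "y \<in> N" "z \<in> L" "x = y \<oplus>\<^bsub>M\<^esub> z" using dec by blast
    then show "f x \<in> carrier (M\<lparr>carrier := N\<rparr>)" by (simp add: f)
    have c: "y \<in> carrier M" "z \<in> carrier M" using x N L by auto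
    {
      fix a assume a: "a \<in> carrier A"
      have "a \<odot>\<^bsub>M\<^esub> x = a \<odot>\<^bsub>M\<^esub> y \<oplus>\<^bsub>M\<^esub> a \<odot>\<^bsub>M\<^esub> z" using a c by (simp add: x smult_r_distr)
      then show "f (a \<odot>\<^bsub>M\<^esub> x) = a \<odot>\<^bsub>M\<lparr>carrier := N\<rparr>\<^esub> f x" using x a N L by (simp add: f)
    next
      fix x' assume "x' \<in> carrier M"
      then obtain y' z' where x': "y' \<in> N" "z' \<in> L" "x' = y' \<oplus>\<^bsub>M\<^esub> z'" using dec by blast
      have c': "y' \<in> carrier M" "z' \<in> carrier M" using x' N L by auto
      have "x \<oplus>\<^bsub>M\<^esub> x' = (y \<oplus>\<^bsub>M\<^esub> y') \<oplus>\<^bsub>M\<^esub> (z \<oplus>\<^bsub>M\<^esub> z')" using c c' by (simp add: x x' M.a_ac)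
      then show "f (x \<oplus>\<^bsub>M\<^esub> x') = f x \<oplus>\<^bsub>M\<lparr>carrier := N\<rparr>\<^esub> f x'" using x x' N L by (simp add: f)
    }
  qed (simp add: f_def)
  have "y \<in> f ` carrier M" if "y \<in> N" for y
    using f[OF that submodule_zero[OF g(3)]] N(4)[OF that] by (auto intro!: image_eqI[of _ _ y])
  then have "f ` carrier M = carrier (M\<lparr>carrier := N\<rparr>)"
    using mod_hom_closed[OF hom] by auto
  then show ?thesis
    using fin_gen_image[OF M g(1) submodule_left_module[OF g(2)] hom] by blast
qed

text \<open>This replaces an explicit decomposition into indecomposables: among the finitely generated
  submodules of \<open>M\<close> that violate \<open>P\<close>, a minimal one would be nonzero and decomposable, with both
  summands strictly smaller.\<close>

lemma fg_module_induct:
  assumes dcc: "\<And>M. M \<in> fg_modules A \<Longrightarrow> dcc A M"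
    and M: "M \<in> fg_modules A"
    and zero: "\<And>N. N \<in> fg_modules A \<Longrightarrow> carrier N = {\<zero>\<^bsub>N\<^esub>} \<Longrightarrow> P N"
    and indec: "\<And>N. N \<in> fg_modules A \<Longrightarrow> indecomposable A N \<Longrightarrow> P N"
    and sum: "\<And>N L L'. N \<in> fg_modules A \<Longrightarrow> submodule L A N \<Longrightarrow> submodule L' A N \<Longrightarrow>
      L <+>\<^bsub>N\<^esub> L' = carrier N \<Longrightarrow> L \<inter> L' = {\<zero>\<^bsub>N\<^esub>} \<Longrightarrow>
      N\<lparr>carrier := L\<rparr> \<in> fg_modules A \<Longrightarrow> N\<lparr>carrier := L'\<rparr> \<in> fg_modules A \<Longrightarrow>
      P (N\<lparr>carrier := L\<rparr>) \<Longrightarrow> P (N\<lparr>carrier := L'\<rparr>) \<Longrightarrow> P N"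
  shows "P M"
proof (rule ccontr)
  assume nP: "\<not> P M"
  interpret M: left_module A M using M by (simp add: fg_modules_def)
  define S where "S = {H. submodule H A M \<and> M\<lparr>carrier := H\<rparr> \<in> fg_modules A \<and> \<not> P (M\<lparr>carrier := H\<rparr>)}"
  have "carrier M \<in> S"
    using M nP by (auto simp: S_def intro!: M.submoduleI M.smult_closed)
  from dcc_minimal[OF dcc[OF M] this] obtain H where H: "H \<in> S" "\<And>L. L \<in> S \<Longrightarrow> L \<subseteq> H \<Longrightarrow> L = H"
    by (auto simp: S_def)
  let ?H = "M\<lparr>carrier := H\<rparr>"
  have sH: "submodule H A M" and fH: "?H \<in> fg_modules A" and nH: "\<not> P ?H" using H(1) by (auto simp: S_def)
  interpret H: left_module A ?H using fH by (simp add: fg_modules_def)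
  have sub: "submodule L A M" if "submodule L A ?H" for L
    using H.submodule_zero[OF that] H.submodule_add[OF that] H.submodule_smult[OF that]
      H.submodule_subset[OF that] M.submodule_subset[OF sH]
    by (intro M.submoduleI) auto
  have "carrier ?H \<noteq> {\<zero>\<^bsub>?H\<^esub>}" "\<not> indecomposable A ?H" using zero indec fH nH by blast+
  then obtain L L' where L: "submodule L A ?H" "submodule L' A ?H" "L <+>\<^bsub>?H\<^esub> L' = carrier ?H"
    "L \<inter> L' = {\<zero>\<^bsub>?H\<^esub>}" "L \<noteq> {\<zero>\<^bsub>?H\<^esub>}" "L' \<noteq> {\<zero>\<^bsub>?H\<^esub>}"
    unfolding indecomposable_def by blast
  have LL': "L' \<inter> L = {\<zero>\<^bsub>?H\<^esub>}" using L(4) by blast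
  have L'L: "L' <+>\<^bsub>?H\<^esub> L = carrier ?H"
  proof -
    have "L' <+>\<^bsub>?H\<^esub> L = L <+>\<^bsub>?H\<^esub> L'"
      using subsetD[OF H.submodule_subset[OF L(1)]] subsetD[OF H.submodule_subset[OF L(2)]] H.a_comm
      by (simp add: set_add_def set_mult_def) blast
    then show ?thesis using L(3) by simp
  qed
  have "L \<noteq> H" "L' \<noteq> H"
    using L H.submodule_subset[OF L(1)] H.submodule_subset[OF L(2)] by auto
  moreover have "?H\<lparr>carrier := L\<rparr> \<in> fg_modules A" "?H\<lparr>carrier := L'\<rparr> \<in> fg_modules A"
    using direct_summand_fin_gen[OF H.left_module_axioms _ L(1,2,3,4)] direct_summand_fin_gen[OF H.left_module_axioms _ L(2,1) L'L LL']
      H.submodule_left_module[OF L(1)] H.submodule_left_module[OF L(2)] fH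
    by (simp_all add: fg_modules_def)
  moreover from this have "P (?H\<lparr>carrier := L\<rparr>)" "P (?H\<lparr>carrier := L'\<rparr>)"
    using H(2)[of L] H(2)[of L'] sub L H.submodule_subset[OF L(1)] H.submodule_subset[OF L(2)] calculation
    by (auto simp: S_def)
  ultimately show False using sum[OF fH L(1,2,3,4)] nH by blast
qed

section \<open>Products and quotients\<close>

lemma mod_prod_simps [simp]:
  "carrier (mod_prod M N) = {Couple x y | x y. x \<in> carrier M \<and> y \<in> carrier N}"
  "\<zero>\<^bsub>mod_prod M N\<^esub> = Couple \<zero>\<^bsub>M\<^esub> \<zero>\<^bsub>N\<^esub>"
  "p \<oplus>\<^bsub>mod_prod M N\<^esub> q = Couple (cfst p \<oplus>\<^bsub>M\<^esub> cfst q) (csnd p \<oplus>\<^bsub>N\<^esub> csnd q)"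
  "a \<odot>\<^bsub>mod_prod M N\<^esub> p = Couple (a \<odot>\<^bsub>M\<^esub> cfst p) (a \<odot>\<^bsub>N\<^esub> csnd p)"
  by (simp_all add: mod_prod_def)

lemma mod_prod_left_module:
  assumes "left_module A M" "left_module A N"
  shows "left_module A (mod_prod M N)"
proof -
  interpret M: left_module A M by fact
  interpret N: left_module A N by fact
  have "abelian_group (mod_prod M N)"
  proof (rule abelian_groupI)
    fix p assume "p \<in> carrier (mod_prod M N)"
    then obtain x y where p: "p = Couple x y" "x \<in> carrier M" "y \<in> carrier N" by auto
    then show "\<exists>q\<in>carrier (mod_prod M N). q \<oplus>\<^bsub>mod_prod M N\<^esub> p = \<zero>\<^bsub>mod_prod M N\<^esub>"
      by (intro bexI[of _ "Couple (\<ominus>\<^bsub>M\<^esub> x) (\<ominus>\<^bsub>N\<^esub> y)"]) (auto simp: M.l_neg N.l_neg)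
  qed (auto simp: M.a_ac N.a_ac)
  then show ?thesis
    by (intro left_module.intro M.R.ring_axioms left_module_axioms.intro)
      (auto simp: M.smult_closed N.smult_closed M.smult_l_distr N.smult_l_distr M.smult_r_distr
        N.smult_r_distr M.smult_assoc1 N.smult_assoc1 M.smult_one N.smult_one)
qed

lemma mod_prod_fg:
  assumes "M \<in> fg_modules A" "N \<in> fg_modules A"
  shows "mod_prod M N \<in> fg_modules A"
proof -
  interpret M: left_module A M using assms by (simp add: fg_modules_def)
  interpret N: left_module A N using assms by (simp add: fg_modules_def)
  have lm: "left_module A (mod_prod M N)"
    by (rule mod_prod_left_module) (rule M.left_module_axioms N.left_module_axioms)+
  interpret P: left_module A "mod_prod M N" by fact
  have "fin_gen A M" "fin_gen A N" using assms by (auto simp: fg_modules_def)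
  then obtain S T where S: "finite S" "S \<subseteq> carrier M"
      "\<And>L. submodule L A M \<Longrightarrow> S \<subseteq> L \<Longrightarrow> L = carrier M"
    and T: "finite T" "T \<subseteq> carrier N" "\<And>L. submodule L A N \<Longrightarrow> T \<subseteq> L \<Longrightarrow> L = carrier N"
    by (elim fin_genE) blast
  let ?S = "(\<lambda>x. Couple x \<zero>\<^bsub>N\<^esub>) ` S \<union> (\<lambda>y. Couple \<zero>\<^bsub>M\<^esub> y) ` T"
  have "fin_gen A (mod_prod M N)" unfolding fin_gen_def
  proof (intro exI conjI allI impI)
    show "finite ?S" "?S \<subseteq> carrier (mod_prod M N)" using S T by auto
    fix L assume L: "submodule L A (mod_prod M N) \<and> ?S \<subseteq> L"
    note L' = P.submodule_subset[OF conjunct1[OF L]] P.submodule_zero[OF conjunct1[OF L]]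
      P.submodule_add[OF conjunct1[OF L]] P.submodule_smult[OF conjunct1[OF L]]
    have "submodule {x \<in> carrier M. Couple x \<zero>\<^bsub>N\<^esub> \<in> L} A M"
    proof (rule M.submoduleI)
      fix x y assume "x \<in> {x \<in> carrier M. Couple x \<zero>\<^bsub>N\<^esub> \<in> L}" "y \<in> {x \<in> carrier M. Couple x \<zero>\<^bsub>N\<^esub> \<in> L}"
      then show "x \<oplus>\<^bsub>M\<^esub> y \<in> {x \<in> carrier M. Couple x \<zero>\<^bsub>N\<^esub> \<in> L}"
        using L'(3)[of "Couple x \<zero>\<^bsub>N\<^esub>" "Couple y \<zero>\<^bsub>N\<^esub>"] by auto
    next
      fix a x assume "a \<in> carrier A" "x \<in> {x \<in> carrier M. Couple x \<zero>\<^bsub>N\<^esub> \<in> L}"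
      then show "a \<odot>\<^bsub>M\<^esub> x \<in> {x \<in> carrier M. Couple x \<zero>\<^bsub>N\<^esub> \<in> L}"
        using L'(4)[of a "Couple x \<zero>\<^bsub>N\<^esub>"] by (auto simp: N.smult_zero_r M.smult_closed)
    qed (use L' in auto)
    from S(3)[OF this] have 1: "Couple x \<zero>\<^bsub>N\<^esub> \<in> L" if "x \<in> carrier M" for x using that L S(2) by blast
    have "submodule {y \<in> carrier N. Couple \<zero>\<^bsub>M\<^esub> y \<in> L} A N"
    proof (rule N.submoduleI)
      fix x y assume "x \<in> {y \<in> carrier N. Couple \<zero>\<^bsub>M\<^esub> y \<in> L}" "y \<in> {y \<in> carrier N. Couple \<zero>\<^bsub>M\<^esub> y \<in> L}"
      then show "x \<oplus>\<^bsub>N\<^esub> y \<in> {y \<in> carrier N. Couple \<zero>\<^bsub>M\<^esub> y \<in> L}"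
        using L'(3)[of "Couple \<zero>\<^bsub>M\<^esub> x" "Couple \<zero>\<^bsub>M\<^esub> y"] by auto
    next
      fix a x assume "a \<in> carrier A" "x \<in> {y \<in> carrier N. Couple \<zero>\<^bsub>M\<^esub> y \<in> L}"
      then show "a \<odot>\<^bsub>N\<^esub> x \<in> {y \<in> carrier N. Couple \<zero>\<^bsub>M\<^esub> y \<in> L}"
        using L'(4)[of a "Couple \<zero>\<^bsub>M\<^esub> x"] by (auto simp: M.smult_zero_r N.smult_closed)
    qed (use L' in auto)
    from T(3)[OF this] have 2: "Couple \<zero>\<^bsub>M\<^esub> y \<in> L" if "y \<in> carrier N" for y using that L T(2) by blast
    have "Couple x y \<in> L" if "x \<in> carrier M" "y \<in> carrier N" for x y
      using L'(3)[OF 1[OF that(1)] 2[OF that(2)]] that by simp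
    then show "L = carrier (mod_prod M N)" using L'(1) by auto
  qed
  with lm show ?thesis by (simp add: fg_modules_def)
qed

lemma mod_prod_minus:
  assumes "left_module A M" "left_module A N" "x \<in> carrier M" "y \<in> carrier N"
  shows "\<ominus>\<^bsub>mod_prod M N\<^esub> Couple x y = Couple (\<ominus>\<^bsub>M\<^esub> x) (\<ominus>\<^bsub>N\<^esub> y)"
proof -
  interpret M: left_module A M by fact
  interpret N: left_module A N by fact
  interpret P: left_module A "mod_prod M N" by (rule mod_prod_left_module[OF assms(1,2)])
  show ?thesis using assms(3,4) by (intro P.M.minus_equality) (auto simp: M.l_neg N.l_neg)
qed

text \<open>The cosets of \<open>H\<close> are represented by chosen elements, so the quotient stays in the
  universe of \<open>M\<close>.\<close>

lemma quotient_exists: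
  assumes M: "M \<in> fg_modules A" and H: "submodule H A M"
  shows "\<exists>Q\<in>fg_modules A. \<exists>\<pi>\<in>mod_hom A M Q. \<pi> ` carrier M = carrier Q \<and>
    (\<forall>x\<in>carrier M. \<pi> x = \<zero>\<^bsub>Q\<^esub> \<longleftrightarrow> x \<in> H)"
proof -
  interpret M: left_module A M using M by (simp add: fg_modules_def)
  note H' = M.submodule_zero[OF H] M.submodule_add[OF H] M.submodule_smult[OF H]
    M.submodule_minus[OF H] subsetD[OF M.submodule_subset[OF H]]
  define r where "r x = (SOME y. y \<in> carrier M \<and> x \<ominus>\<^bsub>M\<^esub> y \<in> H)" for x
  have r: "r x \<in> carrier M \<and> x \<ominus>\<^bsub>M\<^esub> r x \<in> H" if "x \<in> carrier M" for x
    using someI[of "\<lambda>y. y \<in> carrier M \<and> x \<ominus>\<^bsub>M\<^esub> y \<in> H" x] that H'(1)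
    by (simp add: r_def M.minus_eq M.r_neg)
  have sym: "y \<ominus>\<^bsub>M\<^esub> x \<in> H" if "x \<in> carrier M" "y \<in> carrier M" "x \<ominus>\<^bsub>M\<^esub> y \<in> H" for x y
    using H'(4)[OF that(3)] that by (simp add: M.minus_diff)
  have trans: "x \<ominus>\<^bsub>M\<^esub> z \<in> H" if "x \<in> carrier M" "y \<in> carrier M" "z \<in> carrier M"
    "x \<ominus>\<^bsub>M\<^esub> y \<in> H" "y \<ominus>\<^bsub>M\<^esub> z \<in> H" for x y z
  proof -
    show ?thesis using H'(2)[OF that(4,5)] that by (simp add: M.diff_add_diff)
  qed
  have req: "r x = r y" if "x \<in> carrier M" "y \<in> carrier M" "x \<ominus>\<^bsub>M\<^esub> y \<in> H" for x y
  proof -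
    have "(\<lambda>z. z \<in> carrier M \<and> x \<ominus>\<^bsub>M\<^esub> z \<in> H) = (\<lambda>z. z \<in> carrier M \<and> y \<ominus>\<^bsub>M\<^esub> z \<in> H)"
      using that sym trans by blast
    then show ?thesis by (simp add: r_def)
  qed
  have radd: "r (r x \<oplus>\<^bsub>M\<^esub> r y) = r (x \<oplus>\<^bsub>M\<^esub> y)" if "x \<in> carrier M" "y \<in> carrier M" for x y
  proof -
    have c: "r x \<in> carrier M" "r y \<in> carrier M" using r that by auto
    have "(x \<oplus>\<^bsub>M\<^esub> y) \<ominus>\<^bsub>M\<^esub> (r x \<oplus>\<^bsub>M\<^esub> r y) = (x \<ominus>\<^bsub>M\<^esub> r x) \<oplus>\<^bsub>M\<^esub> (y \<ominus>\<^bsub>M\<^esub> r y)"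
      using that c by (simp add: M.add_diff_add)
    also have "\<dots> \<in> H" using r that by (intro H'(2)) auto
    finally show ?thesis using that c by (intro req[symmetric]) auto
  qed
  have rsm: "r (a \<odot>\<^bsub>M\<^esub> r x) = r (a \<odot>\<^bsub>M\<^esub> x)" if "a \<in> carrier A" "x \<in> carrier M" for a x
  proof -
    have c: "r x \<in> carrier M" using r that by auto
    have "a \<odot>\<^bsub>M\<^esub> x \<ominus>\<^bsub>M\<^esub> a \<odot>\<^bsub>M\<^esub> r x = a \<odot>\<^bsub>M\<^esub> (x \<ominus>\<^bsub>M\<^esub> r x)"
      using that c by (simp add: M.minus_eq M.smult_r_distr M.smult_minus_r)
    also have "\<dots> \<in> H" using r that by (intro H'(3)) auto
    finally show ?thesis using that c by (intro req[symmetric]) (auto simp: M.smult_closed)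
  qed
  define Q :: "('a, 'a elt) module" where "Q = \<lparr>carrier = r ` carrier M, monoid.mult = undefined,
    one = undefined, zero = r \<zero>\<^bsub>M\<^esub>, add = (\<lambda>x y. r (x \<oplus>\<^bsub>M\<^esub> y)), smult = (\<lambda>a x. r (a \<odot>\<^bsub>M\<^esub> x))\<rparr>"
  have Q: "carrier Q = r ` carrier M" "\<zero>\<^bsub>Q\<^esub> = r \<zero>\<^bsub>M\<^esub>" "\<And>x y. x \<oplus>\<^bsub>Q\<^esub> y = r (x \<oplus>\<^bsub>M\<^esub> y)"
    "\<And>a x. a \<odot>\<^bsub>Q\<^esub> x = r (a \<odot>\<^bsub>M\<^esub> x)" by (simp_all add: Q_def)
  have "abelian_group Q"
  proof (rule abelian_groupI)
    fix x assume "x \<in> carrier Q"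
    then obtain u where u: "x = r u" "u \<in> carrier M" by (auto simp: Q)
    show "\<zero>\<^bsub>Q\<^esub> \<oplus>\<^bsub>Q\<^esub> x = x" using u by (simp add: Q radd)
    show "\<exists>y\<in>carrier Q. y \<oplus>\<^bsub>Q\<^esub> x = \<zero>\<^bsub>Q\<^esub>"
      using u by (intro bexI[of _ "r (\<ominus>\<^bsub>M\<^esub> u)"]) (auto simp: Q radd M.l_neg)
    fix y assume "y \<in> carrier Q"
    then obtain v where v: "y = r v" "v \<in> carrier M" by (auto simp: Q)
    show "x \<oplus>\<^bsub>Q\<^esub> y \<in> carrier Q" "x \<oplus>\<^bsub>Q\<^esub> y = y \<oplus>\<^bsub>Q\<^esub> x"
      using u v by (auto simp: Q radd M.a_comm)
    fix z assume "z \<in> carrier Q"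
    then obtain w where w: "z = r w" "w \<in> carrier M" by (auto simp: Q)
    show "(x \<oplus>\<^bsub>Q\<^esub> y) \<oplus>\<^bsub>Q\<^esub> z = x \<oplus>\<^bsub>Q\<^esub> (y \<oplus>\<^bsub>Q\<^esub> z)" using u v w by (simp add: Q radd M.a_assoc)
  qed (simp add: Q)
  then have Qlm: "left_module A Q"
    by (intro left_module.intro M.R.ring_axioms left_module_axioms.intro)
      (auto simp: Q radd rsm M.smult_closed M.smult_l_distr M.smult_r_distr M.smult_assoc1 M.smult_one)
  have hom: "(\<lambda>x\<in>carrier M. r x) \<in> mod_hom A M Q"
    by (rule mod_homI) (auto simp: Q radd rsm M.smult_closed)
  have im: "(\<lambda>x\<in>carrier M. r x) ` carrier M = carrier Q" by (auto simp: Q)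
  have "fin_gen A Q"
    using M by (intro fin_gen_image[OF M.left_module_axioms _ Qlm hom im]) (simp add: fg_modules_def)
  moreover have "r x = r \<zero>\<^bsub>M\<^esub> \<longleftrightarrow> x \<in> H" if x: "x \<in> carrier M" for x
  proof
    assume "r x = r \<zero>\<^bsub>M\<^esub>"
    then have "x \<ominus>\<^bsub>M\<^esub> \<zero>\<^bsub>M\<^esub> \<in> H"
      using r[OF x] r[of "\<zero>\<^bsub>M\<^esub>"] trans[of x "r x" "\<zero>\<^bsub>M\<^esub>"] sym[of "\<zero>\<^bsub>M\<^esub>" "r \<zero>\<^bsub>M\<^esub>"] x by simp
    then show "x \<in> H" using x by (simp add: M.diff_zero)
  qed (use req[of x "\<zero>\<^bsub>M\<^esub>"] x in \<open>simp add: M.diff_zero\<close>)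
  ultimately show ?thesis using Qlm hom im
    by (intro bexI[of _ Q] bexI[OF _ hom]) (auto simp: fg_modules_def Q)
qed

section \<open>The category of bounded complexes\<close>

lemma minus_mod_hom:
  assumes "f \<in> mod_hom A M N" "left_module A M" "left_module A N"
  shows "(\<lambda>x\<in>carrier M. \<ominus>\<^bsub>N\<^esub> f x) \<in> mod_hom A M N"
proof -
  interpret M: left_module A M by fact
  interpret N: left_module A N by fact
  show ?thesis using mod_hom_closed[OF assms(1)]
    by (intro mod_homI)
      (auto simp: mod_hom_add[OF assms(1)] mod_hom_smult[OF assms(1)] M.smult_closed N.minus_add
        N.smult_minus_r)
qed

lemma
  assumes "X \<in> bounded_complexes A"
  shows bc_fg: "Term X i \<in> fg_modules A"
    and bc_module: "left_module A (Term X i)"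
    and bc_Dif: "Dif X i \<in> mod_hom A (Term X i) (Term X (i + 1))"
    and bc_Dif_Dif: "x \<in> carrier (Term X i) \<Longrightarrow> Dif X (i + 1) (Dif X i x) = \<zero>\<^bsub>Term X (i + 2)\<^esub>"
    and bc_finite: "finite {i. carrier (Term X i) \<noteq> {\<zero>\<^bsub>Term X i\<^esub>}}"
proof -
  show "left_module A (Term X i)" using assms by (simp add: bounded_complexes_def fg_modules_def)
qed (use assms in \<open>auto simp: bounded_complexes_def\<close>)

lemma bounded_complexesI:
  assumes "\<And>i. Term X i \<in> fg_modules A"
    and "\<And>i. Dif X i \<in> mod_hom A (Term X i) (Term X (i + 1))"
    and "\<And>i x. x \<in> carrier (Term X i) \<Longrightarrow> Dif X (i + 1) (Dif X i x) = \<zero>\<^bsub>Term X (i + 2)\<^esub>"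
    and "finite J" "\<And>i. i \<notin> J \<Longrightarrow> carrier (Term X i) = {\<zero>\<^bsub>Term X i\<^esub>}"
  shows "X \<in> bounded_complexes A"
proof -
  have "{i. carrier (Term X i) \<noteq> {\<zero>\<^bsub>Term X i\<^esub>}} \<subseteq> J" using assms(5) by blast
  then show ?thesis using assms(1-3) finite_subset[OF _ assms(4)] by (simp add: bounded_complexes_def)
qed

lemma chain_mapsI:
  assumes "X \<in> bounded_complexes A" "Y \<in> bounded_complexes A"
    and "\<And>i. f i \<in> mod_hom A (Term X i) (Term Y i)"
    and "\<And>i x. x \<in> carrier (Term X i) \<Longrightarrow> f (i + 1) (Dif X i x) = Dif Y i (f i x)"
  shows "(X, f, Y) \<in> chain_maps A"
  using assms by (simp add: chain_maps_def)

lemma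
  assumes "(X, f, Y) \<in> chain_maps A"
  shows chain_map_dom: "X \<in> bounded_complexes A"
    and chain_map_cod: "Y \<in> bounded_complexes A"
    and chain_map_hom: "f i \<in> mod_hom A (Term X i) (Term Y i)"
    and chain_map_Dif: "x \<in> carrier (Term X i) \<Longrightarrow> f (i + 1) (Dif X i x) = Dif Y i (f i x)"
  using assms by (auto simp: chain_maps_def)

lemma Ch_simps [simp]:
  "Obj (Ch A) = bounded_complexes A" "Arr (Ch A) = chain_maps A"
  "Dom (Ch A) (X, f, Y) = X" "Cod (Ch A) (X, f, Y) = Y"
  "Ident (Ch A) X = (X, \<lambda>i. \<lambda>x\<in>carrier (Term X i). x, X)"
  "Comp (Ch A) (Y', g, Z) (X, f, Y) = (X, \<lambda>i. compose (carrier (Term X i)) (g i) (f i), Z)"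
  by (simp_all add: Ch_def)

lemma Ch_Hom: "a \<in> Hom (Ch A) X Y \<longleftrightarrow> (\<exists>f. a = (X, f, Y) \<and> (X, f, Y) \<in> chain_maps A)"
  by (cases a) (auto simp: Hom_def)

lemma Ch_Ident: "X \<in> bounded_complexes A \<Longrightarrow> (X, \<lambda>i. \<lambda>x\<in>carrier (Term X i). x, X) \<in> chain_maps A"
  by (rule chain_mapsI) (auto simp: ident_mod_hom bc_module mod_hom_closed[OF bc_Dif])

lemma Ch_compose:
  assumes "(X, f, Y) \<in> chain_maps A" "(Y, g, Z) \<in> chain_maps A"
  shows "(X, \<lambda>i. compose (carrier (Term X i)) (g i) (f i), Z) \<in> chain_maps A"
proof (rule chain_mapsI)
  note f = chain_map_dom[OF assms(1)] chain_map_hom[OF assms(1)] chain_map_Dif[OF assms(1)]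
  note g = chain_map_cod[OF assms(2)] chain_map_hom[OF assms(2)] chain_map_Dif[OF assms(2)]
  show "X \<in> bounded_complexes A" "Z \<in> bounded_complexes A" by (fact f g)+
  fix i
  show "compose (carrier (Term X i)) (g i) (f i) \<in> mod_hom A (Term X i) (Term Z i)"
    by (rule compose_mod_hom[OF f(2) g(2) bc_module[OF f(1)]])
  fix x assume x: "x \<in> carrier (Term X i)"
  show "compose (carrier (Term X (i + 1))) (g (i + 1)) (f (i + 1)) (Dif X i x) =
      Dif Z i (compose (carrier (Term X i)) (g i) (f i) x)"
    using x f g mod_hom_closed[OF bc_Dif[OF f(1)] x] mod_hom_closed[OF f(2) x]
    by (simp add: compose_def)
qed

lemma cat_Ch: "cat (Ch A)"
proof
  fix f X Y g Z h V assume "f \<in> Hom (Ch A) X Y" "g \<in> Hom (Ch A) Y Z" "h \<in> Hom (Ch A) Z V"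
  then show "Comp (Ch A) h (Comp (Ch A) g f) = Comp (Ch A) (Comp (Ch A) h g) f"
    by (auto simp: Ch_Hom compose_def fun_eq_iff mod_hom_closed[OF chain_map_hom])
next
  fix f X Y assume "f \<in> Hom (Ch A) X Y"
  then show "Comp (Ch A) (Ident (Ch A) Y) f = f" "Comp (Ch A) f (Ident (Ch A) X) = f"
    by (auto simp: Ch_Hom compose_def fun_eq_iff mod_hom_closed[OF chain_map_hom]
      mod_hom_undefined[OF chain_map_hom])
qed (auto simp: Ch_Hom intro: Ch_Ident Ch_compose chain_map_dom chain_map_cod)

lemma zero_cpx_is_zero:
  assumes Z: "Z \<in> bounded_complexes A" and zero: "\<And>i. carrier (Term Z i) = {\<zero>\<^bsub>Term Z i\<^esub>}"
  shows "is_zero (Ch A) Z"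
  unfolding is_zero_def
proof (intro conjI ballI)
  fix X assume "X \<in> Obj (Ch A)"
  then have X: "X \<in> bounded_complexes A" by simp
  let ?f = "(Z, \<lambda>i. \<lambda>x\<in>carrier (Term Z i). \<zero>\<^bsub>Term X i\<^esub>, X)"
  let ?g = "(X, \<lambda>i. \<lambda>x\<in>carrier (Term X i). \<zero>\<^bsub>Term Z i\<^esub>, Z)"
  note d = mod_hom_closed[OF bc_Dif[OF X]] mod_hom_closed[OF bc_Dif[OF Z]]
    mod_hom_zero[OF bc_Dif[OF X] bc_module[OF X] bc_module[OF X]]
    mod_hom_zero[OF bc_Dif[OF Z] bc_module[OF Z] bc_module[OF Z]]
  have f: "?f \<in> chain_maps A"
    by (rule chain_mapsI[OF Z X zero_mod_hom[OF bc_module[OF Z] bc_module[OF X]]])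
      (use d zero in auto)
  have g: "?g \<in> chain_maps A"
    by (rule chain_mapsI[OF X Z zero_mod_hom[OF bc_module[OF X] bc_module[OF Z]]])
      (use d zero in auto)
  show "\<exists>!f. f \<in> Hom (Ch A) Z X"
  proof (rule ex1I)
    show "?f \<in> Hom (Ch A) Z X" using f by (simp add: Ch_Hom)
    fix h assume "h \<in> Hom (Ch A) Z X"
    then obtain k where h: "h = (Z, k, X)" "(Z, k, X) \<in> chain_maps A" by (auto simp: Ch_Hom)
    have "k i = (\<lambda>x\<in>carrier (Term Z i). \<zero>\<^bsub>Term X i\<^esub>)" for i
      using zero mod_hom_zero[OF chain_map_hom[OF h(2)] bc_module[OF Z] bc_module[OF X]]
      by (intro mod_hom_eqI[OF chain_map_hom[OF h(2)] chain_map_hom[OF f]]) auto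
    then show "h = ?f" by (simp add: h fun_eq_iff)
  qed
  show "\<exists>!f. f \<in> Hom (Ch A) X Z"
  proof (rule ex1I)
    show "?g \<in> Hom (Ch A) X Z" using g by (simp add: Ch_Hom)
    fix h assume "h \<in> Hom (Ch A) X Z"
    then obtain k where h: "h = (X, k, Z)" "(X, k, Z) \<in> chain_maps A" by (auto simp: Ch_Hom)
    have "k i = (\<lambda>x\<in>carrier (Term X i). \<zero>\<^bsub>Term Z i\<^esub>)" for i
      using zero mod_hom_closed[OF chain_map_hom[OF h(2)]]
      by (intro mod_hom_eqI[OF chain_map_hom[OF h(2)] chain_map_hom[OF g]]) auto
    then show "h = ?g" by (simp add: h fun_eq_iff)
  qed
qed (use Z in simp)

section \<open>Direct sums of complexes\<close>

text \<open>The map \<open>i x \<oplus> j y \<mapsto> f x \<oplus> g y\<close> is well defined by uniqueness of the decomposition, and a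
  chain map because \<open>i\<close> and \<open>j\<close> are. The hypotheses speak of elements, so that they cover external
  products, internal decompositions and isomorphisms alike.\<close>

lemma Ch_coproduct:
  assumes i: "(X, i, S) \<in> chain_maps A" and j: "(Y, j, S) \<in> chain_maps A"
    and dec: "\<And>n s. s \<in> carrier (Term S n) \<Longrightarrow>
      \<exists>x\<in>carrier (Term X n). \<exists>y\<in>carrier (Term Y n). s = i n x \<oplus>\<^bsub>Term S n\<^esub> j n y"
    and inj: "\<And>n x y. x \<in> carrier (Term X n) \<Longrightarrow> y \<in> carrier (Term Y n) \<Longrightarrow>
      i n x \<oplus>\<^bsub>Term S n\<^esub> j n y = \<zero>\<^bsub>Term S n\<^esub> \<Longrightarrow> x = \<zero>\<^bsub>Term X n\<^esub> \<and> y = \<zero>\<^bsub>Term Y n\<^esub>"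
    and f: "f \<in> Hom (Ch A) X Z" and g: "g \<in> Hom (Ch A) Y Z"
  shows "\<exists>!h. h \<in> Hom (Ch A) S Z \<and> Comp (Ch A) h (X, i, S) = f \<and> Comp (Ch A) h (Y, j, S) = g"
proof -
  obtain f' g' where f': "f = (X, f', Z)" "(X, f', Z) \<in> chain_maps A"
    and g': "g = (Y, g', Z)" "(Y, g', Z) \<in> chain_maps A"
    using f g by (auto simp: Ch_Hom)
  note X = chain_map_dom[OF i] and Y = chain_map_dom[OF j] and S = chain_map_cod[OF i]
    and Z = chain_map_cod[OF f'(2)]
  note ih = chain_map_hom[OF i] and jh = chain_map_hom[OF j] and fh = chain_map_hom[OF f'(2)]
    and gh = chain_map_hom[OF g'(2)]
  note ic = mod_hom_closed[OF ih] and jc = mod_hom_closed[OF jh]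
    and fc = mod_hom_closed[OF fh] and gc = mod_hom_closed[OF gh]
  interpret X: left_module A "Term X n" for n by (rule bc_module[OF X])
  interpret Y: left_module A "Term Y n" for n by (rule bc_module[OF Y])
  interpret S: left_module A "Term S n" for n by (rule bc_module[OF S])
  interpret Z: left_module A "Term Z n" for n by (rule bc_module[OF Z])
  have uniq: "x = x' \<and> y = y'"
    if "x \<in> carrier (Term X n)" "y \<in> carrier (Term Y n)" "x' \<in> carrier (Term X n)" "y' \<in> carrier (Term Y n)"
      "i n x \<oplus>\<^bsub>Term S n\<^esub> j n y = i n x' \<oplus>\<^bsub>Term S n\<^esub> j n y'" for n x y x' y'
  proof -
    have "i n (x \<ominus>\<^bsub>Term X n\<^esub> x') = i n x \<ominus>\<^bsub>Term S n\<^esub> i n x'"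
      using that by (simp add: X.M.minus_eq S.M.minus_eq mod_hom_add[OF ih]
        mod_hom_minus[OF ih X.left_module_axioms S.left_module_axioms])
    moreover have "j n (y \<ominus>\<^bsub>Term Y n\<^esub> y') = j n y \<ominus>\<^bsub>Term S n\<^esub> j n y'"
      using that by (simp add: Y.M.minus_eq S.M.minus_eq mod_hom_add[OF jh]
        mod_hom_minus[OF jh Y.left_module_axioms S.left_module_axioms])
    moreover have "(i n x \<ominus>\<^bsub>Term S n\<^esub> i n x') \<oplus>\<^bsub>Term S n\<^esub> (j n y \<ominus>\<^bsub>Term S n\<^esub> j n y') = \<zero>\<^bsub>Term S n\<^esub>"
      using that ic jc by (simp add: S.M.add_diff_add[symmetric]) (simp add: S.M.minus_eq S.M.r_neg)
    ultimately have "x \<ominus>\<^bsub>Term X n\<^esub> x' = \<zero>\<^bsub>Term X n\<^esub> \<and> y \<ominus>\<^bsub>Term Y n\<^esub> y' = \<zero>\<^bsub>Term Y n\<^esub>"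
      using that by (intro inj) simp_all
    then show ?thesis using that X.M.diff_zero_imp_eq Y.M.diff_zero_imp_eq by blast
  qed
  define h where "h n = (\<lambda>s\<in>carrier (Term S n). THE z. \<exists>x\<in>carrier (Term X n). \<exists>y\<in>carrier (Term Y n).
      s = i n x \<oplus>\<^bsub>Term S n\<^esub> j n y \<and> z = f' n x \<oplus>\<^bsub>Term Z n\<^esub> g' n y)" for n
  have h: "h n (i n x \<oplus>\<^bsub>Term S n\<^esub> j n y) = f' n x \<oplus>\<^bsub>Term Z n\<^esub> g' n y"
    if "x \<in> carrier (Term X n)" "y \<in> carrier (Term Y n)" for n x y
  proof -
    have "(THE z. \<exists>x'\<in>carrier (Term X n). \<exists>y'\<in>carrier (Term Y n).
      i n x \<oplus>\<^bsub>Term S n\<^esub> j n y = i n x' \<oplus>\<^bsub>Term S n\<^esub> j n y' \<and> z = f' n x' \<oplus>\<^bsub>Term Z n\<^esub> g' n y')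
      = f' n x \<oplus>\<^bsub>Term Z n\<^esub> g' n y"
      using that uniq by (intro the_equality) blast+
    then show ?thesis using that ic jc by (simp add: h_def)
  qed
  have i0: "i n \<zero>\<^bsub>Term X n\<^esub> = \<zero>\<^bsub>Term S n\<^esub>" and j0: "j n \<zero>\<^bsub>Term Y n\<^esub> = \<zero>\<^bsub>Term S n\<^esub>"
    and f0: "f' n \<zero>\<^bsub>Term X n\<^esub> = \<zero>\<^bsub>Term Z n\<^esub>" and g0: "g' n \<zero>\<^bsub>Term Y n\<^esub> = \<zero>\<^bsub>Term Z n\<^esub>" for n
    using mod_hom_zero[OF ih] mod_hom_zero[OF jh] mod_hom_zero[OF fh] mod_hom_zero[OF gh]
      X.left_module_axioms Y.left_module_axioms S.left_module_axioms Z.left_module_axioms by blast+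
  have hi: "h n (i n x) = f' n x" if "x \<in> carrier (Term X n)" for n x
    using h[OF that, of "\<zero>\<^bsub>Term Y n\<^esub>"] that ic fc by (simp add: j0 g0)
  have hj: "h n (j n y) = g' n y" if "y \<in> carrier (Term Y n)" for n y
    using h[OF _ that, of "\<zero>\<^bsub>Term X n\<^esub>"] that jc gc by (simp add: i0 f0)
  have hh: "h n \<in> mod_hom A (Term S n) (Term Z n)" for n
  proof (rule mod_homI)
    fix s assume "s \<in> carrier (Term S n)"
    then obtain x y where s: "x \<in> carrier (Term X n)" "y \<in> carrier (Term Y n)" "s = i n x \<oplus>\<^bsub>Term S n\<^esub> j n y"
      using dec by blast
    show "h n s \<in> carrier (Term Z n)" using s fc gc by (simp add: h)
    {
      fix a assume a: "a \<in> carrier A"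
      have "a \<odot>\<^bsub>Term S n\<^esub> s = i n (a \<odot>\<^bsub>Term X n\<^esub> x) \<oplus>\<^bsub>Term S n\<^esub> j n (a \<odot>\<^bsub>Term Y n\<^esub> y)"
        using s a ic jc by (simp add: S.smult_r_distr mod_hom_smult[OF ih] mod_hom_smult[OF jh])
      then show "h n (a \<odot>\<^bsub>Term S n\<^esub> s) = a \<odot>\<^bsub>Term Z n\<^esub> h n s"
        using s a fc gc by (simp add: h X.smult_closed Y.smult_closed Z.smult_r_distr
          mod_hom_smult[OF fh] mod_hom_smult[OF gh])
    next
      fix s' assume "s' \<in> carrier (Term S n)"
      then obtain x' y' where s': "x' \<in> carrier (Term X n)" "y' \<in> carrier (Term Y n)" "s' = i n x' \<oplus>\<^bsub>Term S n\<^esub> j n y'"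
        using dec by blast
      have "s \<oplus>\<^bsub>Term S n\<^esub> s' = i n (x \<oplus>\<^bsub>Term X n\<^esub> x') \<oplus>\<^bsub>Term S n\<^esub> j n (y \<oplus>\<^bsub>Term Y n\<^esub> y')"
        using s s' ic jc by (simp add: mod_hom_add[OF ih] mod_hom_add[OF jh] S.M.a_assoc S.M.a_lcomm)
      then show "h n (s \<oplus>\<^bsub>Term S n\<^esub> s') = h n s \<oplus>\<^bsub>Term Z n\<^esub> h n s'"
        using s s' fc gc by (simp add: h mod_hom_add[OF fh] mod_hom_add[OF gh] Z.M.a_assoc Z.M.a_lcomm)
    }
  qed (simp add: h_def)
  have hcm: "(S, h, Z) \<in> chain_maps A"
  proof (rule chain_mapsI[OF S Z hh])
    fix n s assume "s \<in> carrier (Term S n)"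
    then obtain x y where s: "x \<in> carrier (Term X n)" "y \<in> carrier (Term Y n)" "s = i n x \<oplus>\<^bsub>Term S n\<^esub> j n y"
      using dec by blast
    note dX = mod_hom_closed[OF bc_Dif[OF X]] and dY = mod_hom_closed[OF bc_Dif[OF Y]]
    have "Dif S n s = i (n + 1) (Dif X n x) \<oplus>\<^bsub>Term S (n + 1)\<^esub> j (n + 1) (Dif Y n y)"
      using s ic jc by (simp add: mod_hom_add[OF bc_Dif[OF S]] chain_map_Dif[OF i] chain_map_Dif[OF j])
    then show "h (n + 1) (Dif S n s) = Dif Z n (h n s)"
      using s fc gc dX dY
      by (simp add: h mod_hom_add[OF bc_Dif[OF Z]] chain_map_Dif[OF f'(2)] chain_map_Dif[OF g'(2)])
  qed
  show ?thesis
  proof (rule ex1I)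
    show "(S, h, Z) \<in> Hom (Ch A) S Z \<and> Comp (Ch A) (S, h, Z) (X, i, S) = f \<and> Comp (Ch A) (S, h, Z) (Y, j, S) = g"
      using hcm hi hj by (auto simp: Ch_Hom f' g' compose_def fun_eq_iff mod_hom_undefined[OF fh]
        mod_hom_undefined[OF gh])
    fix k assume k: "k \<in> Hom (Ch A) S Z \<and> Comp (Ch A) k (X, i, S) = f \<and> Comp (Ch A) k (Y, j, S) = g"
    then obtain k' where k': "k = (S, k', Z)" "(S, k', Z) \<in> chain_maps A" by (auto simp: Ch_Hom)
    note kh = chain_map_hom[OF k'(2)]
    have ki: "k' n (i n x) = f' n x" if "x \<in> carrier (Term X n)" for n x
    proof -
      have "compose (carrier (Term X n)) (k' n) (i n) x = f' n x"
        using k by (auto simp: k' f' fun_eq_iff)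
      then show ?thesis using that by (simp add: compose_def)
    qed
    have kj: "k' n (j n y) = g' n y" if "y \<in> carrier (Term Y n)" for n y
    proof -
      have "compose (carrier (Term Y n)) (k' n) (j n) y = g' n y"
        using k by (auto simp: k' g' fun_eq_iff)
      then show ?thesis using that by (simp add: compose_def)
    qed
    have "k' n = h n" for n
    proof (rule mod_hom_eqI[OF kh hh])
      fix s assume "s \<in> carrier (Term S n)"
      then obtain x y where s: "x \<in> carrier (Term X n)" "y \<in> carrier (Term Y n)" "s = i n x \<oplus>\<^bsub>Term S n\<^esub> j n y"
        using dec by blast
      then show "k' n s = h n s" using ic jc by (simp add: h mod_hom_add[OF kh] ki kj)
    qed
    then show "k = (S, h, Z)" by (simp add: k' fun_eq_iff)
  qed
qed

lemma Ch_is_direct_sum: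
  assumes i: "(X, i, S) \<in> chain_maps A" and j: "(Y, j, S) \<in> chain_maps A"
    and "\<And>n s. s \<in> carrier (Term S n) \<Longrightarrow>
      \<exists>x\<in>carrier (Term X n). \<exists>y\<in>carrier (Term Y n). s = i n x \<oplus>\<^bsub>Term S n\<^esub> j n y"
    and "\<And>n x y. x \<in> carrier (Term X n) \<Longrightarrow> y \<in> carrier (Term Y n) \<Longrightarrow>
      i n x \<oplus>\<^bsub>Term S n\<^esub> j n y = \<zero>\<^bsub>Term S n\<^esub> \<Longrightarrow> x = \<zero>\<^bsub>Term X n\<^esub> \<and> y = \<zero>\<^bsub>Term Y n\<^esub>"
  shows "is_direct_sum (Ch A) S X Y"
  unfolding is_direct_sum_def
proof (intro conjI, goal_cases)
  case 4
  show ?case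
  proof (rule bexI[of _ "(X, i, S)"], rule bexI[of _ "(Y, j, S)"], intro ballI)
  fix Z f g assume "f \<in> Hom (Ch A) X Z" "g \<in> Hom (Ch A) Y Z"
  then show "\<exists>!h. h \<in> Hom (Ch A) S Z \<and> Comp (Ch A) h (X, i, S) = f \<and> Comp (Ch A) h (Y, j, S) = g"
    using assms by (intro Ch_coproduct[OF i j])
  qed (use i j in \<open>simp_all add: Ch_Hom\<close>)
qed (use chain_map_dom[OF i] chain_map_dom[OF j] chain_map_cod[OF i] in simp_all)

lemma mod_prod_trivial:
  "carrier M = {\<zero>\<^bsub>M\<^esub>} \<Longrightarrow> carrier N = {\<zero>\<^bsub>N\<^esub>} \<Longrightarrow> carrier (mod_prod M N) = {\<zero>\<^bsub>mod_prod M N\<^esub>}"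
  by auto

definition cpx_sum :: "('a, 'a elt) cpx \<Rightarrow> ('a, 'a elt) cpx \<Rightarrow> ('a, 'a elt) cpx" where
  "cpx_sum X Y = \<lparr>Term = (\<lambda>i. mod_prod (Term X i) (Term Y i)),
     Dif = (\<lambda>i. \<lambda>p\<in>carrier (mod_prod (Term X i) (Term Y i)).
       Couple (Dif X i (cfst p)) (Dif Y i (csnd p)))\<rparr>"

lemma cpx_sum_simps [simp]:
  "Term (cpx_sum X Y) i = mod_prod (Term X i) (Term Y i)"
  "x \<in> carrier (Term X i) \<Longrightarrow> y \<in> carrier (Term Y i) \<Longrightarrow>
    Dif (cpx_sum X Y) i (Couple x y) = Couple (Dif X i x) (Dif Y i y)"
  by (simp_all add: cpx_sum_def)

lemma cpx_sum_bounded: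
  assumes X: "X \<in> bounded_complexes A" and Y: "Y \<in> bounded_complexes A"
  shows "cpx_sum X Y \<in> bounded_complexes A"
proof (rule bounded_complexesI)
  interpret X: left_module A "Term X n" for n by (rule bc_module[OF X])
  interpret Y: left_module A "Term Y n" for n by (rule bc_module[OF Y])
  note dX = mod_hom_closed[OF bc_Dif[OF X]] and dY = mod_hom_closed[OF bc_Dif[OF Y]]
  show "finite ({i. carrier (Term X i) \<noteq> {\<zero>\<^bsub>Term X i\<^esub>}} \<union> {i. carrier (Term Y i) \<noteq> {\<zero>\<^bsub>Term Y i\<^esub>}})"
    using bc_finite[OF X] bc_finite[OF Y] by simp
  fix i
  show "Term (cpx_sum X Y) i \<in> fg_modules A" using bc_fg[OF X] bc_fg[OF Y] by (simp add: mod_prod_fg)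
  show "carrier (Term (cpx_sum X Y) i) = {\<zero>\<^bsub>Term (cpx_sum X Y) i\<^esub>}"
    if "i \<notin> {i. carrier (Term X i) \<noteq> {\<zero>\<^bsub>Term X i\<^esub>}} \<union> {i. carrier (Term Y i) \<noteq> {\<zero>\<^bsub>Term Y i\<^esub>}}"
    using that by auto
  show "Dif (cpx_sum X Y) i \<in> mod_hom A (Term (cpx_sum X Y) i) (Term (cpx_sum X Y) (i + 1))"
  proof (rule mod_homI)
    show "Dif (cpx_sum X Y) i p = undefined" if "p \<notin> carrier (Term (cpx_sum X Y) i)" for p
      using that by (auto simp: cpx_sum_def)
  qed (auto simp: dX dY mod_hom_add[OF bc_Dif[OF X]] mod_hom_add[OF bc_Dif[OF Y]]
    mod_hom_smult[OF bc_Dif[OF X]] mod_hom_smult[OF bc_Dif[OF Y]] X.smult_closed Y.smult_closed)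
  fix p assume "p \<in> carrier (Term (cpx_sum X Y) i)"
  then show "Dif (cpx_sum X Y) (i + 1) (Dif (cpx_sum X Y) i p) = \<zero>\<^bsub>Term (cpx_sum X Y) (i + 2)\<^esub>"
    by (auto simp: dX dY bc_Dif_Dif[OF X] bc_Dif_Dif[OF Y])
qed

definition cpx_sum_inl :: "('a, 'a elt) cpx \<Rightarrow> ('a, 'a elt) cpx \<Rightarrow> ('a, 'a elt) cpx_arr" where
  "cpx_sum_inl X Y = (X, \<lambda>i. \<lambda>x\<in>carrier (Term X i). Couple x \<zero>\<^bsub>Term Y i\<^esub>, cpx_sum X Y)"

definition cpx_sum_inr :: "('a, 'a elt) cpx \<Rightarrow> ('a, 'a elt) cpx \<Rightarrow> ('a, 'a elt) cpx_arr" where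
  "cpx_sum_inr X Y = (Y, \<lambda>i. \<lambda>y\<in>carrier (Term Y i). Couple \<zero>\<^bsub>Term X i\<^esub> y, cpx_sum X Y)"

lemma
  assumes X: "X \<in> bounded_complexes A" and Y: "Y \<in> bounded_complexes A"
  shows cpx_sum_inl_chain_map: "cpx_sum_inl X Y \<in> chain_maps A"
    and cpx_sum_inr_chain_map: "cpx_sum_inr X Y \<in> chain_maps A"
proof -
  interpret X: left_module A "Term X n" for n by (rule bc_module[OF X])
  interpret Y: left_module A "Term Y n" for n by (rule bc_module[OF Y])
  note dX = mod_hom_closed[OF bc_Dif[OF X]] and dY = mod_hom_closed[OF bc_Dif[OF Y]]
    and dX0 = mod_hom_zero[OF bc_Dif[OF X] bc_module[OF X] bc_module[OF X]]
    and dY0 = mod_hom_zero[OF bc_Dif[OF Y] bc_module[OF Y] bc_module[OF Y]]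
  show "cpx_sum_inl X Y \<in> chain_maps A" unfolding cpx_sum_inl_def
    by (intro chain_mapsI mod_homI cpx_sum_bounded X Y)
      (auto simp: dX dY0 X.smult_closed Y.smult_zero_r)
  show "cpx_sum_inr X Y \<in> chain_maps A" unfolding cpx_sum_inr_def
    by (intro chain_mapsI mod_homI cpx_sum_bounded X Y)
      (auto simp: dY dX0 Y.smult_closed X.smult_zero_r)
qed

lemma cpx_sum_universal:
  assumes f: "f \<in> Hom (Ch A) X Z" and g: "g \<in> Hom (Ch A) Y Z"
  shows "\<exists>!h. h \<in> Hom (Ch A) (cpx_sum X Y) Z \<and> Comp (Ch A) h (cpx_sum_inl X Y) = f \<and>
    Comp (Ch A) h (cpx_sum_inr X Y) = g"
proof -
  have X: "X \<in> bounded_complexes A" and Y: "Y \<in> bounded_complexes A"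
    using f g by (auto simp: Ch_Hom chain_map_dom)
  interpret X: left_module A "Term X n" for n by (rule bc_module[OF X])
  interpret Y: left_module A "Term Y n" for n by (rule bc_module[OF Y])
  show ?thesis unfolding cpx_sum_inl_def cpx_sum_inr_def
  proof (rule Ch_coproduct[OF _ _ _ _ f g])
    fix n s assume "s \<in> carrier (Term (cpx_sum X Y) n)"
    then obtain x y where "s = Couple x y" "x \<in> carrier (Term X n)" "y \<in> carrier (Term Y n)" by auto
    then show "\<exists>x\<in>carrier (Term X n). \<exists>y\<in>carrier (Term Y n).
        s = (\<lambda>x\<in>carrier (Term X n). Couple x \<zero>\<^bsub>Term Y n\<^esub>) x \<oplus>\<^bsub>Term (cpx_sum X Y) n\<^esub>
          (\<lambda>y\<in>carrier (Term Y n). Couple \<zero>\<^bsub>Term X n\<^esub> y) y"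
      by (intro bexI[of _ x] bexI[of _ y]) auto
  qed (use cpx_sum_inl_chain_map[OF X Y] cpx_sum_inr_chain_map[OF X Y] in \<open>auto simp: cpx_sum_inl_def cpx_sum_inr_def\<close>)
qed

section \<open>Quasi-isomorphisms\<close>

lemma bc_Dif_pred: "X \<in> bounded_complexes A \<Longrightarrow> Dif X (i - 1) \<in> mod_hom A (Term X (i - 1)) (Term X i)"
  using bc_Dif[of X A "i - 1"] by simp

lemma boundaries_submodule:
  assumes X: "X \<in> bounded_complexes A"
  shows "submodule (boundaries X i) A (Term X i)"
proof -
  interpret P: left_module A "Term X (i - 1)" by (rule bc_module[OF X])
  interpret X: left_module A "Term X i" by (rule bc_module[OF X])
  note d = bc_Dif_pred[OF X, of i]
  show ?thesis unfolding boundaries_def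
  proof (rule X.submoduleI)
    show "\<zero>\<^bsub>Term X i\<^esub> \<in> Dif X (i - 1) ` carrier (Term X (i - 1))"
      using mod_hom_zero[OF d P.left_module_axioms X.left_module_axioms, symmetric] by simp
    fix a x assume "a \<in> carrier A" "x \<in> Dif X (i - 1) ` carrier (Term X (i - 1))"
    then show "a \<odot>\<^bsub>Term X i\<^esub> x \<in> Dif X (i - 1) ` carrier (Term X (i - 1))"
      by (auto simp: mod_hom_smult[OF d, symmetric] P.smult_closed)
  qed (use mod_hom_closed[OF d] in \<open>auto simp: mod_hom_add[OF d, symmetric]\<close>)
qed

lemma boundaries_subset_cycles: 
  assumes "X \<in> bounded_complexes A" "x \<in> boundaries X i"
  shows "x \<in> cycles X i"
  using assms(2) mod_hom_closed[OF bc_Dif_pred[OF assms(1), of i]] bc_Dif_Dif[OF assms(1), of _ "i - 1"]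
  by (auto simp: boundaries_def cycles_def add.commute)

lemma cycles_diff:
  assumes "X \<in> bounded_complexes A" "x \<in> cycles X i" "y \<in> cycles X i"
  shows "x \<ominus>\<^bsub>Term X i\<^esub> y \<in> cycles X i"
proof -
  interpret X: left_module A "Term X n" for n by (rule bc_module[OF assms(1)])
  show ?thesis using assms(2,3)
    by (auto simp: cycles_def X.M.minus_eq mod_hom_add[OF bc_Dif[OF assms(1)]] X.M.a_inv_zero
      mod_hom_minus[OF bc_Dif[OF assms(1)] X.left_module_axioms X.left_module_axioms])
qed

lemma
  assumes f: "(X, f, Y) \<in> chain_maps A"
  shows chain_map_cycle: "z \<in> cycles X i \<Longrightarrow> f i z \<in> cycles Y i"
    and chain_map_boundary: "z \<in> boundaries X i \<Longrightarrow> f i z \<in> boundaries Y i"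
proof -
  note X = chain_map_dom[OF f] and Y = chain_map_cod[OF f]
  show "f i z \<in> cycles Y i" if "z \<in> cycles X i"
    using that mod_hom_closed[OF chain_map_hom[OF f]] chain_map_Dif[OF f, of z i]
      mod_hom_zero[OF chain_map_hom[OF f] bc_module[OF X] bc_module[OF Y]]
    by (auto simp: cycles_def)
  show "f i z \<in> boundaries Y i" if z: "z \<in> boundaries X i"
  proof -
    obtain x where x: "x \<in> carrier (Term X (i - 1))" "z = Dif X (i - 1) x"
      using z by (auto simp: boundaries_def)
    then have "f i z = Dif Y (i - 1) (f (i - 1) x)" using chain_map_Dif[OF f x(1)] by simp
    then show ?thesis using x mod_hom_closed[OF chain_map_hom[OF f]] by (auto simp: boundaries_def)
  qed
qed

lemma (in left_module) coset_eq_iff: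
  assumes B: "submodule B A M" and "x \<in> carrier M" "y \<in> carrier M"
  shows "B +>\<^bsub>M\<^esub> x = B +>\<^bsub>M\<^esub> y \<longleftrightarrow> x \<ominus>\<^bsub>M\<^esub> y \<in> B"
proof
  note B' = submodule_zero[OF B] submodule_add[OF B] submodule_minus[OF B] subsetD[OF submodule_subset[OF B]]
  have mem: "u \<in> B +>\<^bsub>M\<^esub> v \<longleftrightarrow> u \<ominus>\<^bsub>M\<^esub> v \<in> B" if "u \<in> carrier M" "v \<in> carrier M" for u v
  proof
    assume "u \<in> B +>\<^bsub>M\<^esub> v"
    then obtain b where "b \<in> B" "u = b \<oplus>\<^bsub>M\<^esub> v" by (auto simp: a_r_coset_def')
    then show "u \<ominus>\<^bsub>M\<^esub> v \<in> B" using that B'(4) by (simp add: M.minus_eq M.a_assoc M.r_neg)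
  next
    assume "u \<ominus>\<^bsub>M\<^esub> v \<in> B"
    moreover have "u = (u \<ominus>\<^bsub>M\<^esub> v) \<oplus>\<^bsub>M\<^esub> v" using that by (simp add: M.minus_eq M.a_assoc M.l_neg)
    ultimately show "u \<in> B +>\<^bsub>M\<^esub> v" unfolding a_r_coset_def' by blast
  qed
  have sub: "B +>\<^bsub>M\<^esub> v \<subseteq> carrier M" if "v \<in> carrier M" for v using that B'(4) by (auto simp: a_r_coset_def')
  {
    assume "B +>\<^bsub>M\<^esub> x = B +>\<^bsub>M\<^esub> y"
    moreover have "x \<in> B +>\<^bsub>M\<^esub> x" using mem assms B'(1) by (simp add: M.minus_eq M.r_neg)
    ultimately show "x \<ominus>\<^bsub>M\<^esub> y \<in> B" using mem assms by simp
  next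
    assume xy: "x \<ominus>\<^bsub>M\<^esub> y \<in> B"
    then have yx: "y \<ominus>\<^bsub>M\<^esub> x \<in> B" using B'(3)[OF xy] assms by (simp add: M.minus_diff)
    have "u \<in> B +>\<^bsub>M\<^esub> x \<longleftrightarrow> u \<in> B +>\<^bsub>M\<^esub> y" if u: "u \<in> carrier M" for u
      using mem[OF u] assms B'(2)[OF _ xy, of "u \<ominus>\<^bsub>M\<^esub> x"] B'(2)[OF _ yx, of "u \<ominus>\<^bsub>M\<^esub> y"] u
      by (auto simp: M.diff_add_diff)
    then show "B +>\<^bsub>M\<^esub> x = B +>\<^bsub>M\<^esub> y" using sub assms by blast
  }
qed

text \<open>Injectivity and surjectivity on cohomology, expressed without cosets.\<close>

lemma quasi_isos_iff:
  assumes f: "(X, f, Y) \<in> chain_maps A"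
  shows "(X, f, Y) \<in> quasi_isos A \<longleftrightarrow> (\<forall>i.
    (\<forall>z\<in>cycles X i. f i z \<in> boundaries Y i \<longrightarrow> z \<in> boundaries X i) \<and>
    (\<forall>y\<in>cycles Y i. \<exists>z\<in>cycles X i. f i z \<ominus>\<^bsub>Term Y i\<^esub> y \<in> boundaries Y i))"
proof -
  let ?x = "\<lambda>i z. boundaries X i +>\<^bsub>Term X i\<^esub> z" and ?y = "\<lambda>i z. boundaries Y i +>\<^bsub>Term Y i\<^esub> z"
  note X = chain_map_dom[OF f] and Y = chain_map_cod[OF f] and fh = chain_map_hom[OF f]
  interpret X: left_module A "Term X n" for n by (rule bc_module[OF X])
  interpret Y: left_module A "Term Y n" for n by (rule bc_module[OF Y])
  note BX = boundaries_submodule[OF X] and BY = boundaries_submodule[OF Y]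
  have cX: "z \<in> carrier (Term X i)" if "z \<in> cycles X i" for z i using that by (simp add: cycles_def)
  have cY: "z \<in> carrier (Term Y i)" if "z \<in> cycles Y i" for z i using that by (simp add: cycles_def)
  have coh: "?x i z \<in> cohomology X i" if "z \<in> cycles X i" for z i
    using that unfolding cohomology_def by (rule imageI)
  have map: "cohomology_map (X, f, Y) i (?x i z) = ?y i (f i z)"
    if z: "z \<in> cycles X i" for i z
  proof -
    have fz: "f i z \<in> carrier (Term Y i)" using mod_hom_closed[OF fh] cX[OF z] .
    have add: "f i (b \<oplus>\<^bsub>Term X i\<^esub> z) = f i b \<oplus>\<^bsub>Term Y i\<^esub> f i z" if "b \<in> boundaries X i" for b
      using mod_hom_add[OF fh] cX[OF z] that X.submodule_subset[OF BX] by blast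
    have z0: "?x i z = {b \<oplus>\<^bsub>Term X i\<^esub> z |b. b \<in> boundaries X i}"
      by (auto simp: a_r_coset_def')
    have "u \<in> boundaries Y i <+>\<^bsub>Term Y i\<^esub> f i ` (?x i z) \<longleftrightarrow>
        u \<in> ?y i (f i z)" for u
    proof
      assume "u \<in> boundaries Y i <+>\<^bsub>Term Y i\<^esub> f i ` (?x i z)"
      then obtain b c where b: "b \<in> boundaries Y i" and c: "c \<in> boundaries X i"
        and u: "u = b \<oplus>\<^bsub>Term Y i\<^esub> f i (c \<oplus>\<^bsub>Term X i\<^esub> z)"
        unfolding z0 set_add_def set_mult_def by auto
      note fc = chain_map_boundary[OF f c]
      have bc: "b \<in> carrier (Term Y i)" "f i c \<in> carrier (Term Y i)" using b fc Y.submodule_subset[OF BY] by auto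
      have "u = (b \<oplus>\<^bsub>Term Y i\<^esub> f i c) \<oplus>\<^bsub>Term Y i\<^esub> f i z"
        unfolding u add[OF c] using bc fz by (simp add: Y.M.a_assoc)
      then show "u \<in> ?y i (f i z)"
        using Y.submodule_add[OF BY b fc] by (auto simp: a_r_coset_def')
    next
      assume "u \<in> ?y i (f i z)"
      then obtain b where b: "b \<in> boundaries Y i" "u = b \<oplus>\<^bsub>Term Y i\<^esub> f i z" by (auto simp: a_r_coset_def')
      have "f i z \<in> f i ` (?x i z)"
        using X.submodule_zero[OF BX] cX[OF z] unfolding z0
        by (intro imageI) (auto intro!: exI[of _ "\<zero>\<^bsub>Term X i\<^esub>"])
      then show "u \<in> boundaries Y i <+>\<^bsub>Term Y i\<^esub> f i ` (?x i z)"
        unfolding b(2) set_add_def set_mult_def using b(1) by (intro UN_I) simp_all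
    qed
    then show ?thesis unfolding cohomology_map_def by auto
  qed
  have "bij_betw (cohomology_map (X, f, Y) i) (cohomology X i) (cohomology Y i) \<longleftrightarrow>
    (\<forall>z\<in>cycles X i. f i z \<in> boundaries Y i \<longrightarrow> z \<in> boundaries X i) \<and>
    (\<forall>y\<in>cycles Y i. \<exists>z\<in>cycles X i. f i z \<ominus>\<^bsub>Term Y i\<^esub> y \<in> boundaries Y i)" for i
  proof -
    have inj: "inj_on (cohomology_map (X, f, Y) i) (cohomology X i) \<longleftrightarrow>
      (\<forall>z\<in>cycles X i. f i z \<in> boundaries Y i \<longrightarrow> z \<in> boundaries X i)"
    proof
      assume L: "inj_on (cohomology_map (X, f, Y) i) (cohomology X i)"
      show "\<forall>z\<in>cycles X i. f i z \<in> boundaries Y i \<longrightarrow> z \<in> boundaries X i"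
      proof (intro ballI impI)
        fix z assume z: "z \<in> cycles X i" and fz: "f i z \<in> boundaries Y i"
        have z0: "\<zero>\<^bsub>Term X i\<^esub> \<in> cycles X i"
          by (rule boundaries_subset_cycles[OF X X.submodule_zero[OF BX]])
        have f0: "f i \<zero>\<^bsub>Term X i\<^esub> = \<zero>\<^bsub>Term Y i\<^esub>"
          by (rule mod_hom_zero[OF fh X.left_module_axioms Y.left_module_axioms])
        have "?y i (f i z) = ?y i (f i \<zero>\<^bsub>Term X i\<^esub>)"
          using fz mod_hom_closed[OF fh cX[OF z]]
          by (simp add: f0 Y.coset_eq_iff[OF BY] Y.M.diff_zero)
        then have "?x i z = ?x i \<zero>\<^bsub>Term X i\<^esub>"
          using inj_onD[OF L _ coh[OF z] coh[OF z0]] by (simp only: map[OF z] map[OF z0])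
        then show "z \<in> boundaries X i"
          unfolding X.coset_eq_iff[OF BX cX[OF z] X.M.zero_closed] using cX[OF z]
          by (simp only: X.M.diff_zero)
      qed
    next
      assume R: "\<forall>z\<in>cycles X i. f i z \<in> boundaries Y i \<longrightarrow> z \<in> boundaries X i"
      show "inj_on (cohomology_map (X, f, Y) i) (cohomology X i)"
      proof (rule inj_onI)
        fix u v assume "u \<in> cohomology X i" "v \<in> cohomology X i"
          and eq: "cohomology_map (X, f, Y) i u = cohomology_map (X, f, Y) i v"
        then obtain z w where z: "z \<in> cycles X i" "u = ?x i z"
          and w: "w \<in> cycles X i" "v = ?x i w" by (auto simp: cohomology_def)
        have c: "z \<in> carrier (Term X i)" "w \<in> carrier (Term X i)" using z w cX by auto
        note fc = mod_hom_closed[OF fh c(1)] mod_hom_closed[OF fh c(2)]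
        have "f i z \<ominus>\<^bsub>Term Y i\<^esub> f i w \<in> boundaries Y i"
          using eq z w Y.coset_eq_iff[OF BY fc] by (simp add: map)
        moreover have "f i (z \<ominus>\<^bsub>Term X i\<^esub> w) = f i z \<ominus>\<^bsub>Term Y i\<^esub> f i w"
          using c by (simp add: X.M.minus_eq Y.M.minus_eq mod_hom_add[OF fh]
            mod_hom_minus[OF fh X.left_module_axioms Y.left_module_axioms])
        ultimately have "z \<ominus>\<^bsub>Term X i\<^esub> w \<in> boundaries X i"
          using R cycles_diff[OF X z(1) w(1)] by simp
        then show "u = v" using X.coset_eq_iff[OF BX c] z w by simp
      qed
    qed
    have im: "cohomology_map (X, f, Y) i ` cohomology X i = (\<lambda>z. ?y i (f i z)) ` cycles X i"
      by (auto simp: cohomology_def map image_image intro!: image_cong)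
    have surj: "cohomology_map (X, f, Y) i ` cohomology X i = cohomology Y i \<longleftrightarrow>
      (\<forall>y\<in>cycles Y i. \<exists>z\<in>cycles X i. f i z \<ominus>\<^bsub>Term Y i\<^esub> y \<in> boundaries Y i)"
    proof -
      have eq: "?y i (f i z) = ?y i y \<longleftrightarrow>
          f i z \<ominus>\<^bsub>Term Y i\<^esub> y \<in> boundaries Y i" if "z \<in> cycles X i" "y \<in> cycles Y i" for z y
        using Y.coset_eq_iff[OF BY mod_hom_closed[OF fh cX[OF that(1)]] cY[OF that(2)]] .
      have "cohomology_map (X, f, Y) i ` cohomology X i \<subseteq> cohomology Y i"
        unfolding im unfolding cohomology_def using chain_map_cycle[OF f] by auto
      then have "cohomology_map (X, f, Y) i ` cohomology X i = cohomology Y i \<longleftrightarrow>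
          cohomology Y i \<subseteq> cohomology_map (X, f, Y) i ` cohomology X i" by blast
      also have "\<dots> \<longleftrightarrow> (\<forall>y\<in>cycles Y i. \<exists>z\<in>cycles X i.
          ?y i (f i z) = ?y i y)"
        unfolding im unfolding cohomology_def by (auto simp: image_iff subset_iff) metis+
      also have "\<dots> \<longleftrightarrow> (\<forall>y\<in>cycles Y i. \<exists>z\<in>cycles X i. f i z \<ominus>\<^bsub>Term Y i\<^esub> y \<in> boundaries Y i)"
        using eq by blast
      finally show ?thesis .
    qed
    show ?thesis unfolding bij_betw_def inj surj ..
  qed
  then show ?thesis using f by (simp add: quasi_isos_def)
qed

lemma quasi_isoD1:
  assumes "(X, f, Y) \<in> quasi_isos A" "z \<in> cycles X i" "f i z \<in> boundaries Y i"
  shows "z \<in> boundaries X i"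
  using assms quasi_isos_iff[of X f Y A] by (auto simp: quasi_isos_def)

lemma quasi_isoD2:
  assumes "(X, f, Y) \<in> quasi_isos A" "y \<in> cycles Y i"
  shows "\<exists>z\<in>cycles X i. f i z \<ominus>\<^bsub>Term Y i\<^esub> y \<in> boundaries Y i"
  using assms quasi_isos_iff[of X f Y A] by (auto simp: quasi_isos_def)

lemma quasi_isoI:
  assumes "(X, f, Y) \<in> chain_maps A"
    and "\<And>i z. z \<in> cycles X i \<Longrightarrow> f i z \<in> boundaries Y i \<Longrightarrow> z \<in> boundaries X i"
    and "\<And>i y. y \<in> cycles Y i \<Longrightarrow> \<exists>z\<in>cycles X i. f i z \<ominus>\<^bsub>Term Y i\<^esub> y \<in> boundaries Y i"
  shows "(X, f, Y) \<in> quasi_isos A"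
  using assms quasi_isos_iff[of X f Y A] by auto

lemma Ident_quasi_iso:
  assumes X: "X \<in> bounded_complexes A"
  shows "(X, \<lambda>i. \<lambda>x\<in>carrier (Term X i). x, X) \<in> quasi_isos A"
proof (rule quasi_isoI[OF Ch_Ident[OF X]])
  interpret X: left_module A "Term X n" for n by (rule bc_module[OF X])
  fix i y assume "y \<in> cycles X i"
  then show "\<exists>z\<in>cycles X i. (\<lambda>x\<in>carrier (Term X i). x) z \<ominus>\<^bsub>Term X i\<^esub> y \<in> boundaries X i"
    using X.submodule_zero[OF boundaries_submodule[OF X]]
    by (intro bexI[of _ y]) (auto simp: cycles_def X.M.minus_eq X.M.r_neg)
qed (auto simp: cycles_def)

lemma cpx_sum_cycles: "Couple x y \<in> cycles (cpx_sum X Y) i \<longleftrightarrow> x \<in> cycles X i \<and> y \<in> cycles Y i"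
  by (auto simp: cycles_def)

lemma cpx_sum_boundaries: "Couple x y \<in> boundaries (cpx_sum X Y) i \<longleftrightarrow> x \<in> boundaries X i \<and> y \<in> boundaries Y i"
proof
  assume "Couple x y \<in> boundaries (cpx_sum X Y) i"
  then show "x \<in> boundaries X i \<and> y \<in> boundaries Y i" by (auto simp: boundaries_def)
next
  assume "x \<in> boundaries X i \<and> y \<in> boundaries Y i"
  then obtain u v where "u \<in> carrier (Term X (i - 1))" "x = Dif X (i - 1) u"
    "v \<in> carrier (Term Y (i - 1))" "y = Dif Y (i - 1) v" by (auto simp: boundaries_def)
  then show "Couple x y \<in> boundaries (cpx_sum X Y) i"
    unfolding boundaries_def by (intro image_eqI[of _ _ "Couple u v"]) auto
qed

text \<open>The map \<open>h\<close> is determined by its restrictions to the summands, hence acts componentwise, and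
  cycles and boundaries of a direct sum are computed componentwise.\<close>

lemma cpx_sum_quasi_iso:
  assumes f: "(X, f, X') \<in> quasi_isos A" and g: "(Y, g, Y') \<in> quasi_isos A"
    and h: "(cpx_sum X Y, h, cpx_sum X' Y') \<in> chain_maps A"
    and hl: "Comp (Ch A) (cpx_sum X Y, h, cpx_sum X' Y') (cpx_sum_inl X Y) = Comp (Ch A) (cpx_sum_inl X' Y') (X, f, X')"
    and hr: "Comp (Ch A) (cpx_sum X Y, h, cpx_sum X' Y') (cpx_sum_inr X Y) = Comp (Ch A) (cpx_sum_inr X' Y') (Y, g, Y')"
  shows "(cpx_sum X Y, h, cpx_sum X' Y') \<in> quasi_isos A"
proof -
  have f': "(X, f, X') \<in> chain_maps A" and g': "(Y, g, Y') \<in> chain_maps A"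
    using f g by (auto simp: quasi_isos_def)
  interpret X: left_module A "Term X n" for n by (rule bc_module[OF chain_map_dom[OF f']])
  interpret Y: left_module A "Term Y n" for n by (rule bc_module[OF chain_map_dom[OF g']])
  interpret X': left_module A "Term X' n" for n by (rule bc_module[OF chain_map_cod[OF f']])
  interpret Y': left_module A "Term Y' n" for n by (rule bc_module[OF chain_map_cod[OF g']])
  note fc = mod_hom_closed[OF chain_map_hom[OF f']] and gc = mod_hom_closed[OF chain_map_hom[OF g']]
  have h_eq: "h i (Couple x y) = Couple (f i x) (g i y)"
    if x: "x \<in> carrier (Term X i)" and y: "y \<in> carrier (Term Y i)" for i x y
  proof -
    have "compose (carrier (Term X i)) (h i) (\<lambda>x\<in>carrier (Term X i). Couple x \<zero>\<^bsub>Term Y i\<^esub>) x =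
      compose (carrier (Term X i)) (\<lambda>x\<in>carrier (Term X' i). Couple x \<zero>\<^bsub>Term Y' i\<^esub>) (f i) x"
      using hl by (simp add: cpx_sum_inl_def fun_eq_iff)
    then have 1: "h i (Couple x \<zero>\<^bsub>Term Y i\<^esub>) = Couple (f i x) \<zero>\<^bsub>Term Y' i\<^esub>"
      using x fc by (simp add: compose_def)
    have "compose (carrier (Term Y i)) (h i) (\<lambda>y\<in>carrier (Term Y i). Couple \<zero>\<^bsub>Term X i\<^esub> y) y =
      compose (carrier (Term Y i)) (\<lambda>y\<in>carrier (Term Y' i). Couple \<zero>\<^bsub>Term X' i\<^esub> y) (g i) y"
      using hr by (simp add: cpx_sum_inr_def fun_eq_iff)
    then have 2: "h i (Couple \<zero>\<^bsub>Term X i\<^esub> y) = Couple \<zero>\<^bsub>Term X' i\<^esub> (g i y)"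
      using y gc by (simp add: compose_def)
    have "h i (Couple x \<zero>\<^bsub>Term Y i\<^esub> \<oplus>\<^bsub>Term (cpx_sum X Y) i\<^esub> Couple \<zero>\<^bsub>Term X i\<^esub> y) =
      h i (Couple x \<zero>\<^bsub>Term Y i\<^esub>) \<oplus>\<^bsub>Term (cpx_sum X' Y') i\<^esub> h i (Couple \<zero>\<^bsub>Term X i\<^esub> y)"
      using x y by (intro mod_hom_add[OF chain_map_hom[OF h]]) auto
    then show ?thesis using x y fc gc by (simp add: 1 2)
  qed
  have diff: "Couple a b \<ominus>\<^bsub>mod_prod (Term X' i) (Term Y' i)\<^esub> Couple c d =
      Couple (a \<ominus>\<^bsub>Term X' i\<^esub> c) (b \<ominus>\<^bsub>Term Y' i\<^esub> d)"
    if "c \<in> carrier (Term X' i)" "d \<in> carrier (Term Y' i)" for a b c d i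
    using that by (simp add: a_minus_def mod_prod_minus[OF X'.left_module_axioms Y'.left_module_axioms])
  show ?thesis
  proof (rule quasi_isoI[OF h])
    fix i z assume z: "z \<in> cycles (cpx_sum X Y) i" and hz: "h i z \<in> boundaries (cpx_sum X' Y') i"
    obtain x y where "z = Couple x y" using z by (auto simp: cycles_def)
    then show "z \<in> boundaries (cpx_sum X Y) i"
      using z hz quasi_isoD1[OF f] quasi_isoD1[OF g]
      by (auto simp: cpx_sum_cycles cpx_sum_boundaries h_eq cycles_def)
  next
    fix i z assume z: "z \<in> cycles (cpx_sum X' Y') i"
    then obtain x y where xy: "z = Couple x y" "x \<in> cycles X' i" "y \<in> cycles Y' i"
      by (auto simp: cycles_def)
    obtain u v where u: "u \<in> cycles X i" "f i u \<ominus>\<^bsub>Term X' i\<^esub> x \<in> boundaries X' i"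
      and v: "v \<in> cycles Y i" "g i v \<ominus>\<^bsub>Term Y' i\<^esub> y \<in> boundaries Y' i"
      using quasi_isoD2[OF f xy(2)] quasi_isoD2[OF g xy(3)] by blast
    have "h i (Couple u v) \<ominus>\<^bsub>Term (cpx_sum X' Y') i\<^esub> z = Couple (f i u \<ominus>\<^bsub>Term X' i\<^esub> x) (g i v \<ominus>\<^bsub>Term Y' i\<^esub> y)"
      using u v xy by (simp add: h_eq cycles_def diff)
    then show "\<exists>z'\<in>cycles (cpx_sum X Y) i. h i z' \<ominus>\<^bsub>Term (cpx_sum X' Y') i\<^esub> z \<in> boundaries (cpx_sum X' Y') i"
      using u v by (intro bexI[of _ "Couple u v"]) (auto simp: cpx_sum_cycles cpx_sum_boundaries)
  qed
qed

lemma cat_loc_Ch: "cat_loc (Ch A) (quasi_isos A)"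
proof -
  interpret cat "Ch A" by (rule cat_Ch)
  show ?thesis by unfold_locales (simp_all add: Ident_quasi_iso, auto simp: quasi_isos_def)
qed

lemma cat_cop_Ch: "cat_cop (Ch A) (quasi_isos A) cpx_sum cpx_sum_inl cpx_sum_inr"
proof -
  interpret cat_loc "Ch A" "quasi_isos A" by (rule cat_loc_Ch)
  show ?thesis
  proof
    fix X Y assume "X \<in> Obj (Ch A)" "Y \<in> Obj (Ch A)"
    then show "cpx_sum X Y \<in> Obj (Ch A)" "cpx_sum_inl X Y \<in> Hom (Ch A) X (cpx_sum X Y)"
      "cpx_sum_inr X Y \<in> Hom (Ch A) Y (cpx_sum X Y)"
      using cpx_sum_inl_chain_map[of X A Y] cpx_sum_inr_chain_map[of X A Y]
      by (auto simp: cpx_sum_bounded Ch_Hom cpx_sum_inl_def cpx_sum_inr_def)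
  next
    fix f g h X X' Y Y' assume "f \<in> quasi_isos A" "g \<in> quasi_isos A" "f \<in> Hom (Ch A) X X'"
      "g \<in> Hom (Ch A) Y Y'" "h \<in> Hom (Ch A) (cpx_sum X Y) (cpx_sum X' Y')"
      "Comp (Ch A) h (cpx_sum_inl X Y) = Comp (Ch A) (cpx_sum_inl X' Y') f"
      "Comp (Ch A) h (cpx_sum_inr X Y) = Comp (Ch A) (cpx_sum_inr X' Y') g"
    then show "h \<in> quasi_isos A" using cpx_sum_quasi_iso unfolding Ch_Hom by blast
  qed (rule cpx_sum_universal)
qed

section \<open>Shift, cones and triangles\<close>

lemma cpx_shift_simps [simp]:
  "Term (cpx_shift X) i = Term X (i + 1)"
  "Dif (cpx_shift X) i = (\<lambda>x\<in>carrier (Term X (i + 1)). \<ominus>\<^bsub>Term X (i + 2)\<^esub> Dif X (i + 1) x)"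
  by (simp_all add: cpx_shift_def)

lemma bc_Dif2: "X \<in> bounded_complexes A \<Longrightarrow> Dif X (i + 1) \<in> mod_hom A (Term X (i + 1)) (Term X (i + 2))"
  using bc_Dif[of X A "i + 1"] by (simp add: add.assoc)

lemma minus_zero_iff:
  assumes "left_module A M" "x \<in> carrier M"
  shows "\<ominus>\<^bsub>M\<^esub> x = \<zero>\<^bsub>M\<^esub> \<longleftrightarrow> x = \<zero>\<^bsub>M\<^esub>"
proof -
  interpret left_module A M by fact
  show ?thesis using assms(2) M.a_inv_zero M.minus_minus by metis
qed

lemma shift_bounded:
  assumes X: "X \<in> bounded_complexes A"
  shows "cpx_shift X \<in> bounded_complexes A"
proof (rule bounded_complexesI)
  note d = mod_hom_closed[OF bc_Dif2[OF X]] and lm = bc_module[OF X]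
  interpret X: left_module A "Term X n" for n by (rule lm)
  show "finite ((\<lambda>i. i - 1) ` {i. carrier (Term X i) \<noteq> {\<zero>\<^bsub>Term X i\<^esub>}})" using bc_finite[OF X] by simp
  fix i
  show "Term (cpx_shift X) i \<in> fg_modules A" using bc_fg[OF X] by simp
  show "Dif (cpx_shift X) i \<in> mod_hom A (Term (cpx_shift X) i) (Term (cpx_shift X) (i + 1))"
    using minus_mod_hom[OF bc_Dif2[OF X] lm lm] by (simp add: add.assoc)
  show "carrier (Term (cpx_shift X) i) = {\<zero>\<^bsub>Term (cpx_shift X) i\<^esub>}"
    if "i \<notin> (\<lambda>i. i - 1) ` {i. carrier (Term X i) \<noteq> {\<zero>\<^bsub>Term X i\<^esub>}}"
    using that by (force simp: image_iff)
  fix x assume x: "x \<in> carrier (Term (cpx_shift X) i)"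
  have d2: "Dif X (i + 2) (Dif X (i + 1) x) = \<zero>\<^bsub>Term X (i + 3)\<^esub>"
    using bc_Dif_Dif[OF X, of x "i + 1"] x by (simp add: add.assoc)
  have h: "Dif X (i + 2) \<in> mod_hom A (Term X (i + 2)) (Term X (i + 3))"
    using bc_Dif[OF X, of "i + 2"] by (simp add: add.assoc)
  show "Dif (cpx_shift X) (i + 1) (Dif (cpx_shift X) i x) = \<zero>\<^bsub>Term (cpx_shift X) (i + 2)\<^esub>"
    using x d[of x i] by (simp add: add.assoc mod_hom_minus[OF h lm lm] d2 X.M.a_inv_zero)
qed

lemma shift_chain_map:
  assumes f: "(X, f, Y) \<in> chain_maps A"
  shows "(cpx_shift X, \<lambda>i. f (i + 1), cpx_shift Y) \<in> chain_maps A"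
proof (rule chain_mapsI)
  note X = chain_map_dom[OF f] and Y = chain_map_cod[OF f]
  show "cpx_shift X \<in> bounded_complexes A" "cpx_shift Y \<in> bounded_complexes A"
    using shift_bounded X Y by auto
  fix i
  show "f (i + 1) \<in> mod_hom A (Term (cpx_shift X) i) (Term (cpx_shift Y) i)"
    using chain_map_hom[OF f] by simp
  fix x assume x: "x \<in> carrier (Term (cpx_shift X) i)"
  then show "f (i + 1 + 1) (Dif (cpx_shift X) i x) = Dif (cpx_shift Y) i (f (i + 1) x)"
    using chain_map_Dif[OF f, of x "i + 1"] mod_hom_closed[OF bc_Dif2[OF X], of x i]
      mod_hom_closed[OF chain_map_hom[OF f], of x "i + 1"]
    by (simp add: add.assoc mod_hom_minus[OF chain_map_hom[OF f] bc_module[OF X] bc_module[OF Y]])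
qed

lemma shift_cycles:
  assumes X: "X \<in> bounded_complexes A"
  shows "cycles (cpx_shift X) i = cycles X (i + 1)"
  using minus_zero_iff[OF bc_module[OF X] mod_hom_closed[OF bc_Dif2[OF X]]]
  by (auto simp: cycles_def add.assoc)

lemma shift_boundaries:
  assumes X: "X \<in> bounded_complexes A"
  shows "boundaries (cpx_shift X) i = boundaries X (i + 1)"
proof -
  interpret X: left_module A "Term X n" for n by (rule bc_module[OF X])
  note d = bc_Dif[OF X, of i]
  have "boundaries (cpx_shift X) i = (\<lambda>x. \<ominus>\<^bsub>Term X (i + 1)\<^esub> Dif X i x) ` carrier (Term X i)"
  proof -
    have "i - 1 + 2 = i + 1" "i - 1 + 1 = i" by simp_all
    then show ?thesis unfolding boundaries_def cpx_shift_simps by (simp only: image_restrict_eq)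
  qed
  also have "\<dots> = Dif X i ` carrier (Term X i)"
  proof -
    have m: "\<ominus>\<^bsub>Term X (i + 1)\<^esub> Dif X i x = Dif X i (\<ominus>\<^bsub>Term X i\<^esub> x)" if "x \<in> carrier (Term X i)" for x
      using mod_hom_minus[OF d X.left_module_axioms X.left_module_axioms that] by simp
    have "(\<lambda>x. \<ominus>\<^bsub>Term X i\<^esub> x) ` carrier (Term X i) = carrier (Term X i)"
      by (force intro: image_eqI[of _ _ "\<ominus>\<^bsub>Term X i\<^esub> _"])
    then have "Dif X i ` carrier (Term X i) = (\<lambda>x. Dif X i (\<ominus>\<^bsub>Term X i\<^esub> x)) ` carrier (Term X i)"
      by (metis image_image)
    then show ?thesis using m by simp
  qed
  finally show ?thesis by (simp add: boundaries_def)
qed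

lemma shift_quasi_iso:
  assumes "(X, f, Y) \<in> quasi_isos A"
  shows "(cpx_shift X, \<lambda>i. f (i + 1), cpx_shift Y) \<in> quasi_isos A"
proof -
  have f: "(X, f, Y) \<in> chain_maps A" using assms by (simp add: quasi_isos_def)
  note X = chain_map_dom[OF f] and Y = chain_map_cod[OF f]
  show ?thesis
    using quasi_isoD1[OF assms] quasi_isoD2[OF assms]
    by (intro quasi_isoI shift_chain_map[OF f])
      (simp_all add: shift_cycles[OF X] shift_cycles[OF Y] shift_boundaries[OF X] shift_boundaries[OF Y])
qed

context
  fixes A :: "('a, 'r) ring_scheme"
begin

interpretation cat_cop "Ch A" "quasi_isos A" cpx_sum cpx_sum_inl cpx_sum_inr by (rule cat_cop_Ch)

lemma endo_shift: "endo cpx_shift cpx_shift_arr"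
  unfolding endo_def
proof (intro conjI allI impI ballI)
  show "cpx_shift_arr ` quasi_isos A \<subseteq> quasi_isos A"
    using shift_quasi_iso by (auto simp: cpx_shift_arr_def)
qed (auto simp: cpx_shift_arr_def Ch_Hom shift_bounded shift_chain_map)

text \<open>A distinguished triangle is compared with the triangle of a cone through the shift of an
  isomorphism; for the triangle of the cone itself that isomorphism is an identity.\<close>

lemma Db_shift_Ident:
  assumes "X \<in> bounded_complexes A"
  shows "Db_shift_arr A (cls X [] X) =
    cls (cpx_shift X) [] (cpx_shift X)"
proof -
  have "{r. \<exists>p. eqv X X [] p \<and> eqv (cpx_shift X) (cpx_shift X) (map (map_step cpx_shift_arr) p) r} =
      {r. eqv (cpx_shift X) (cpx_shift X) [] r}"
  proof -
    have "eqv (cpx_shift X) (cpx_shift X) [] r"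
      if "eqv X X [] p" "eqv (cpx_shift X) (cpx_shift X) (map (map_step cpx_shift_arr) p) r" for p r
      using endo_eqv[OF endo_shift that(1)] that(2) by (auto intro: zz_equiv.trans)
    moreover have "eqv X X [] []" using assms by (intro zz_equiv.refl) simp
    ultimately show ?thesis by (fastforce intro: exI[of _ "[]"])
  qed
  then show ?thesis by (simp add: Db_shift_arr_def loc_map_def zz_class_def)
qed

lemma Db_simps [simp]:
  "Obj (Db A) = bounded_complexes A" "Shift (Db A) = cpx_shift" "Tri (Db A) = Db_triangles A"
  "Dom (Db A) = Dom (Db_cat A)" "Cod (Db A) = Cod (Db_cat A)"
  "is_zero (Db A) = is_zero (Db_cat A)" "is_direct_sum (Db A) = is_direct_sum (Db_cat A)"
proof -
  have e: "Obj (Db A) = Obj (Db_cat A)" "Arr (Db A) = Arr (Db_cat A)" "Dom (Db A) = Dom (Db_cat A)"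
    "Cod (Db A) = Cod (Db_cat A)" "Comp (Db A) = Comp (Db_cat A)"
    by (simp_all add: Db_def category.defs)
  show "Obj (Db A) = bounded_complexes A" "Shift (Db A) = cpx_shift" "Tri (Db A) = Db_triangles A"
    "Dom (Db A) = Dom (Db_cat A)" "Cod (Db A) = Cod (Db_cat A)"
    by (simp_all add: e Db_cat_def) (simp_all add: Db_def category.defs)
  have h: "Hom (Db A) = Hom (Db_cat A)" by (simp add: fun_eq_iff Hom_def e)
  show "is_zero (Db A) = is_zero (Db_cat A)" "is_direct_sum (Db A) = is_direct_sum (Db_cat A)"
    by (simp_all add: fun_eq_iff is_zero_def is_direct_sum_def h e)
qed

lemma Db_is_direct_sum: "is_direct_sum (Ch A) S X Y \<Longrightarrow> is_direct_sum (Db A) S X Y"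
  using loc_is_direct_sum by (simp add: Db_cat_def)

lemma Db_is_zero: "is_zero (Ch A) Z \<Longrightarrow> is_zero (Db A) Z"
  using loc_is_zero by (simp add: Db_cat_def)

lemma Db_is_direct_sum_quasi_iso:
  "(X, s, Y) \<in> quasi_isos A \<Longrightarrow> is_zero (Ch A) Z \<Longrightarrow> is_direct_sum (Db A) X Y Z"
  using loc_is_direct_sum_W[of "(X, s, Y)" X Y Z] by (auto simp: Db_cat_def Ch_Hom quasi_isos_def)

lemma cone_simps [simp]:
  "Term (cone (X, f, Y)) i = mod_prod (Term X (i + 1)) (Term Y i)"
  "x \<in> carrier (Term X (i + 1)) \<Longrightarrow> y \<in> carrier (Term Y i) \<Longrightarrow> Dif (cone (X, f, Y)) i (Couple x y) =
    Couple (\<ominus>\<^bsub>Term X (i + 2)\<^esub> Dif X (i + 1) x) (f (i + 1) x \<oplus>\<^bsub>Term Y (i + 1)\<^esub> Dif Y i y)"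
  by (simp_all add: cone_def)

lemma cone_bounded:
  assumes f: "(X, f, Y) \<in> chain_maps A"
  shows "cone (X, f, Y) \<in> bounded_complexes A"
proof (rule bounded_complexesI)
  let ?C = "cone (X, f, Y)"
  note X = chain_map_dom[OF f] and Y = chain_map_cod[OF f] and fh = chain_map_hom[OF f]
  note lX = bc_module[OF X] and lY = bc_module[OF Y]
  interpret X: left_module A "Term X n" for n by (rule lX)
  interpret Y: left_module A "Term Y n" for n by (rule lY)
  note dX = bc_Dif2[OF X] and dY = bc_Dif[OF Y]
  note c = mod_hom_closed[OF dX] mod_hom_closed[OF dY] mod_hom_closed[OF fh]
  let ?J = "(\<lambda>i. i - 1) ` {i. carrier (Term X i) \<noteq> {\<zero>\<^bsub>Term X i\<^esub>}} \<union> {i. carrier (Term Y i) \<noteq> {\<zero>\<^bsub>Term Y i\<^esub>}}"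
  show "finite ?J" using bc_finite[OF X] bc_finite[OF Y] by simp
  fix i
  show "Term (?C) i \<in> fg_modules A" using bc_fg[OF X] bc_fg[OF Y] by (simp add: mod_prod_fg)
  show "carrier (Term (?C) i) = {\<zero>\<^bsub>Term (?C) i\<^esub>}" if "i \<notin> ?J"
  proof -
    have "carrier (Term X (i + 1)) = {\<zero>\<^bsub>Term X (i + 1)\<^esub>}" "carrier (Term Y i) = {\<zero>\<^bsub>Term Y i\<^esub>}"
      using that by (force simp: image_iff)+
    then show ?thesis by (simp only: cone_simps mod_prod_trivial)
  qed
  show "Dif (?C) i \<in> mod_hom A (Term (?C) i) (Term (?C) (i + 1))"
  proof (rule mod_homI)
    fix p assume "p \<in> carrier (Term (?C) i)"
    then obtain x y where p: "p = Couple x y" "x \<in> carrier (Term X (i + 1))" "y \<in> carrier (Term Y i)" by auto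
    note cp = c(1)[OF p(2)] c(2)[OF p(3)] c(3)[OF p(2)]
    show "Dif (?C) i p \<in> carrier (Term (?C) (i + 1))"
      using p cp by (simp add: add.assoc)
    {
      fix a assume "a \<in> carrier A"
      then show "Dif (?C) i (a \<odot>\<^bsub>Term (?C) i\<^esub> p) =
          a \<odot>\<^bsub>Term (?C) (i + 1)\<^esub> Dif (?C) i p"
        using p cp by (simp add: add.assoc X.smult_closed Y.smult_closed mod_hom_smult[OF dX] mod_hom_smult[OF dY]
          mod_hom_smult[OF fh] X.smult_minus_r Y.smult_r_distr)
    next
      fix q assume "q \<in> carrier (Term (?C) i)"
      then obtain u v where q: "q = Couple u v" "u \<in> carrier (Term X (i + 1))" "v \<in> carrier (Term Y i)" by auto
      note cq = c(1)[OF q(2)] c(2)[OF q(3)] c(3)[OF q(2)]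
      show "Dif (?C) i (p \<oplus>\<^bsub>Term (?C) i\<^esub> q) =
          Dif (?C) i p \<oplus>\<^bsub>Term (?C) (i + 1)\<^esub> Dif (?C) i q"
        using p q cp cq by (simp add: add.assoc mod_hom_add[OF dX] mod_hom_add[OF dY]
          mod_hom_add[OF fh] X.M.minus_add Y.M.a_assoc Y.M.a_lcomm)
    }
  next
    fix p assume "p \<notin> carrier (Term (?C) i)"
    then show "Dif (?C) i p = undefined" by (auto simp: cone_def)
  qed
  fix p assume "p \<in> carrier (Term (?C) i)"
  then obtain x y where p: "p = Couple x y" "x \<in> carrier (Term X (i + 1))" "y \<in> carrier (Term Y i)" by auto
  note cp = c(1)[OF p(2)] c(2)[OF p(3)] c(3)[OF p(2)]
  have 1: "Dif X (i + 2) (\<ominus>\<^bsub>Term X (i + 2)\<^esub> Dif X (i + 1) x) = \<zero>\<^bsub>Term X (i + 3)\<^esub>"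
  proof -
    have h: "Dif X (i + 2) \<in> mod_hom A (Term X (i + 2)) (Term X (i + 3))"
      using bc_Dif[OF X, of "i + 2"] by (simp add: add.assoc)
    show ?thesis using bc_Dif_Dif[OF X p(2)] cp
      by (simp add: mod_hom_minus[OF h lX lX] add.assoc X.M.a_inv_zero)
  qed
  have 2: "f (i + 2) (\<ominus>\<^bsub>Term X (i + 2)\<^esub> Dif X (i + 1) x) = \<ominus>\<^bsub>Term Y (i + 2)\<^esub> Dif Y (i + 1) (f (i + 1) x)"
    using chain_map_Dif[OF f p(2)] cp by (simp add: mod_hom_minus[OF fh lX lY] add.assoc)
  have h: "Dif Y (i + 1) \<in> mod_hom A (Term Y (i + 1)) (Term Y (i + 2))" by (rule bc_Dif2[OF Y])
  have 3: "Dif Y (i + 1) (f (i + 1) x \<oplus>\<^bsub>Term Y (i + 1)\<^esub> Dif Y i y) = Dif Y (i + 1) (f (i + 1) x)"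
    using cp p mod_hom_closed[OF h] by (simp add: mod_hom_add[OF h] bc_Dif_Dif[OF Y])
  show "Dif (?C) (i + 1) (Dif (?C) i p) = \<zero>\<^bsub>Term (?C) (i + 2)\<^esub>"
    using p cp mod_hom_closed[OF h] by (simp add: add.assoc 1 2 3 X.M.a_inv_zero Y.M.l_neg)
qed

lemma cone_in_chain_map:
  assumes f: "(X, f, Y) \<in> chain_maps A"
  shows "cone_in (X, f, Y) \<in> chain_maps A"
proof -
  note X = chain_map_dom[OF f] and Y = chain_map_cod[OF f] and fh = chain_map_hom[OF f]
  note lX = bc_module[OF X] and lY = bc_module[OF Y]
  interpret X: left_module A "Term X n" for n by (rule lX)
  interpret Y: left_module A "Term Y n" for n by (rule lY)
  show ?thesis unfolding cone_in_def prod.case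
    using mod_hom_closed[OF bc_Dif[OF Y]]
    by (intro chain_mapsI mod_homI Y cone_bounded[OF f])
      (auto simp: X.smult_zero_r Y.smult_closed add.assoc mod_hom_zero[OF fh lX lY]
        mod_hom_zero[OF bc_Dif2[OF X] lX lX] X.M.a_inv_zero)
qed

lemma cone_out_chain_map:
  assumes f: "(X, f, Y) \<in> chain_maps A"
  shows "cone_out (X, f, Y) \<in> chain_maps A"
proof -
  let ?C = "cone (X, f, Y)"
  note X = chain_map_dom[OF f] and Y = chain_map_cod[OF f] and fh = chain_map_hom[OF f]
  note lX = bc_module[OF X] and lY = bc_module[OF Y]
  interpret X: left_module A "Term X n" for n by (rule lX)
  interpret Y: left_module A "Term Y n" for n by (rule lY)
  note c = mod_hom_closed[OF bc_Dif[OF Y]] mod_hom_closed[OF bc_Dif2[OF X]] mod_hom_closed[OF fh]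
  show ?thesis unfolding cone_out_def prod.case
  proof (rule chain_mapsI[OF cone_bounded[OF f] shift_bounded[OF X]])
    fix i
    show "(\<lambda>p\<in>carrier (Term (?C) i). cfst p) \<in> mod_hom A (Term (?C) i) (Term (cpx_shift X) i)"
      by (rule mod_homI) (auto simp: X.smult_closed Y.smult_closed)
    fix p assume "p \<in> carrier (Term (?C) i)"
    then obtain x y where p: "p = Couple x y" "x \<in> carrier (Term X (i + 1))" "y \<in> carrier (Term Y i)" by auto
    then show "(\<lambda>p\<in>carrier (Term (?C) (i + 1)). cfst p) (Dif (?C) i p) =
        Dif (cpx_shift X) i ((\<lambda>p\<in>carrier (Term (?C) i). cfst p) p)"
      using c(1)[OF p(3)] c(2)[OF p(2)] c(3)[OF p(2)] by (simp add: add.assoc)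
  qed
qed

lemma cone_triangle:
  assumes f: "(X, f, Y) \<in> chain_maps A"
  shows "(loc_fun (Ch A) (quasi_isos A) (X, f, Y), loc_fun (Ch A) (quasi_isos A) (cone_in (X, f, Y)),
    loc_fun (Ch A) (quasi_isos A) (cone_out (X, f, Y))) \<in> Db_triangles A"
proof -
  let ?Q = "loc_fun (Ch A) (quasi_isos A)" and ?D = "loc (Ch A) (quasi_isos A)" and ?c = "cone (X, f, Y)"
  let ?I = "\<lambda>X. cls X [] X"
  have o: "X \<in> Obj (Ch A)" "Y \<in> Obj (Ch A)" "?c \<in> Obj (Ch A)" "cpx_shift X \<in> Obj (Ch A)"
    using chain_map_dom[OF f] chain_map_cod[OF f] cone_bounded[OF f] shift_bounded by auto
  have dc: "(X, f, Y) \<in> Hom (Ch A) X Y" "cone_in (X, f, Y) \<in> Hom (Ch A) Y ?c" "cone_out (X, f, Y) \<in> Hom (Ch A) ?c (cpx_shift X)"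
    using f cone_in_chain_map[OF f] cone_out_chain_map[OF f]
    by (auto simp: Ch_Hom cone_in_def cone_out_def)
  have Q: "?Q g = cls U [Fwd g] V" if "g \<in> Hom (Ch A) U V" for g U V
    using that by (auto simp: loc_fun_def Hom_def)
  have h: "?Q g \<in> Arr ?D" "Dom ?D (?Q g) = U" "Cod ?D (?Q g) = V"
    "Comp ?D (?I V) (?Q g) = ?Q g" "Comp ?D (?Q g) (?I U) = ?Q g" if "g \<in> Hom (Ch A) U V" for g U V
  proof -
    show "?Q g \<in> Arr ?D" using loc_Hom[of "?Q g" U V] zz_Fwd[OF that] Q[OF that] by (auto simp: Hom_def)
    show "Dom ?D (?Q g) = U" "Cod ?D (?Q g) = V" by (simp_all add: Q[OF that])
    show "Comp ?D (?I V) (?Q g) = ?Q g" "Comp ?D (?Q g) (?I U) = ?Q g"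
      using zz_Fwd[OF that] Hom_Obj[OF that] by (simp_all add: Q[OF that] loc_Comp)
  qed
  have i: "?I U \<in> Hom ?D U U" if "U \<in> Obj (Ch A)" for U
    unfolding loc_Hom using that by (intro exI[of _ "[]"]) simp
  note ii = loc_is_iso_Ident[OF o(1)] loc_is_iso_Ident[OF o(2)] loc_is_iso_Ident[OF o(3)]
    i[OF o(1)] i[OF o(2)] i[OF o(3)]
  have s: "Db_shift_arr A (?I X) = ?I (cpx_shift X)" using o by (intro Db_shift_Ident) simp
  show ?thesis
    unfolding Db_triangles_def Let_def Db_cat_def mem_Collect_eq prod.case
    by (intro conjI bexI[OF _ f] exI[of _ "?I X"] exI[of _ "?I Y"] exI[of _ "?I ?c"])
       (use ii in \<open>simp_all add: h[OF dc(1)] h[OF dc(2)] h[OF dc(3)] s\<close>)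
qed

lemma star_coneI:
  assumes f: "(X, f, Y) \<in> chain_maps A" and "X \<in> I" "cone (X, f, Y) \<in> J"
  shows "Y \<in> star (Db A) I J"
  unfolding star_def
  using cone_triangle[OF f] assms chain_map_cod[OF f]
  by (auto simp: loc_fun_def Db_cat_def cone_in_def intro!: bexI[OF _ cone_triangle[OF f]])

end

section \<open>Complexes with zero differential\<close>

definition zero_mod :: "('a, 'a elt) module" where
  "zero_mod = \<lparr>carrier = {Gen undefined}, monoid.mult = undefined, one = undefined,
     zero = Gen undefined, add = (\<lambda>x y. Gen undefined), smult = (\<lambda>a x. Gen undefined)\<rparr>"

lemma zero_mod_carrier: "carrier zero_mod = {\<zero>\<^bsub>zero_mod\<^esub>}"
  by (simp add: zero_mod_def)

lemma zero_mod_fg: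
  assumes "ring A"
  shows "zero_mod \<in> fg_modules A"
proof -
  have "abelian_group zero_mod" by (rule abelian_groupI) (auto simp: zero_mod_def)
  then have lm: "left_module A zero_mod"
    by (intro left_module.intro assms left_module_axioms.intro) (auto simp: zero_mod_def)
  interpret left_module A zero_mod by fact
  have "fin_gen A zero_mod" unfolding fin_gen_def
    using submodule_subset submodule_zero
    by (intro exI[of _ "{}"]) (auto simp: zero_mod_carrier)
  with lm show ?thesis by (simp add: fg_modules_def)
qed

definition mod_sum :: "('a, 'r) ring_scheme \<Rightarrow> ('a, 'a elt) module \<Rightarrow> ('a, 'a elt) module \<Rightarrow> ('a, 'a elt) module \<Rightarrow>
    ('a elt \<Rightarrow> 'a elt) \<Rightarrow> ('a elt \<Rightarrow> 'a elt) \<Rightarrow> bool" where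
  "mod_sum A S X Y i j \<longleftrightarrow> i \<in> mod_hom A X S \<and> j \<in> mod_hom A Y S \<and>
    (\<forall>s\<in>carrier S. \<exists>x\<in>carrier X. \<exists>y\<in>carrier Y. s = i x \<oplus>\<^bsub>S\<^esub> j y) \<and>
    (\<forall>x\<in>carrier X. \<forall>y\<in>carrier Y. i x \<oplus>\<^bsub>S\<^esub> j y = \<zero>\<^bsub>S\<^esub> \<longrightarrow> x = \<zero>\<^bsub>X\<^esub> \<and> y = \<zero>\<^bsub>Y\<^esub>)"

lemma mod_sum_commute:
  assumes "left_module A S" "mod_sum A S X Y i j"
  shows "mod_sum A S Y X j i"
proof -
  interpret left_module A S by fact
  have i: "i \<in> mod_hom A X S" and j: "j \<in> mod_hom A Y S" using assms(2) by (auto simp: mod_sum_def)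
  have c: "i x \<oplus>\<^bsub>S\<^esub> j y = j y \<oplus>\<^bsub>S\<^esub> i x" if "x \<in> carrier X" "y \<in> carrier Y" for x y
    using M.a_comm[OF mod_hom_closed[OF i that(1)] mod_hom_closed[OF j that(2)]] .
  show ?thesis using assms(2) c unfolding mod_sum_def by metis
qed

lemma mod_sum_iso:
  assumes M: "left_module A M" and N: "left_module A N" and Z: "left_module A Z"
    and f: "f \<in> mod_hom A M N" "bij_betw f (carrier M) (carrier N)" and z: "carrier Z = {\<zero>\<^bsub>Z\<^esub>}"
  shows "mod_sum A N M Z f (\<lambda>x\<in>carrier Z. \<zero>\<^bsub>N\<^esub>)"
proof -
  interpret M: left_module A M by fact
  interpret N: left_module A N by fact
  have "\<exists>x\<in>carrier M. s = f x \<oplus>\<^bsub>N\<^esub> \<zero>\<^bsub>N\<^esub>" if s: "s \<in> carrier N" for s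
  proof -
    have "s \<in> f ` carrier M" using f(2) s by (simp add: bij_betw_def)
    then obtain x where "x \<in> carrier M" "s = f x" by blast
    then show ?thesis using s by (intro bexI[of _ x]) simp_all
  qed
  moreover have "x = \<zero>\<^bsub>M\<^esub>" if x: "x \<in> carrier M" "f x \<oplus>\<^bsub>N\<^esub> \<zero>\<^bsub>N\<^esub> = \<zero>\<^bsub>N\<^esub>" for x
  proof -
    have "f x = f \<zero>\<^bsub>M\<^esub>" using x mod_hom_closed[OF f(1) x(1)] mod_hom_zero[OF f(1) M N] by simp
    then show ?thesis using f(2) x(1) by (auto simp: bij_betw_def dest: inj_onD)
  qed
  ultimately show ?thesis
    unfolding mod_sum_def using f(1) zero_mod_hom[OF Z N] by (simp add: z)
qed

lemma mod_sum_zero: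
  assumes "left_module A M" "left_module A Z" "carrier Z = {\<zero>\<^bsub>Z\<^esub>}"
  shows "mod_sum A M M Z (\<lambda>x\<in>carrier M. x) (\<lambda>x\<in>carrier Z. \<zero>\<^bsub>M\<^esub>)"
  using assms by (intro mod_sum_iso ident_mod_hom) (auto simp: bij_betw_def inj_on_def)

lemma mod_sum_internal:
  assumes M: "left_module A M" and L: "submodule L A M" "submodule L' A M"
    and "L <+>\<^bsub>M\<^esub> L' = carrier M" "L \<inter> L' = {\<zero>\<^bsub>M\<^esub>}"
  shows "mod_sum A M (M\<lparr>carrier := L\<rparr>) (M\<lparr>carrier := L'\<rparr>) (\<lambda>x\<in>L. x) (\<lambda>x\<in>L'. x)"
proof -
  interpret left_module A M by fact
  note s = submodule_subset[OF L(1)] submodule_subset[OF L(2)]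
  have incl: "(\<lambda>x\<in>H. x) \<in> mod_hom A (M\<lparr>carrier := H\<rparr>) M" if "submodule H A M" for H
    using submodule_subset[OF that] submodule_add[OF that] submodule_smult[OF that]
    by (intro mod_homI) auto
  have "\<exists>x\<in>L. \<exists>y\<in>L'. s = x \<oplus>\<^bsub>M\<^esub> y" if "s \<in> carrier M" for s
  proof -
    have "s \<in> L <+>\<^bsub>M\<^esub> L'" using that assms(4) by simp
    then show ?thesis by (auto simp: set_add_def set_mult_def)
  qed
  moreover have "x = \<zero>\<^bsub>M\<^esub> \<and> y = \<zero>\<^bsub>M\<^esub>" if xy: "x \<in> L" "y \<in> L'" "x \<oplus>\<^bsub>M\<^esub> y = \<zero>\<^bsub>M\<^esub>" for x y
  proof -
    have c: "x \<in> carrier M" "y \<in> carrier M" using xy s by auto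
    have "x = \<ominus>\<^bsub>M\<^esub> y" using M.minus_equality[OF xy(3)] c by simp
    then have "x \<in> L \<inter> L'" using xy submodule_minus[OF L(2)] by simp
    then have "x = \<zero>\<^bsub>M\<^esub>" using assms(5) by simp
    then show ?thesis using xy c by simp
  qed
  ultimately show ?thesis unfolding mod_sum_def using incl[OF L(1)] incl[OF L(2)] by simp
qed

lemma mod_sum_prod:
  assumes "left_module A M" "left_module A N"
  shows "mod_sum A (mod_prod M N) M N (\<lambda>x\<in>carrier M. Couple x \<zero>\<^bsub>N\<^esub>) (\<lambda>y\<in>carrier N. Couple \<zero>\<^bsub>M\<^esub> y)"
proof -
  interpret M: left_module A M by fact
  interpret N: left_module A N by fact
  have "(\<lambda>x\<in>carrier M. Couple x \<zero>\<^bsub>N\<^esub>) \<in> mod_hom A M (mod_prod M N)"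
    "(\<lambda>y\<in>carrier N. Couple \<zero>\<^bsub>M\<^esub> y) \<in> mod_hom A N (mod_prod M N)"
    by (auto intro!: mod_homI simp: M.smult_closed N.smult_closed M.smult_zero_r N.smult_zero_r)
  then show ?thesis unfolding mod_sum_def by auto
qed

text \<open>A graded module, viewed as a complex with zero differential.\<close>

definition gr :: "(int \<Rightarrow> ('a, 'a elt) module) \<Rightarrow> ('a, 'a elt) cpx" where
  "gr F = \<lparr>Term = F, Dif = (\<lambda>i. \<lambda>x\<in>carrier (F i). \<zero>\<^bsub>F (i + 1)\<^esub>)\<rparr>"

lemma gr_simps [simp]:
  "Term (gr F) = F" "Dif (gr F) i = (\<lambda>x\<in>carrier (F i). \<zero>\<^bsub>F (i + 1)\<^esub>)"
  by (simp_all add: gr_def)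

lemma gr_bounded:
  assumes F: "\<And>i. F i \<in> fg_modules A" and "finite J" "\<And>i. i \<notin> J \<Longrightarrow> carrier (F i) = {\<zero>\<^bsub>F i\<^esub>}"
  shows "gr F \<in> bounded_complexes A"
proof (rule bounded_complexesI[OF _ _ _ assms(2)])
  have lm: "left_module A (F i)" for i using F by (simp add: fg_modules_def)
  interpret F: left_module A "F i" for i by (rule lm)
  show "Dif (gr F) i \<in> mod_hom A (Term (gr F) i) (Term (gr F) (i + 1))" for i
    using zero_mod_hom[OF lm lm] by simp
  show "Dif (gr F) (i + 1) (Dif (gr F) i x) = \<zero>\<^bsub>Term (gr F) (i + 2)\<^esub>" if "x \<in> carrier (Term (gr F) i)" for i x
    using that by (simp add: add.assoc)
qed (use assms in simp_all)

lemma gr_chain_map: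
  assumes F: "gr F \<in> bounded_complexes A" and G: "gr G \<in> bounded_complexes A"
    and f: "\<And>i. f i \<in> mod_hom A (F i) (G i)"
  shows "(gr F, f, gr G) \<in> chain_maps A"
proof (rule chain_mapsI[OF F G])
  fix i x assume "x \<in> carrier (Term (gr F) i)"
  then show "f (i + 1) (Dif (gr F) i x) = Dif (gr G) i (f i x)"
    using mod_hom_closed[OF f] mod_hom_zero[OF f] bc_module[OF F] bc_module[OF G] by simp
qed (use f in simp)

lemma gr_direct_sum:
  assumes H: "gr H \<in> bounded_complexes A" and F: "gr F \<in> bounded_complexes A" and G: "gr G \<in> bounded_complexes A"
    and sum: "\<And>n. \<exists>i j. mod_sum A (H n) (F n) (G n) i j"
  shows "is_direct_sum (Ch A) (gr H) (gr F) (gr G)"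
proof -
  obtain i j where ij: "\<And>n. mod_sum A (H n) (F n) (G n) (i n) (j n)" using sum by metis
  show ?thesis
    using ij by (intro Ch_is_direct_sum[of _ i _ _ _ j] gr_chain_map F G H) (auto simp: mod_sum_def)
qed

definition stalk :: "('a, 'a elt) module \<Rightarrow> int \<Rightarrow> ('a, 'a elt) cpx" where
  "stalk N n = gr ((\<lambda>_. zero_mod)(n := N))"

section \<open>Generating the derived category\<close>

lemma gen_Obj: "X \<in> gen (Db A) I \<Longrightarrow> X \<in> bounded_complexes A"
  by (induction rule: gen.induct) (auto simp: shift_bounded is_zero_def is_direct_sum_def Db_cat_def loc_def)

lemma gen_mono:
  assumes "I \<subseteq> gen (Db A) J"
  shows "X \<in> gen (Db A) I \<Longrightarrow> X \<in> gen (Db A) J"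
  by (induction rule: gen.induct) (use assms in \<open>auto simp del: Db_simps intro: gen.intros\<close>)

context
  fixes A :: "('a, 'r) ring_scheme"
  assumes ring: "ring A"
begin

lemma stalk_bounded: "N \<in> fg_modules A \<Longrightarrow> stalk N n \<in> bounded_complexes A"
  unfolding stalk_def using zero_mod_fg[OF ring] zero_mod_carrier
  by (intro gr_bounded[where J = "{n}"]) auto

text \<open>The differential is zero, so the sign in the shift disappears and this is an equality of
  complexes.\<close>

lemma stalk_shift:
  assumes "N \<in> fg_modules A"
  shows "cpx_shift (stalk N n) = stalk N (n - 1)"
proof -
  let ?F = "(\<lambda>_. zero_mod)(n := N)"
  have "?F i \<in> fg_modules A" for i using assms zero_mod_fg[OF ring] by simp
  then interpret F: left_module A "?F i" for i by (simp add: fg_modules_def)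
  have "(\<lambda>i. ?F (i + 1)) = (\<lambda>_. zero_mod)(n - 1 := N)" by auto
  moreover have "cpx_shift (gr ?F) = gr (\<lambda>i. ?F (i + 1))"
    using F.M.a_inv_zero[of n] F.M.a_inv_zero[of "n + 1"] by (simp add: cpx_shift_def gr_def add.assoc fun_eq_iff restrict_def)
  ultimately show ?thesis by (simp only: stalk_def)
qed

lemma stalk_gen:
  assumes N: "N \<in> fg_modules A" and "stalk N m \<in> gen (Db A) I"
  shows "stalk N n \<in> gen (Db A) I"
proof (induction n rule: int_induct[of _ m])
  case (step1 i)
  have "Shift (Db A) (stalk N (i + 1)) \<in> gen (Db A) I" using step1 stalk_shift[OF N, of "i + 1"] by simp
  then show ?case by (rule gen.unshift) (simp add: stalk_bounded[OF N])
next
  case (step2 i)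
  then show ?case using gen.shift[OF step2(2)] stalk_shift[OF N, of i] by simp
qed (rule assms(2))

lemma stalk_direct_sum:
  assumes "S \<in> fg_modules A" "X \<in> fg_modules A" "Y \<in> fg_modules A" "mod_sum A S X Y i j"
  shows "is_direct_sum (Db A) (stalk S n) (stalk X n) (stalk Y n)"
proof (rule Db_is_direct_sum)
  have Z: "left_module A zero_mod" using zero_mod_fg[OF ring] by (simp add: fg_modules_def)
  show "is_direct_sum (Ch A) (stalk S n) (stalk X n) (stalk Y n)"
    using stalk_bounded assms mod_sum_zero[OF Z Z zero_mod_carrier] unfolding stalk_def
    by (intro gr_direct_sum) auto
qed

lemma trivial_is_zero:
  assumes "X \<in> bounded_complexes A" "\<And>i. carrier (Term X i) = {\<zero>\<^bsub>Term X i\<^esub>}"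
  shows "is_zero (Db A) X"
  by (rule Db_is_zero[OF zero_cpx_is_zero[OF assms]])

lemma zero_cpx_bounded: "gr (\<lambda>_. zero_mod) \<in> bounded_complexes A"
  using zero_mod_fg[OF ring] zero_mod_carrier by (intro gr_bounded[where J = "{}"]) auto

lemma zero_cpx: "is_zero (Ch A) (gr (\<lambda>_. zero_mod))"
  by (rule zero_cpx_is_zero[OF zero_cpx_bounded]) (simp add: zero_mod_carrier)

text \<open>Stalks are split off one degree at a time.\<close>

lemma gr_gen:
  assumes "finite J" "\<And>i. F i \<in> fg_modules A" "\<And>i. i \<notin> J \<Longrightarrow> carrier (F i) = {\<zero>\<^bsub>F i\<^esub>}"
    and stalks: "\<And>N n. N \<in> fg_modules A \<Longrightarrow> stalk N n \<in> gen (Db A) I"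
  shows "gr F \<in> gen (Db A) I"
  using assms(1-3)
proof (induction J arbitrary: F rule: finite_induct)
  case empty
  have "gr F \<in> bounded_complexes A" using empty by (intro gr_bounded[where J = "{}"]) auto
  then show ?case using empty by (intro gen.zero trivial_is_zero) auto
next
  case (insert n J)
  let ?G = "F(n := zero_mod)"
  have fg: "?G i \<in> fg_modules A" "((\<lambda>_. zero_mod)(n := F n)) i \<in> fg_modules A" for i
    using insert zero_mod_fg[OF ring] by auto
  have z: "carrier (?G i) = {\<zero>\<^bsub>?G i\<^esub>}" if "i \<notin> J" for i
    using insert(5)[of i] that zero_mod_carrier by auto
  have G: "gr ?G \<in> gen (Db A) I" by (rule insert.IH[OF fg(1) z])
  have lm: "left_module A (F i)" "left_module A zero_mod" for i
    using insert zero_mod_fg[OF ring] by (auto simp: fg_modules_def)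
  have "is_direct_sum (Ch A) (gr F) (stalk (F n) n) (gr ?G)"
    unfolding stalk_def
  proof (rule gr_direct_sum)
    show "gr F \<in> bounded_complexes A" using insert by (intro gr_bounded[where J = "insert n J"]) auto
    show "gr ((\<lambda>_. zero_mod)(n := F n)) \<in> bounded_complexes A"
      using stalk_bounded[of "F n" n] insert by (simp add: stalk_def)
    show "gr ?G \<in> bounded_complexes A" by (rule gen_Obj[OF G])
    fix m
    show "\<exists>i j. mod_sum A (F m) (((\<lambda>_. zero_mod)(n := F n)) m) (?G m) i j"
    proof (cases "m = n")
      case True
      then show ?thesis using mod_sum_zero[OF lm(1)[of n] lm(2) zero_mod_carrier] by auto
    next
      case False
      then show ?thesis
        using mod_sum_commute[OF lm(1) mod_sum_zero[OF lm(1)[of m] lm(2) zero_mod_carrier]] by auto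
    qed
  qed
  from gen.sum[OF stalks[of "F n"] G Db_is_direct_sum[OF this]] show ?case using insert by simp
qed

lemma stalk_gen_all:
  assumes dcc: "\<And>M. M \<in> fg_modules A \<Longrightarrow> dcc A M"
    and S: "S \<subseteq> fg_modules A" "\<And>M. M \<in> fg_modules A \<Longrightarrow> indecomposable A M \<Longrightarrow> \<exists>N\<in>S. mod_iso A M N"
    and gen: "\<And>N. N \<in> S \<Longrightarrow> stalk N 0 \<in> gen (Db A) I"
    and M: "M \<in> fg_modules A"
  shows "stalk M n \<in> gen (Db A) I"
proof (rule stalk_gen[OF M, of 0])
  have lm: "left_module A N" if "N \<in> fg_modules A" for N using that by (simp add: fg_modules_def)
  note Z = zero_mod_fg[OF ring]
  show "stalk M 0 \<in> gen (Db A) I"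
  proof (rule fg_module_induct[OF dcc M])
    fix N assume N: "N \<in> fg_modules A"
    {
      assume "carrier N = {\<zero>\<^bsub>N\<^esub>}"
      then have "carrier (Term (stalk N 0) i) = {\<zero>\<^bsub>Term (stalk N 0) i\<^esub>}" for i
        by (simp add: stalk_def zero_mod_carrier)
      then show "stalk N 0 \<in> gen (Db A) I" by (intro gen.zero trivial_is_zero stalk_bounded N)
    next
      assume "indecomposable A N"
      with S(2)[OF N] obtain N' f where N': "N' \<in> S" "f \<in> mod_hom A N N'" "bij_betw f (carrier N) (carrier N')"
        unfolding mod_iso_def by blast
      have "N' \<in> fg_modules A" using S(1) N'(1) by blast
      then have "is_direct_sum (Db A) (stalk N' 0) (stalk N 0) (stalk zero_mod 0)"
        by (intro stalk_direct_sum[OF _ N Z mod_sum_iso[OF lm[OF N] lm lm[OF Z] N'(2,3) zero_mod_carrier]])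
      with gen[OF N'(1)] show "stalk N 0 \<in> gen (Db A) I" by (rule gen.summand)
    next
      fix L L' assume L: "submodule L A N" "submodule L' A N" "L <+>\<^bsub>N\<^esub> L' = carrier N" "L \<inter> L' = {\<zero>\<^bsub>N\<^esub>}"
        and fg: "N\<lparr>carrier := L\<rparr> \<in> fg_modules A" "N\<lparr>carrier := L'\<rparr> \<in> fg_modules A"
        and g: "stalk (N\<lparr>carrier := L\<rparr>) 0 \<in> gen (Db A) I" "stalk (N\<lparr>carrier := L'\<rparr>) 0 \<in> gen (Db A) I"
      show "stalk N 0 \<in> gen (Db A) I"
        by (rule gen.sum[OF g stalk_direct_sum[OF N fg mod_sum_internal[OF lm[OF N] L]]])
    }
  qed
qed

text \<open>The module \<open>M\<close> is the direct sum of the modules in \<open>S\<close>.\<close>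

lemma finite_sum_module:
  assumes "finite S" "S \<subseteq> fg_modules A"
  shows "\<exists>M\<in>fg_modules A. \<forall>I. stalk M 0 \<in> gen (Db A) I \<longrightarrow> (\<forall>N\<in>S. stalk N 0 \<in> gen (Db A) I)"
  using assms
proof (induction S rule: finite_induct)
  case empty
  then show ?case using zero_mod_fg[OF ring] by blast
next
  case (insert N S)
  then obtain M where M: "M \<in> fg_modules A"
    "\<And>I N. stalk M 0 \<in> gen (Db A) I \<Longrightarrow> N \<in> S \<Longrightarrow> stalk N 0 \<in> gen (Db A) I" by auto
  have N: "N \<in> fg_modules A" using insert by simp
  have lm: "left_module A M" "left_module A N" using M N by (auto simp: fg_modules_def)
  note P = mod_prod_fg[OF N M(1)]
  note ms = mod_sum_prod[OF lm(2,1)]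
  note d = stalk_direct_sum[OF P N M(1) ms, of 0]
    stalk_direct_sum[OF P M(1) N mod_sum_commute[OF mod_prod_left_module[OF lm(2,1)] ms], of 0]
  have "\<forall>N'\<in>insert N S. stalk N' 0 \<in> gen (Db A) I" if "stalk (mod_prod N M) 0 \<in> gen (Db A) I" for I
    using gen.summand[OF that d(1)] M(2)[OF gen.summand[OF that d(2)]] by blast
  then show ?case using P by blast
qed

text \<open>The cone of \<open>0 \<rightarrow> Y\<close> is \<open>Y\<close>. This is how \<open>\<langle>Y\<rangle>\<close> embeds into \<open>\<langle>Y\<rangle>\<^sub>1\<close>, which is built from the zero
  objects.\<close>

lemma star_zero:
  assumes Y: "Y \<in> bounded_complexes A"
  shows "Y \<in> star (Db A) {Z. is_zero (Db A) Z} (gen (Db A) {Y})"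
proof -
  let ?Z = "gr (\<lambda>_. zero_mod)"
  note Z = zero_cpx_bounded and zero = zero_cpx
  obtain f where f: "(?Z, f, Y) \<in> chain_maps A"
    using zero Y unfolding is_zero_def Ch_Hom by auto
  let ?C = "cone (?Z, f, Y)"
  have "\<exists>a. a \<in> Hom (Ch A) ?Z (?C)"
    using zero cone_bounded[OF f] unfolding is_zero_def Ch_simps by blast
  then obtain j where j: "(?Z, j, ?C) \<in> chain_maps A" by (auto simp: Ch_Hom)
  have ci: "(Y, \<lambda>i. \<lambda>y\<in>carrier (Term Y i). Couple \<zero>\<^bsub>zero_mod\<^esub> y, ?C) \<in> chain_maps A"
    using cone_in_chain_map[OF f] by (simp add: cone_in_def)
  interpret Y: left_module A "Term Y i" for i by (rule bc_module[OF Y])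
  interpret Z: left_module A zero_mod using zero_mod_fg[OF ring] by (simp add: fg_modules_def)
  have j0: "j n \<zero>\<^bsub>zero_mod\<^esub> = Couple \<zero>\<^bsub>zero_mod\<^esub> \<zero>\<^bsub>Term Y n\<^esub>" for n
    using mod_hom_zero[OF chain_map_hom[OF j] bc_module[OF Z] bc_module[OF cone_bounded[OF f]], of n] by simp
  have "is_direct_sum (Ch A) (?C) Y ?Z"
  proof (rule Ch_is_direct_sum[OF ci j])
    fix n s assume "s \<in> carrier (Term (?C) n)"
    then obtain y where "s = Couple \<zero>\<^bsub>zero_mod\<^esub> y" "y \<in> carrier (Term Y n)" by (auto simp: zero_mod_carrier)
    then show "\<exists>x\<in>carrier (Term Y n). \<exists>z\<in>carrier (Term ?Z n).
        s = (\<lambda>y\<in>carrier (Term Y n). Couple \<zero>\<^bsub>zero_mod\<^esub> y) x \<oplus>\<^bsub>Term (?C) n\<^esub> j n z"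
      by (intro bexI[of _ y] bexI[of _ "\<zero>\<^bsub>zero_mod\<^esub>"]) (simp_all add: j0)
  next
    fix n x z assume "x \<in> carrier (Term Y n)" "z \<in> carrier (Term ?Z n)"
      "(\<lambda>y\<in>carrier (Term Y n). Couple \<zero>\<^bsub>zero_mod\<^esub> y) x \<oplus>\<^bsub>Term (?C) n\<^esub> j n z =
        \<zero>\<^bsub>Term (?C) n\<^esub>"
    then show "x = \<zero>\<^bsub>Term Y n\<^esub> \<and> z = \<zero>\<^bsub>Term ?Z n\<^esub>" by (simp add: zero_mod_carrier j0)
  qed
  then have sum: "is_direct_sum (Db A) (?C) Y ?Z" by (rule Db_is_direct_sum)
  have "Y \<in> gen (Db A) {Y}" using Y by (intro gen.base) auto
  from gen.sum[OF this gen.zero[OF Db_is_zero[OF zero]] sum]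
  have "?C \<in> gen (Db A) {Y}" .
  with Db_is_zero[OF zero] show ?thesis by (intro star_coneI[OF f] CollectI)
qed

text \<open>The triangle \<open>B \<rightarrow> X \<rightarrow> X / B\<close>. In the cone of \<open>f : B \<rightarrow> X\<close> the differential is
  \<open>(b, x) \<mapsto> (0, b + d x)\<close>, so a cycle \<open>(b, x)\<close> is determined by \<open>x\<close>, with \<open>b = - d x\<close>, and the boundaries
  are the pairs \<open>(0, x)\<close> with \<open>x\<close> in \<open>B\<close>. Hence the projection to \<open>X / B\<close> is a quasi-isomorphism.\<close>

lemma boundaries_triangle:
  assumes X: "X \<in> bounded_complexes A"
    and stalks: "\<And>N n. N \<in> fg_modules A \<Longrightarrow> stalk N n \<in> gen (Db A) I"
  shows "X \<in> star (Db A) (gen (Db A) I) (gen (Db A) I)"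
proof -
  interpret X: left_module A "Term X n" for n by (rule bc_module[OF X])
  note BX = boundaries_submodule[OF X]
  define B where "B n = (Term X n)\<lparr>carrier := boundaries X n\<rparr>" for n
  have B: "carrier (B n) = boundaries X n" "\<zero>\<^bsub>B n\<^esub> = \<zero>\<^bsub>Term X n\<^esub>" for n by (simp_all add: B_def)
  have lB: "left_module A (B n)" for n unfolding B_def by (rule X.submodule_left_module[OF BX])
  have Bfg: "B n \<in> fg_modules A" for n
  proof -
    have "Dif X (n - 1) \<in> mod_hom A (Term X (n - 1)) (B n)"
      using bc_Dif_pred[OF X, of n] by (auto simp: mod_hom_def B_def boundaries_def)
    moreover have "fin_gen A (Term X (n - 1))" using bc_fg[OF X] by (simp add: fg_modules_def)
    ultimately have "fin_gen A (B n)"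
      by (intro fin_gen_image[OF X.left_module_axioms _ lB]) (auto simp: B boundaries_def)
    then show ?thesis using lB by (simp add: fg_modules_def)
  qed
  have "\<forall>n. \<exists>Q \<pi>. Q \<in> fg_modules A \<and> \<pi> \<in> mod_hom A (Term X n) Q \<and> \<pi> ` carrier (Term X n) = carrier Q \<and>
    (\<forall>x\<in>carrier (Term X n). \<pi> x = \<zero>\<^bsub>Q\<^esub> \<longleftrightarrow> x \<in> boundaries X n)"
    using quotient_exists[OF bc_fg[OF X] BX] by blast
  then obtain Q \<pi> where Qfg: "\<And>n. Q n \<in> fg_modules A" and \<pi>: "\<And>n. \<pi> n \<in> mod_hom A (Term X n) (Q n)"
    and \<pi>s: "\<And>n. \<pi> n ` carrier (Term X n) = carrier (Q n)"
    and \<pi>0: "\<And>n x. x \<in> carrier (Term X n) \<Longrightarrow> \<pi> n x = \<zero>\<^bsub>Q n\<^esub> \<longleftrightarrow> x \<in> boundaries X n"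
    by metis
  let ?J = "{i. carrier (Term X i) \<noteq> {\<zero>\<^bsub>Term X i\<^esub>}}"
  have Bz: "carrier (B n) = {\<zero>\<^bsub>B n\<^esub>}" if "n \<notin> ?J" for n
    using that X.submodule_subset[OF BX, of n] X.submodule_zero[OF BX, of n] by (auto simp: B)
  have lQ: "left_module A (Q n)" for n using Qfg by (simp add: fg_modules_def)
  interpret Q: left_module A "Q n" for n by (rule lQ)
  have Qz: "carrier (Q n) = {\<zero>\<^bsub>Q n\<^esub>}" if "n \<notin> ?J" for n
    using that \<pi>s[of n] mod_hom_zero[OF \<pi> X.left_module_axioms lQ, of n] by auto
  have gB: "gr B \<in> gen (Db A) I" by (rule gr_gen[OF bc_finite[OF X] Bfg Bz stalks])
  have gQ: "gr Q \<in> gen (Db A) I" by (rule gr_gen[OF bc_finite[OF X] Qfg Qz stalks])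
  define f where "f n = (\<lambda>x\<in>boundaries X n. x)" for n
  have f: "(gr B, f, X) \<in> chain_maps A"
  proof (rule chain_mapsI[OF gen_Obj[OF gB] X])
    show "f n \<in> mod_hom A (Term (gr B) n) (Term X n)" for n
      using X.submodule_subset[OF BX] X.submodule_add[OF BX] X.submodule_smult[OF BX]
      by (intro mod_homI) (auto simp: f_def B_def)
    show "f (n + 1) (Dif (gr B) n x) = Dif X n (f n x)" if "x \<in> carrier (Term (gr B) n)" for n x
      using that boundaries_subset_cycles[OF X, of x n] X.submodule_zero[OF BX]
      by (simp add: f_def B cycles_def)
  qed
  let ?C = "cone (gr B, f, X)"
  define g where "g n = (\<lambda>p\<in>carrier (Term ?C n). \<pi> n (csnd p))" for n
  have C: "?C \<in> bounded_complexes A" by (rule cone_bounded[OF f])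
  have DC: "Dif ?C n (Couple b x) = Couple \<zero>\<^bsub>Term X (n + 2)\<^esub> (b \<oplus>\<^bsub>Term X (n + 1)\<^esub> Dif X n x)"
    if "b \<in> boundaries X (n + 1)" "x \<in> carrier (Term X n)" for n b x
  proof -
    interpret B: left_module A "B m" for m by (rule lB)
    show ?thesis using that B.M.a_inv_zero[of "n + 2"] by (simp add: B f_def add.assoc)
  qed
  have dB: "Dif X n x \<in> boundaries X (n + 1)" if "x \<in> carrier (Term X n)" for n x
    using that by (auto simp: boundaries_def)
  have bc: "b \<in> carrier (Term X n)" if "b \<in> boundaries X n" for b n
    using that X.submodule_subset[OF BX] by blast
  have g: "(?C, g, gr Q) \<in> chain_maps A"
  proof (rule chain_mapsI[OF C gen_Obj[OF gQ]])
    show "g n \<in> mod_hom A (Term ?C n) (Term (gr Q) n)" for n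
      using mod_hom_closed[OF \<pi>] X.submodule_add[OF BX] X.submodule_smult[OF BX]
      by (intro mod_homI)
        (auto simp: g_def B_def mod_hom_add[OF \<pi>] mod_hom_smult[OF \<pi>] X.smult_closed)
    fix n p assume "p \<in> carrier (Term ?C n)"
    then obtain b x where p: "p = Couple b x" "b \<in> boundaries X (n + 1)" "x \<in> carrier (Term X n)"
      by (auto simp: B)
    have s: "b \<oplus>\<^bsub>Term X (n + 1)\<^esub> Dif X n x \<in> boundaries X (n + 1)"
      by (rule X.submodule_add[OF BX p(2) dB[OF p(3)]])
    have "\<pi> (n + 1) (b \<oplus>\<^bsub>Term X (n + 1)\<^esub> Dif X n x) = \<zero>\<^bsub>Q (n + 1)\<^esub>"
      using \<pi>0[OF bc[OF s]] s by simp
    then show "g (n + 1) (Dif ?C n p) = Dif (gr Q) n (g n p)"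
      using p DC[OF p(2,3)] bc[OF s] X.submodule_zero[OF BX, of "n + 2"] mod_hom_closed[OF \<pi> p(3)]
      by (simp add: g_def B add.assoc)
  qed
  have qi: "(?C, g, gr Q) \<in> quasi_isos A"
  proof (rule quasi_isoI[OF g])
    fix n z assume z: "z \<in> cycles ?C n" and gz: "g n z \<in> boundaries (gr Q) n"
    then obtain b x where p: "z = Couple b x" "b \<in> boundaries X (n + 1)" "x \<in> carrier (Term X n)"
      by (auto simp: cycles_def B)
    have "g n z = \<zero>\<^bsub>Q n\<^esub>" using gz by (auto simp: boundaries_def)
    then have x: "x \<in> boundaries X n" using \<pi>0[OF p(3)] p by (simp add: g_def B)
    have dx: "Dif X n x = \<zero>\<^bsub>Term X (n + 1)\<^esub>" using boundaries_subset_cycles[OF X x] by (simp add: cycles_def)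
    have "b \<oplus>\<^bsub>Term X (n + 1)\<^esub> Dif X n x = \<zero>\<^bsub>Term X (n + 1)\<^esub>"
      using z DC[OF p(2,3)] by (simp add: cycles_def p(1) add.assoc B)
    then have b: "b = \<zero>\<^bsub>Term X (n + 1)\<^esub>" using bc[OF p(2)] by (simp add: dx)
    have "Dif X (n - 1) \<zero>\<^bsub>Term X (n - 1)\<^esub> = \<zero>\<^bsub>Term X n\<^esub>"
      by (rule mod_hom_zero[OF bc_Dif_pred[OF X] X.left_module_axioms X.left_module_axioms])
    then have "Dif ?C (n - 1) (Couple x \<zero>\<^bsub>Term X (n - 1)\<^esub>) = z"
      using DC[of x "n - 1" "\<zero>\<^bsub>Term X (n - 1)\<^esub>"] x p(3) by (simp add: p(1) b add.commute)
    moreover have "Couple x \<zero>\<^bsub>Term X (n - 1)\<^esub> \<in> carrier (Term ?C (n - 1))" using x by (simp add: B)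
    ultimately show "z \<in> boundaries ?C n" unfolding boundaries_def by blast
  next
    fix n y assume "y \<in> cycles (gr Q) n"
    then have y: "y \<in> carrier (Q n)" by (simp add: cycles_def)
    then obtain x where x: "x \<in> carrier (Term X n)" "y = \<pi> n x" using \<pi>s[of n] by blast
    let ?z = "Couple (\<ominus>\<^bsub>Term X (n + 1)\<^esub> Dif X n x) x"
    have b: "\<ominus>\<^bsub>Term X (n + 1)\<^esub> Dif X n x \<in> boundaries X (n + 1)"
      by (rule X.submodule_minus[OF BX dB[OF x(1)]])
    have "?z \<in> cycles ?C n"
      using DC[OF b x(1)] b x bc[OF dB[OF x(1)]] by (simp add: cycles_def B add.assoc X.M.l_neg)
    moreover have "g n ?z \<ominus>\<^bsub>Term (gr Q) n\<^esub> y \<in> boundaries (gr Q) n"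
    proof -
      have "g n ?z \<ominus>\<^bsub>Term (gr Q) n\<^esub> y = \<zero>\<^bsub>Term (gr Q) n\<^esub>"
        using b x y by (simp add: g_def B Q.M.minus_eq Q.M.r_neg)
      then show ?thesis
        using Q.submodule_zero[OF boundaries_submodule[OF gen_Obj[OF gQ], of n, unfolded gr_simps]] by simp
    qed
    ultimately show "\<exists>z\<in>cycles ?C n. g n z \<ominus>\<^bsub>Term (gr Q) n\<^esub> y \<in> boundaries (gr Q) n" by blast
  qed
  have "?C \<in> gen (Db A) I"
    using gen.sum[OF gQ gen.zero[OF Db_is_zero[OF zero_cpx]]
      Db_is_direct_sum_quasi_iso[OF qi zero_cpx]] .
  then show ?thesis by (rule star_coneI[OF f gB])
qed

end
theorem mainTheorem2:
  fixes K :: "('k, 'q) ring_scheme" and \<phi> :: "'k \<Rightarrow> 'a" and A :: "('a, 'r) ring_scheme"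
  assumes "artin_algebra K \<phi> A" and "rep_finite A"
  shows "tri_dim (Db A) \<le> 1"
proof -
  have ring: "ring A" using assms(1) by (simp add: artin_algebra_def)
  have dcc: "dcc A M" if "M \<in> fg_modules A" for M
    using artin_algebra_dcc[OF assms(1)] that by (auto simp: fg_modules_def)
  obtain S where S: "finite S" "S \<subseteq> fg_modules A"
    "\<And>M. M \<in> fg_modules A \<Longrightarrow> indecomposable A M \<Longrightarrow> \<exists>N\<in>S. mod_iso A M N"
    using assms(2) unfolding rep_finite_def by blast
  obtain M where M: "M \<in> fg_modules A"
    "\<And>I N. stalk M 0 \<in> gen (Db A) I \<Longrightarrow> N \<in> S \<Longrightarrow> stalk N 0 \<in> gen (Db A) I"
    using finite_sum_module[OF ring S(1,2)] by auto
  let ?M = "stalk M 0"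
  have Mb: "?M \<in> bounded_complexes A" by (rule stalk_bounded[OF ring M(1)])
  have stalks: "stalk N n \<in> gen (Db A) {?M}" if "N \<in> fg_modules A" for N n
    using stalk_gen_all[OF ring dcc S(2,3) M(2) that] gen.base[of ?M "{?M}" "Db A"] Mb by simp
  \<comment> \<open>membership in the first step of the filtration reduces to the generator itself\<close>
  have one: "gen (Db A) {?M} \<subseteq> gen_n (Db A) {?M} 1"
  proof
    fix X assume X: "X \<in> gen (Db A) {?M}"
    have "?M \<in> gen_n (Db A) {?M} 1"
      using star_zero[OF ring Mb] Mb by (auto simp: diamond_def intro!: gen.base)
    then show "X \<in> gen_n (Db A) {?M} 1"
      using gen_mono[OF _ X] by (simp add: diamond_def)
  qed
  have "X \<in> gen_n (Db A) {?M} 2" if X: "X \<in> bounded_complexes A" for X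
  proof -
    have "X \<in> star (Db A) (gen_n (Db A) {?M} 1) (gen (Db A) {?M})"
      using boundaries_triangle[OF ring X stalks] one by (auto simp: star_def)
    then show ?thesis using X by (simp add: numeral_2_eq_2 diamond_def gen.base)
  qed
  moreover have "gen_n (Db A) {?M} 2 \<subseteq> bounded_complexes A"
    using gen_Obj by (auto simp: numeral_2_eq_2 diamond_def)
  ultimately have "gen_n (Db A) {?M} 2 = Obj (Db A)" by (simp only: Db_simps) blast
  then have "gen_n (Db A) {?M} (1 + 1) = Obj (Db A)" by (simp only: one_add_one)
  then have "enat 1 \<in> {enat d | d. \<exists>M\<in>Obj (Db A). gen_n (Db A) {M} (d + 1) = Obj (Db A)}"
    using Mb by (simp only: Db_simps) blast
  then show ?thesis unfolding tri_dim_def one_enat_def by (rule Inf_lower)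
qed

end
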